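(* Let $\mathbb{K}$ be a field of characteristic $0$, $l>2$ an odd integer, $\epsilon\in\mathbb{K}$ a primitive $l$-th root of unity, and $m\le n$ positive integers. The discriminant of the algebra of rectangular quantum matrices at $\epsilon$ is given by $$d(R_\epsilon[M_{m,n}]/C_\epsilon[M_{m,n}])=_{\mathbb{K}^\times}\prod_{j=1}^{m-1}\big(\Delta_{[m-j+1,m];[1,j]}^L\,\Delta_{[1,j];[n-j+1,n]}^L\big)\prod_{k=1}^{n-m+1}\Delta_{[1,m];[k,m+k-1]}^L,$$ where $L:=l^{mn-1}(l-1)$.
   Context: $R_q[M_{m,n}]$ is the $\mathbb{K}[q^{\pm1}]$-algebra with generators $x_{ij}$, $1\le i\le m$, $1\le j\le n$, and relations: $x_{ij}x_{kj}=q\,x_{kj}x_{ij}$ for $i<k$; $x_{ij}x_{ir}=q\,x_{ir}x_{ij}$ for $j<r$; $x_{ij}x_{kr}=x_{kr}x_{ij}$ for $i<k,\ j>r$; $x_{ij}x_{kr}-x_{kr}x_{ij}=(q-q^{-1})x_{ir}x_{kj}$ for $i<k,\ j<r$ (with $i,k\in[1,m]$, $j,r\in[1,n]$). Set $R_\epsilon[M_{m,n}]:=R_q[M_{m,n}]/(q-\epsilon)R_q[M_{m,n}]$ with projection $\sigma$, and $z_{ij}:=\sigma(x_{ij})^l$. The $z_{ij}$ are central; $C_\epsilon[M_{m,n}]$ is the subalgebra generated by them. It is a polynomial algebra over $\mathbb{K}$ in the $z_{ij}$, and $R_\epsilon[M_{m,n}]$ is a free $C_\epsilon[M_{m,n}]$-module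 of rank $l^{mn}$. $[i,j]:=\{i,\dots,j\}$; $\Delta_{I;J}$ is the minor of the matrix $(z_{ij})$ with rows in $I$ and columns in $J$. Discriminant: if an algebra $S$ is free of rank $N$ over a central subalgebra $C$, the embedding $S\hookrightarrow M_N(C)$ (left multiplication in a $C$-basis) composed with the matrix trace gives $\mathrm{tr}:S\to C$, and $d(S/C):=\det([\mathrm{tr}(y_iy_j)]_{i,j=1}^N)$ for a $C$-basis $\{y_i\}$, well defined up to units of $C$. $a=_{\mathbb{K}^\times}b$ means $a=ub$ with $u\in\mathbb{K}^\times$. *)

theory Defs
  imports "HOL-Algebra.Algebra" "HOL-Library.Poly_Mapping" "HOL-Combinatorics.Permutations"
begin

subsection \<open>Free algebras\<close>

text \<open>
  The free monoid is a copy of the type of lists, so that it can be made an instance of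
  \<^class>\<open>monoid_add\<close> (concatenation is written additively). Then \<open>'x fword \<Rightarrow>\<^sub>0 'r\<close>, with the
  convolution product of \<^theory>\<open>HOL-Library.Poly_Mapping\<close>, is the free \<open>'r\<close>-algebra on \<open>'x\<close>.
\<close>

datatype 'x fword = FWord (letters: "'x list")

instantiation fword :: (type) monoid_add
begin

definition zero_fword :: "'a fword" where
  "zero_fword = FWord []"

definition plus_fword :: "'a fword \<Rightarrow> 'a fword \<Rightarrow> 'a fword" where
  "plus_fword v w = FWord (letters v @ letters w)"

instance
  by standard (simp_all add: zero_fword_def plus_fword_def)

end

definition free_algebra :: "'x set \<Rightarrow> ('x fword \<Rightarrow>\<^sub>0 'r::comm_ring_1) ring" where
  "free_algebra V =
     \<lparr>carrier = {p. \<forall>w\<in>Poly_Mapping.keys p. set (letters w) \<subseteq> V},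
      monoid.mult = (*), one = 1, ring.zero = 0, add = (+)\<rparr>"

definition gen :: "'x \<Rightarrow> ('x fword \<Rightarrow>\<^sub>0 'r::comm_ring_1)" where
  "gen x = Poly_Mapping.single (FWord [x]) 1"

definition scal :: "'r::comm_ring_1 \<Rightarrow> ('x fword \<Rightarrow>\<^sub>0 'r)" where
  "scal c = Poly_Mapping.single 0 c"

subsection \<open>Laurent polynomials\<close>

type_synonym 'k laurent = "int \<Rightarrow>\<^sub>0 'k"

definition qpow :: "int \<Rightarrow> 'k::field laurent" where
  "qpow e = Poly_Mapping.single e 1"

definition lconst :: "'k::field \<Rightarrow> 'k laurent" where
  "lconst a = Poly_Mapping.single 0 a"

subsection \<open>Rectangular quantum matrices\<close>

type_synonym 'k qfree = "(nat \<times> nat) fword \<Rightarrow>\<^sub>0 'k laurent"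

definition qfree_algebra :: "nat \<Rightarrow> nat \<Rightarrow> 'k::field qfree ring" where
  "qfree_algebra m n = free_algebra ({1..m} \<times> {1..n})"

definition qmat_relations :: "nat \<Rightarrow> nat \<Rightarrow> 'k::field qfree set" where
  "qmat_relations m n =
     {gen (i,j) * gen (k,j) - scal (qpow 1) * (gen (k,j) * gen (i,j)) | i k j.
        i \<in> {1..m} \<and> k \<in> {1..m} \<and> j \<in> {1..n} \<and> i < k} \<union>
     {gen (i,j) * gen (i,r) - scal (qpow 1) * (gen (i,r) * gen (i,j)) | i j r.
        i \<in> {1..m} \<and> j \<in> {1..n} \<and> r \<in> {1..n} \<and> j < r} \<union>
     {gen (i,j) * gen (k,r) - gen (k,r) * gen (i,j) | i k j r.
        i \<in> {1..m} \<and> k \<in> {1..m} \<and> j \<in> {1..n} \<and> r \<in> {1..n} \<and> i < k \<and> j > r} \<union>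
     {(gen (i,j) * gen (k,r) - gen (k,r) * gen (i,j))
        - scal (qpow 1 - qpow (- 1)) * (gen (i,r) * gen (k,j)) | i k j r.
        i \<in> {1..m} \<and> k \<in> {1..m} \<and> j \<in> {1..n} \<and> r \<in> {1..n} \<and> i < k \<and> j < r}"

definition qmat_ideal :: "nat \<Rightarrow> nat \<Rightarrow> 'k::field qfree set" where
  "qmat_ideal m n = Idl\<^bsub>qfree_algebra m n\<^esub> (qmat_relations m n)"

definition Rq :: "nat \<Rightarrow> nat \<Rightarrow> 'k::field qfree set ring" where
  "Rq m n = qfree_algebra m n Quot qmat_ideal m n"

definition Rq_class :: "nat \<Rightarrow> nat \<Rightarrow> 'k::field qfree \<Rightarrow> 'k qfree set" where
  "Rq_class m n p = qmat_ideal m n +>\<^bsub>qfree_algebra m n\<^esub> p"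

subsection \<open>Specialization at a root of unity\<close>

text \<open>Since \<open>q - \<epsilon>\<close> is central, the set \<open>(q - \<epsilon>) R\<^sub>q\<close> is a two-sided ideal.\<close>

definition spec_ideal :: "nat \<Rightarrow> nat \<Rightarrow> 'k::field \<Rightarrow> 'k qfree set set" where
  "spec_ideal m n \<epsilon> =
     (\<lambda>r. Rq_class m n (scal (qpow 1 - lconst \<epsilon>)) \<otimes>\<^bsub>Rq m n\<^esub> r) ` carrier (Rq m n)"

definition Reps :: "nat \<Rightarrow> nat \<Rightarrow> 'k::field \<Rightarrow> 'k qfree set set ring" where
  "Reps m n \<epsilon> = Rq m n Quot spec_ideal m n \<epsilon>"

definition sigma :: "nat \<Rightarrow> nat \<Rightarrow> 'k::field \<Rightarrow> 'k qfree set \<Rightarrow> 'k qfree set set" where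
  "sigma m n \<epsilon> r = spec_ideal m n \<epsilon> +>\<^bsub>Rq m n\<^esub> r"

definition Reps_scalar :: "nat \<Rightarrow> nat \<Rightarrow> 'k::field \<Rightarrow> 'k \<Rightarrow> 'k qfree set set" where
  "Reps_scalar m n \<epsilon> a = sigma m n \<epsilon> (Rq_class m n (scal (lconst a)))"

definition zgen :: "nat \<Rightarrow> nat \<Rightarrow> nat \<Rightarrow> 'k::field \<Rightarrow> nat \<Rightarrow> nat \<Rightarrow> 'k qfree set set" where
  "zgen m n l \<epsilon> i j = sigma m n \<epsilon> (Rq_class m n (gen (i,j))) [^]\<^bsub>Reps m n \<epsilon>\<^esub> l"

text \<open>The subalgebra generated by the \<open>z\<^sub>i\<^sub>j\<close> is the subring generated by them and the scalars.\<close>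

definition Ceps_carrier :: "nat \<Rightarrow> nat \<Rightarrow> nat \<Rightarrow> 'k::field \<Rightarrow> 'k qfree set set set" where
  "Ceps_carrier m n l \<epsilon> =
     generate_ring (Reps m n \<epsilon>)
       (range (Reps_scalar m n \<epsilon>) \<union> {zgen m n l \<epsilon> i j | i j. i \<in> {1..m} \<and> j \<in> {1..n}})"

definition Ceps :: "nat \<Rightarrow> nat \<Rightarrow> nat \<Rightarrow> 'k::field \<Rightarrow> 'k qfree set set ring" where
  "Ceps m n l \<epsilon> = (Reps m n \<epsilon>)\<lparr>carrier := Ceps_carrier m n l \<epsilon>\<rparr>"

subsection \<open>Determinants and minors over a commutative ring given by a record\<close>

definition rdet :: "('a, 'b) ring_scheme \<Rightarrow> nat \<Rightarrow> (nat \<Rightarrow> nat \<Rightarrow> 'a) \<Rightarrow> 'a" where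
  "rdet C N A =
     (\<Oplus>\<^bsub>C\<^esub>p\<in>{p. p permutes {..<N}}. [sign p] \<cdot>\<^bsub>C\<^esub> (\<Otimes>\<^bsub>C\<^esub>i\<in>{..<N}. A i (p i)))"

text \<open>
  Rows in \<open>I\<close> and columns in \<open>J\<close>, both listed increasingly; only meant for finite \<open>I\<close>, \<open>J\<close>
  of the same cardinality.
\<close>

definition rminor :: "('a, 'b) ring_scheme \<Rightarrow> (nat \<Rightarrow> nat \<Rightarrow> 'a) \<Rightarrow> nat set \<Rightarrow> nat set \<Rightarrow> 'a" where
  "rminor C A I J =
     rdet C (card I) (\<lambda>r s. A (sorted_list_of_set I ! r) (sorted_list_of_set J ! s))"

definition Delta ::
  "nat \<Rightarrow> nat \<Rightarrow> nat \<Rightarrow> 'k::field \<Rightarrow> nat set \<Rightarrow> nat set \<Rightarrow> 'k qfree set set" where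
  "Delta m n l \<epsilon> I J = rminor (Ceps m n l \<epsilon>) (zgen m n l \<epsilon>) I J"

subsection \<open>Discriminants\<close>

text \<open>In this section \<open>C\<close> is the carrier of a subring of \<open>S\<close>.\<close>

definition central_subring :: "('a, 'b) ring_scheme \<Rightarrow> 'a set \<Rightarrow> bool" where
  "central_subring S C \<longleftrightarrow>
     subring C S \<and> (\<forall>c\<in>C. \<forall>s\<in>carrier S. c \<otimes>\<^bsub>S\<^esub> s = s \<otimes>\<^bsub>S\<^esub> c)"

definition is_coords ::
  "('a, 'b) ring_scheme \<Rightarrow> 'a set \<Rightarrow> nat \<Rightarrow> (nat \<Rightarrow> 'a) \<Rightarrow> 'a \<Rightarrow> (nat \<Rightarrow> 'a) \<Rightarrow> bool" where
  "is_coords S C N y s c \<longleftrightarrow>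
     c \<in> {..<N} \<rightarrow>\<^sub>E C \<and> s = (\<Oplus>\<^bsub>S\<^esub>i\<in>{..<N}. c i \<otimes>\<^bsub>S\<^esub> y i)"

definition free_basis :: "('a, 'b) ring_scheme \<Rightarrow> 'a set \<Rightarrow> nat \<Rightarrow> (nat \<Rightarrow> 'a) \<Rightarrow> bool" where
  "free_basis S C N y \<longleftrightarrow>
     y \<in> {..<N} \<rightarrow> carrier S \<and> (\<forall>s\<in>carrier S. \<exists>!c. is_coords S C N y s c)"

definition coords ::
  "('a, 'b) ring_scheme \<Rightarrow> 'a set \<Rightarrow> nat \<Rightarrow> (nat \<Rightarrow> 'a) \<Rightarrow> 'a \<Rightarrow> nat \<Rightarrow> 'a" where
  "coords S C N y s = (THE c. is_coords S C N y s c)"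

definition left_mult_matrix ::
  "('a, 'b) ring_scheme \<Rightarrow> 'a set \<Rightarrow> nat \<Rightarrow> (nat \<Rightarrow> 'a) \<Rightarrow> 'a \<Rightarrow> nat \<Rightarrow> nat \<Rightarrow> 'a" where
  "left_mult_matrix S C N b s i j = coords S C N b (s \<otimes>\<^bsub>S\<^esub> b j) i"

definition reg_trace ::
  "('a, 'b) ring_scheme \<Rightarrow> 'a set \<Rightarrow> nat \<Rightarrow> (nat \<Rightarrow> 'a) \<Rightarrow> 'a \<Rightarrow> 'a" where
  "reg_trace S C N b s = (\<Oplus>\<^bsub>S\<lparr>carrier := C\<rparr>\<^esub>i\<in>{..<N}. left_mult_matrix S C N b s i i)"

text \<open>
  The discriminant depends on a choice of basis (through a unit of \<open>C\<close>), so it is a predicate: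
  \<open>d\<close> is a discriminant of \<open>S\<close> over \<open>C\<close> if it is obtained from some finite \<open>C\<close>-basis \<open>b\<close> used
  for the trace and some \<open>C\<close>-basis \<open>y\<close> used for the Gram matrix. In particular, a discriminant
  exists iff \<open>C\<close> is central and \<open>S\<close> is free of finite rank over \<open>C\<close>.
\<close>

definition is_discriminant :: "('a, 'b) ring_scheme \<Rightarrow> 'a set \<Rightarrow> 'a \<Rightarrow> bool" where
  "is_discriminant S C d \<longleftrightarrow>
     central_subring S C \<and>
     (\<exists>N b y. free_basis S C N b \<and> free_basis S C N y \<and>
        d = rdet (S\<lparr>carrier := C\<rparr>) N (\<lambda>i j. reg_trace S C N b (y i \<otimes>\<^bsub>S\<^esub> y j)))"

subsection \<open>Roots of unity\<close>

definition primitive_root_of_unity :: "nat \<Rightarrow> 'k::field \<Rightarrow> bool" where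
  "primitive_root_of_unity l \<epsilon> \<longleftrightarrow> l > 0 \<and> \<epsilon> ^ l = 1 \<and> (\<forall>k. 0 < k \<and> k < l \<longrightarrow> \<epsilon> ^ k \<noteq> 1)"

end

theory Submission
  imports Defs "Jordan_Normal_Form.Determinant" "HOL-Library.Product_Lexorder"
begin

text \<open>
  Inverting Cauchon's deleting derivations algorithm embeds \<open>R\<^sub>\<epsilon>\<close> into a quantum torus: the generator
  \<open>x\<^sub>i\<^sub>j\<close> becomes a sum of Laurent monomials with leading term \<open>T\<^sub>i\<^sub>j\<close>. By the quantum binomial theorem
  \<open>l\<close>-th powers follow the same recursion with commuting entries \<open>t\<^sub>i\<^sub>j = T\<^sub>i\<^sub>j\<^sup>l\<close>, so \<open>C\<^sub>\<epsilon>\<close> embeds into the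
  Laurent ring \<open>Z\<close> of the \<open>t\<^sub>i\<^sub>j\<close>, and each minor of the theorem becomes the product of the \<open>t\<^sub>i\<^sub>j\<close> along
  its diagonal. These diagonals partition the matrix, so the right hand side becomes the product of
  all \<open>t\<^sub>i\<^sub>j\<^sup>L\<close>.

  Undoing the recursion shows that the torus is spanned by \<open>R\<^sub>\<epsilon>\<close> over \<open>Z\<close>. Hence a \<open>C\<^sub>\<epsilon>\<close>-basis of \<open>R\<^sub>\<epsilon>\<close> is also a
  \<open>Z\<close>-basis of the torus, and it differs from the basis of monomials \<open>T\<^sup>\<alpha>\<close>, \<open>0 \<le> \<alpha> < l\<close>, by a matrix whose
  determinant is a unit of \<open>Z\<close>; leading exponents show that this unit is a scalar. For the monomial basis the
  Gram matrix of the trace is a permutation matrix with monomial entries, whose determinant is a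
  scalar multiple of the product of all \<open>t\<^sub>i\<^sub>j\<^sup>L\<close>.
\<close>

section \<open>Quantum matrices built row by row\<close>

text \<open>The product of the quantum torus depends on \<epsilon>, so it is carried by linear
  operators on one commutative Laurent ring; \<open>\<Theta> s\<close>, the value at 1 of the
  operator of \<open>s\<close>, turns questions about a quotient of a quotient into questions about
  ordinary Laurent polynomials. Oddness of \<open>l\<close> enters twice: the square of \<epsilon>
  must again be primitive for the binomial theorem, and l must divide l(l-1)/2 for powers of
  products. Freeness over the central subring is proved rather than presupposed: straightening gives
  spanning, leading exponents that differ modulo \<open>l\<close> give independence. The trace is
  l^(mn) times the projection to exponents divisible by \<open>l\<close>, a nonzero factor in
  characteristic 0; hence a reduced monomial pairs only with the one of opposite exponent modulo
  \<open>l\<close>. Counting the reduced exponents that do not vanish at a fixed position gives the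
  number L. Base changes over the central subring have scalar determinants because leading exponents
  of algebra elements are nonnegative; passing to torus monomials inverts variables and needs a
  separate argument.\<close>

locale scalar_algebra =
  fixes sc :: "'k::field \<Rightarrow> 'a::ring_1 \<Rightarrow> 'a"
  assumes sc_add_right: "sc c (x + y) = sc c x + sc c y"
    and sc_add_left: "sc (c + d) x = sc c x + sc d x"
    and sc_sc: "sc c (sc d x) = sc (c * d) x"
    and sc_one [simp]: "sc 1 x = x"
    and sc_mult_left: "sc c x * y = sc c (x * y)"
    and sc_mult_right: "x * sc c y = sc c (x * y)"
begin

lemma sc_zero_right [simp]: "sc c 0 = 0"
  using sc_add_right[of c 0 0] by simp

lemma sc_zero_left [simp]: "sc 0 x = 0"
  using sc_add_left[of 0 0 x] by simp

lemma sc_sum: "sc c (sum f S) = (\<Sum>s\<in>S. sc c (f s))"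
  by (induction S rule: infinite_finite_induct) (auto simp: sc_add_right)

definition qcomm :: "'k \<Rightarrow> 'a \<Rightarrow> 'a \<Rightarrow> bool" where
  "qcomm c u v \<longleftrightarrow> u * v = sc c (v * u)"

lemma qcommD: "qcomm c u v \<Longrightarrow> u * v = sc c (v * u)"
  by (simp add: qcomm_def)

lemma qcomm_left_commute: "qcomm c u v \<Longrightarrow> u * (v * z) = sc c (v * (u * z))"
  by (metis qcomm_def mult.assoc sc_mult_left)

lemma qcomm_mult_left:
  assumes "qcomm c u w" "qcomm d v w" shows "qcomm (c * d) (u * v) w"
proof -
  have "u * v * w = sc d (u * w * v)"
    using assms(2) by (simp add: qcomm_def mult.assoc sc_mult_right)
  also have "\<dots> = sc (c * d) (w * (u * v))"
    using assms(1) by (simp add: qcomm_def mult.assoc sc_mult_left sc_sc mult.commute)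
  finally show ?thesis by (simp add: qcomm_def)
qed

lemma qcomm_mult_right:
  assumes "qcomm c w u" "qcomm d w v" shows "qcomm (c * d) w (u * v)"
proof -
  have "w * (u * v) = sc c (u * (w * v))"
    using assms(1) by (metis qcomm_left_commute)
  also have "\<dots> = sc (c * d) (u * v * w)"
    using assms(2) by (simp add: qcomm_def sc_mult_right sc_sc mult.assoc)
  finally show ?thesis by (simp add: qcomm_def)
qed

lemma qcomm_sym: "qcomm c u v \<Longrightarrow> c \<noteq> 0 \<Longrightarrow> qcomm (inverse c) v u"
  by (simp add: qcomm_def sc_sc)

lemma qcomm_inverse_left:
  assumes "qcomm c u v" "c \<noteq> 0" "u * u' = 1" "u' * u = 1"
  shows "qcomm (inverse c) u' v"
proof -
  have "v * u' = u' * (u * v) * u'"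
    using assms by (metis mult.assoc mult_1)
  also have "\<dots> = sc c (u' * v)"
    using assms by (simp add: qcomm_def sc_mult_left sc_mult_right mult.assoc)
  finally show ?thesis using assms(2) by (simp add: qcomm_def sc_sc)
qed

lemma qcomm_inverse_right:
  assumes "qcomm c v u" "c \<noteq> 0" "u * u' = 1" "u' * u = 1"
  shows "qcomm (inverse c) v u'"
  using qcomm_sym[OF qcomm_inverse_left[OF qcomm_sym[OF assms(1,2)] _ assms(3,4)]] assms(2)
  by simp

lemma qcomm_sum_left: "(\<And>s. s \<in> S \<Longrightarrow> qcomm c (f s) v) \<Longrightarrow> qcomm c (sum f S) v"
  by (simp add: qcomm_def sum_distrib_left sum_distrib_right sc_sum)

lemma qcomm_sum_right: "(\<And>s. s \<in> S \<Longrightarrow> qcomm c v (f s)) \<Longrightarrow> qcomm c v (sum f S)"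
  by (simp add: qcomm_def sum_distrib_left sum_distrib_right sc_sum)

lemma qcomm_self [simp]: "qcomm 1 u u"
  by (simp add: qcomm_def)

definition quantum_matrix :: "'k \<Rightarrow> nat \<Rightarrow> nat \<Rightarrow> (nat \<Rightarrow> nat \<Rightarrow> 'a) \<Rightarrow> bool" where
  "quantum_matrix q m n W \<longleftrightarrow>
     (\<forall>i k j. 1 \<le> i \<and> i < k \<and> k \<le> m \<and> j \<in> {1..n} \<longrightarrow> qcomm q (W i j) (W k j)) \<and>
     (\<forall>i j r. i \<in> {1..m} \<and> 1 \<le> j \<and> j < r \<and> r \<le> n \<longrightarrow> qcomm q (W i j) (W i r)) \<and>
     (\<forall>i k j r. 1 \<le> i \<and> i < k \<and> k \<le> m \<and> 1 \<le> r \<and> r < j \<and> j \<le> n \<longrightarrow> qcomm 1 (W i j) (W k r)) \<and>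
     (\<forall>i k j r. 1 \<le> i \<and> i < k \<and> k \<le> m \<and> 1 \<le> j \<and> j < r \<and> r \<le> n \<longrightarrow>
        W i j * W k r = W k r * W i j + sc (q - inverse q) (W i r * W k j))"

lemma quantum_matrixD:
  assumes "quantum_matrix q m n W"
  shows "\<And>i k j. 1 \<le> i \<Longrightarrow> i < k \<Longrightarrow> k \<le> m \<Longrightarrow> 1 \<le> j \<Longrightarrow> j \<le> n \<Longrightarrow> qcomm q (W i j) (W k j)"
    and "\<And>i j r. 1 \<le> i \<Longrightarrow> i \<le> m \<Longrightarrow> 1 \<le> j \<Longrightarrow> j < r \<Longrightarrow> r \<le> n \<Longrightarrow> qcomm q (W i j) (W i r)"
    and "\<And>i k j r. 1 \<le> i \<Longrightarrow> i < k \<Longrightarrow> k \<le> m \<Longrightarrow> 1 \<le> r \<Longrightarrow> r < j \<Longrightarrow> j \<le> n \<Longrightarrow>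
      qcomm 1 (W i j) (W k r)"
    and "\<And>i k j r. 1 \<le> i \<Longrightarrow> i < k \<Longrightarrow> k \<le> m \<Longrightarrow> 1 \<le> j \<Longrightarrow> j < r \<Longrightarrow> r \<le> n \<Longrightarrow>
      W i j * W k r = W k r * W i j + sc (q - inverse q) (W i r * W k j)"
  using assms by (auto simp: quantum_matrix_def)

end

section \<open>Appending a row of pivots to a quantum matrix\<close>

locale quantum_row_step = scalar_algebra sc for sc :: "'k::field \<Rightarrow> 'a::ring_1 \<Rightarrow> 'a" +
  fixes q :: 'k and m n :: nat and W :: "nat \<Rightarrow> nat \<Rightarrow> 'a" and y yi :: "nat \<Rightarrow> 'a"
  assumes q: "q \<noteq> 0"
    and W: "quantum_matrix q m n W"
    and y: "\<And>j r. 1 \<le> j \<Longrightarrow> j < r \<Longrightarrow> r \<le> n \<Longrightarrow> qcomm q (y j) (y r)"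
    and yi: "\<And>j. y j * yi j = 1" "\<And>j. yi j * y j = 1"
    and Wy: "\<And>i s j. \<lbrakk>1 \<le> i; i \<le> m; 1 \<le> s; s \<le> n; 1 \<le> j; j \<le> n\<rbrakk> \<Longrightarrow>
      qcomm (if s = j then q else 1) (W i s) (y j)"
begin

text \<open>Dividing column \<open>s\<close> by its pivot makes all commutation factors depend only
  on the relative order of the indices. They therefore pass to the tail sums \<open>A\<close> and
  the block sums \<open>B\<close>, and the new entries are \<open>A i j * y j\<close>.\<close>

definition "a i s = W i s * yi s"
definition "A i j = (\<Sum>s\<in>{j..n}. a i s)"
definition "B i j r = (\<Sum>s\<in>{j..<r}. a i s)"

lemma Wyi: "\<lbrakk>1 \<le> i; i \<le> m; 1 \<le> s; s \<le> n; 1 \<le> j; j \<le> n\<rbrakk> \<Longrightarrow>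
      qcomm (if s = j then inverse q else 1) (W i s) (yi j)"
  using qcomm_inverse_right[OF Wy _ yi, of i s j] q by (auto split: if_splits)

lemma yiW: "\<lbrakk>1 \<le> i; i \<le> m; 1 \<le> s; s \<le> n; 1 \<le> j; j \<le> n\<rbrakk> \<Longrightarrow>
      qcomm (if s = j then q else 1) (yi j) (W i s)"
  using qcomm_sym[OF Wyi, of i s j] q by (auto split: if_splits)

lemma yy: "\<lbrakk>1 \<le> j; j \<le> n; 1 \<le> r; r \<le> n\<rbrakk> \<Longrightarrow>
    qcomm (if j < r then q else if r < j then inverse q else 1) (y j) (y r)"
  using y[of j r] qcomm_sym[OF y, of r j] q by auto

lemma yiy: "\<lbrakk>1 \<le> j; j \<le> n; 1 \<le> r; r \<le> n\<rbrakk> \<Longrightarrow>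
    qcomm (if j < r then inverse q else if r < j then q else 1) (yi j) (y r)"
  using qcomm_inverse_left[OF yy _ yi, of j r] q by (auto split: if_splits)

lemma yiyi: "\<lbrakk>1 \<le> j; j \<le> n; 1 \<le> r; r \<le> n\<rbrakk> \<Longrightarrow>
    qcomm (if j < r then q else if r < j then inverse q else 1) (yi j) (yi r)"
  using qcomm_inverse_right[OF yiy _ yi, of j r] q by (auto split: if_splits)

text \<open>At \<open>j = s\<close> the factor q comes from \<open>W i s\<close>, for
  \<open>j < s\<close> it comes from \<open>yi s\<close>. That equality falls on the same side as
  \<open>j < s\<close> is what lets a whole tail sum q-commute with a pivot.\<close>

lemma a_y: "\<lbrakk>1 \<le> i; i \<le> m; 1 \<le> s; s \<le> n; 1 \<le> j; j \<le> n\<rbrakk> \<Longrightarrow>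
    qcomm (if j \<le> s then q else inverse q) (a i s) (y j)"
  unfolding a_def
  using qcomm_mult_left[OF Wy[of i s j] yiy[of s j]] q by (auto split: if_splits)

lemma a_a_same_row:
  assumes "1 \<le> i" "i \<le> m" "1 \<le> s" "s < t" "t \<le> n"
  shows "qcomm (q\<^sup>2) (a i s) (a i t)"
proof -
  have "qcomm (q * 1) (W i s) (a i t)" unfolding a_def
    using quantum_matrixD(2)[OF W, of i s t] Wyi[of i s t] assms by (intro qcomm_mult_right) auto
  moreover have "qcomm (1 * q) (yi s) (a i t)" unfolding a_def
    using yiW[of i t s] yiyi[of s t] assms by (intro qcomm_mult_right) auto
  ultimately show ?thesis
    using qcomm_mult_left[of "q * 1" "W i s" "a i t" "1 * q" "yi s"] unfolding a_def[of i s] power2_eq_square by simp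
qed

lemma a_a_same_col:
  assumes "1 \<le> i" "i < k" "k \<le> m" "1 \<le> s" "s \<le> n"
  shows "qcomm q (a i s) (a k s)"
proof -
  have "qcomm (q * inverse q) (W i s) (a k s)" unfolding a_def
    using quantum_matrixD(1)[OF W, of i k s] Wyi[of i s s] assms by (intro qcomm_mult_right) auto
  moreover have "qcomm (q * 1) (yi s) (a k s)" unfolding a_def
    using yiW[of k s s] yiyi[of s s] assms by (intro qcomm_mult_right) auto
  ultimately show ?thesis
    using qcomm_mult_left[of "q * inverse q" "W i s" "a k s" "q * 1" "yi s"] q unfolding a_def[of i s] by simp
qed

lemma a_a_antidiagonal:
  assumes "1 \<le> i" "i < k" "k \<le> m" "1 \<le> t" "t < s" "s \<le> n"
  shows "qcomm (inverse q) (a i s) (a k t)"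
proof -
  have "qcomm (1 * 1) (W i s) (a k t)" unfolding a_def
    using quantum_matrixD(3)[OF W, of i k t s] Wyi[of i s t] assms by (intro qcomm_mult_right) auto
  moreover have "qcomm (1 * inverse q) (yi s) (a k t)" unfolding a_def
    using yiW[of k t s] yiyi[of s t] assms by (intro qcomm_mult_right) auto
  ultimately show ?thesis
    using qcomm_mult_left[of "1*1" "W i s" "a k t" "1*inverse q" "yi s"] q unfolding a_def[of i s] by simp
qed

text \<open>Reordering \<open>yi s * yi t\<close> costs a factor q, which turns the coefficient
  \<open>q - inverse q\<close> of the quantum relation into \<open>q\<^sup>2 - 1\<close>.\<close>

lemma a_a_diagonal:
  assumes "1 \<le> i" "i < k" "k \<le> m" "1 \<le> s" "s < t" "t \<le> n"
  shows "a i s * a k t = sc q (a k t * a i s) + sc (q\<^sup>2 - 1) (a i t * a k s)"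
proof -
  have e1: "yi s * W k t = W k t * yi s"
    using qcommD[OF yiW[of k t s]] assms by simp
  have e2: "yi t * W i s = W i s * yi t"
    using qcommD[OF yiW[of i s t]] assms by simp
  have e3: "yi t * W k s = W k s * yi t"
    using qcommD[OF yiW[of k s t]] assms by simp
  have e4: "yi s * yi t = sc q (yi t * yi s)"
    using qcommD[OF yiyi[of s t]] assms by simp
  have "a i s * a k t = W i s * (yi s * W k t) * yi t"
    by (simp add: a_def mult.assoc)
  also have "\<dots> = W i s * W k t * (yi s * yi t)"
    by (simp only: e1 mult.assoc)
  also have "\<dots> = sc q ((W k t * W i s + sc (q - inverse q) (W i t * W k s)) * (yi t * yi s))"
    using quantum_matrixD(4)[OF W, of i k s t] assms by (simp add: e4 sc_mult_right)
  also have "\<dots> = sc q (W k t * W i s * yi t * yi s) + sc (q\<^sup>2 - 1) (W i t * W k s * yi t * yi s)"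
    using q by (simp add: distrib_right sc_add_right sc_sc sc_mult_left mult.assoc power2_eq_square right_diff_distrib)
  also have "W k t * W i s * yi t * yi s = a k t * a i s"
    by (simp add: a_def mult.assoc) (metis e2 mult.assoc)
  also have "W i t * W k s * yi t * yi s = a i t * a k s"
    by (simp add: a_def mult.assoc) (metis e3 mult.assoc)
  finally show ?thesis .
qed

lemma A_split: "j \<le> r \<Longrightarrow> r \<le> Suc n \<Longrightarrow> A i j = B i j r + A i r"
proof -
  assume "j \<le> r" "r \<le> Suc n"
  then have "{j..n} = {j..<r} \<union> {r..n}" "{j..<r} \<inter> {r..n} = {}" by auto
  then show ?thesis by (simp add: A_def B_def sum.union_disjoint)
qed

lemma A_y:
  assumes "1 \<le> i" "i \<le> m" "1 \<le> r" "r \<le> j" "j \<le> n"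
  shows "qcomm q (A i j) (y r)"
  unfolding A_def
proof (rule qcomm_sum_left)
  fix s assume "s \<in> {j..n}"
  then show "qcomm q (a i s) (y r)" using a_y[of i s r] assms by simp
qed

lemma B_y:
  assumes "1 \<le> i" "i \<le> m" "1 \<le> j" "j < r" "r \<le> n"
  shows "qcomm (inverse q) (B i j r) (y r)"
  unfolding B_def
proof (rule qcomm_sum_left)
  fix s assume "s \<in> {j..<r}"
  then show "qcomm (inverse q) (a i s) (y r)" using a_y[of i s r] assms by simp
qed

lemma B_A_same: "\<lbrakk>1 \<le> i; i \<le> m; 1 \<le> j; j < r; r \<le> n\<rbrakk> \<Longrightarrow> qcomm (q\<^sup>2) (B i j r) (A i r)"
  unfolding B_def A_def by (intro qcomm_sum_left qcomm_sum_right a_a_same_row) auto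

lemma A_B_cross:
  "\<lbrakk>1 \<le> i; i < k; k \<le> m; 1 \<le> r; r < j; j \<le> n\<rbrakk> \<Longrightarrow> qcomm (inverse q) (A i j) (B k r j)"
  unfolding B_def A_def by (intro qcomm_sum_left qcomm_sum_right a_a_antidiagonal) auto

text \<open>All columns in \<open>S\<close> precede all columns in \<open>U\<close>, so every pair
  obeys the same diagonal relation and the products can be summed.\<close>

lemma sum_diagonal:
  assumes "1 \<le> i" "i < k" "k \<le> m"
    and "\<And>s t. s \<in> S \<Longrightarrow> t \<in> U \<Longrightarrow> 1 \<le> s \<and> s < t \<and> t \<le> n"
  shows "sum (a i) S * sum (a k) U =
    sc q (sum (a k) U * sum (a i) S) + sc (q\<^sup>2 - 1) (sum (a i) U * sum (a k) S)"
proof -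
  have "sum (a i) S * sum (a k) U =
      (\<Sum>s\<in>S. \<Sum>t\<in>U. sc q (a k t * a i s) + sc (q\<^sup>2 - 1) (a i t * a k s))"
    unfolding sum_product using assms by (intro sum.cong refl a_a_diagonal) auto
  also have "\<dots> = (\<Sum>s\<in>S. \<Sum>t\<in>U. sc q (a k t * a i s)) + (\<Sum>s\<in>S. \<Sum>t\<in>U. sc (q\<^sup>2 - 1) (a i t * a k s))"
    by (simp add: sum.distrib)
  also have "(\<Sum>s\<in>S. \<Sum>t\<in>U. sc q (a k t * a i s)) = sc q (sum (a k) U * sum (a i) S)"
    unfolding sum_product sc_sum by (rule sum.swap)
  also have "(\<Sum>s\<in>S. \<Sum>t\<in>U. sc (q\<^sup>2 - 1) (a i t * a k s)) = sc (q\<^sup>2 - 1) (sum (a i) U * sum (a k) S)"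
    unfolding sum_product sc_sum by (rule sum.swap)
  finally show ?thesis .
qed

lemma B_A_cross:
  assumes "1 \<le> i" "i < k" "k \<le> m" "1 \<le> j" "j < r" "r \<le> n"
  shows "B i j r * A k r = sc q (A k r * B i j r) + sc (q\<^sup>2 - 1) (A i r * B k j r)"
  unfolding A_def B_def using assms by (intro sum_diagonal) auto

text \<open>Induction from the right end, splitting off column \<open>j\<close>. The correction of
  the diagonal relation merges with the term \<open>A i (Suc j) * a k j\<close>: the coefficients
  \<open>q\<^sup>2 - 1\<close> and 1 add up to \<open>q\<^sup>2\<close>, which the antidiagonal
  factor \<open>inverse q\<close> reduces to q.\<close>

lemma A_A_col:
  assumes "1 \<le> i" "i < k" "k \<le> m" "1 \<le> j"
  shows "qcomm q (A i j) (A k j)"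
  using assms(4)
proof (induction "Suc n - j" arbitrary: j)
  case 0
  then have "A i j = 0" by (simp add: A_def)
  then show ?case by (simp add: qcomm_def)
next
  case (Suc d)
  then have j: "j \<le> n" and IH: "qcomm q (A i (Suc j)) (A k (Suc j))" by auto
  have B: "B i j (Suc j) = a i j" for i by (simp add: B_def)
  have sp: "A i j = a i j + A i (Suc j)" for i
    using A_split[of j "Suc j" i] j by (simp add: B)
  have e1: "a i j * A k (Suc j) = sc q (A k (Suc j) * a i j) + sc (q\<^sup>2 - 1) (A i (Suc j) * a k j)"
    using sum_diagonal[OF assms(1-3), of "{j}" "{Suc j..n}"] j \<open>1 \<le> j\<close> by (simp add: A_def)
  have "qcomm (inverse q) (A i (Suc j)) (a k j)"
    unfolding A_def using assms \<open>1 \<le> j\<close> by (intro qcomm_sum_left a_a_antidiagonal) auto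
  then have e2: "A i (Suc j) * a k j = sc (inverse q) (a k j * A i (Suc j))" by (rule qcommD)
  have e3: "a i j * a k j = sc q (a k j * a i j)"
    using qcommD[OF a_a_same_col[of i k j]] assms j \<open>1 \<le> j\<close> by simp
  have "sc (q\<^sup>2 - 1) (A i (Suc j) * a k j) + A i (Suc j) * a k j = sc (q\<^sup>2) (A i (Suc j) * a k j)"
    by (metis sc_add_left sc_one diff_add_cancel)
  also have "\<dots> = sc q (a k j * A i (Suc j))"
    unfolding e2 using q by (simp add: sc_sc power2_eq_square mult.assoc)
  finally have e4: "sc (q\<^sup>2 - 1) (A i (Suc j) * a k j) + A i (Suc j) * a k j = sc q (a k j * A i (Suc j))" .
  have "A i j * A k j = a i j * a k j + a i j * A k (Suc j) + A i (Suc j) * a k j + A i (Suc j) * A k (Suc j)"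
    unfolding sp by (simp add: distrib_left distrib_right add_ac)
  also have "\<dots> = sc q (a k j * a i j) + sc q (A k (Suc j) * a i j) +
      (sc (q\<^sup>2 - 1) (A i (Suc j) * a k j) + A i (Suc j) * a k j) + sc q (A k (Suc j) * A i (Suc j))"
    unfolding e3 e1 qcommD[OF IH] by (simp add: add_ac)
  also have "\<dots> = sc q (A k j * A i j)"
    unfolding e4 sp by (simp add: distrib_left distrib_right add_ac sc_add_right)
  finally show ?case by (simp add: qcomm_def)
qed

text \<open>The pivots become the last row. In \<open>A i j * y j\<close> the term of column
  \<open>j\<close> is the old entry \<open>W i j\<close>; the terms of later columns are what the
  deletion of derivations removes.\<close>

definition "W' i j = (if i = Suc m then y j else A i j * y j)"

lemma col_last: "\<lbrakk>1 \<le> i; i \<le> m; 1 \<le> j; j \<le> n\<rbrakk> \<Longrightarrow> qcomm q (A i j * y j) (y j)"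
  using qcomm_mult_left[OF A_y[of i j j] qcomm_self] by simp

lemma antidiagonal_last:
  "\<lbrakk>1 \<le> i; i \<le> m; 1 \<le> r; r < j; j \<le> n\<rbrakk> \<Longrightarrow> qcomm 1 (A i j * y j) (y r)"
  using qcomm_mult_left[OF A_y[of i r j] yy[of j r]] q by simp

text \<open>\<open>y r\<close> has opposite factors with the columns left of \<open>r\<close> and
  with those from \<open>r\<close> on, so \<open>A i j\<close> is cut at \<open>r\<close>. On the
  right part q is required but \<open>inverse q\<close> occurs; the difference is the correction
  term.\<close>

lemma diagonal_last:
  assumes "1 \<le> i" "i \<le> m" "1 \<le> j" "j < r" "r \<le> n"
  shows "A i j * y j * y r = y r * (A i j * y j) + sc (q - inverse q) (A i r * y r * y j)"
proof -
  have e1: "y j * y r = sc q (y r * y j)" using qcommD[OF y] assms by simp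
  have e2: "y r * B i j r = sc q (B i j r * y r)"
    using qcommD[OF qcomm_sym[OF B_y[of i j r]]] assms q by simp
  have e3: "y r * A i r = sc (inverse q) (A i r * y r)"
    using qcommD[OF qcomm_sym[OF A_y[of i r r]]] assms q by simp
  have sp: "A i j = B i j r + A i r" using A_split[of j r i] assms by simp
  have "y r * (A i j * y j) = sc q (B i j r * y r * y j) + sc (inverse q) (A i r * y r * y j)"
    unfolding sp by (simp add: distrib_left distrib_right mult.assoc[symmetric] e2 e3 sc_mult_left)
  then have "y r * (A i j * y j) + sc (q - inverse q) (A i r * y r * y j) =
      sc q (B i j r * y r * y j) + (sc (inverse q) (A i r * y r * y j) + sc (q - inverse q) (A i r * y r * y j))"
    by (simp add: add_ac)
  also have "sc (inverse q) (A i r * y r * y j) + sc (q - inverse q) (A i r * y r * y j) = sc q (A i r * y r * y j)"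
    by (simp add: sc_add_left[symmetric])
  finally show ?thesis
    unfolding sp by (simp add: mult.assoc e1 sc_mult_right distrib_right sc_add_right)
qed

text \<open>Cut at \<open>r\<close>, the two parts of \<open>A i j\<close> have factors
  \<open>q\<^sup>2\<close> and 1 with \<open>A i r\<close>. Moving \<open>y r\<close> across them
  accounts for q and \<open>inverse q\<close>, which leaves the common factor q.\<close>

lemma same_row:
  assumes "1 \<le> i" "i \<le> m" "1 \<le> j" "j < r" "r \<le> n"
  shows "qcomm q (A i j * y j) (A i r * y r)"
proof -
  have e1: "y j * y r = sc q (y r * y j)" using qcommD[OF y] assms by simp
  have e2: "y r * B i j r = sc q (B i j r * y r)"
    using qcommD[OF qcomm_sym[OF B_y[of i j r]]] assms q by simp
  have e3: "y r * A i r = sc (inverse q) (A i r * y r)"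
    using qcommD[OF qcomm_sym[OF A_y[of i r r]]] assms q by simp
  have e4: "y j * A i r = sc (inverse q) (A i r * y j)"
    using qcommD[OF qcomm_sym[OF A_y[of i j r]]] assms q by simp
  have e5: "B i j r * A i r = sc (q\<^sup>2) (A i r * B i j r)"
    using qcommD[OF B_A_same] assms by simp
  have sp: "A i j = B i j r + A i r" using A_split[of j r i] assms by simp
  have "A i j * y j * (A i r * y r) = A i j * (y j * A i r) * y r" by (simp add: mult.assoc)
  also have "\<dots> = A i j * A i r * y r * y j"
    using q by (simp add: e4 sc_mult_left sc_mult_right mult.assoc e1 sc_sc)
  also have "A i j * A i r = sc q (A i r * (sc q (B i j r) + sc (inverse q) (A i r)))"
    unfolding sp using q by (simp add: distrib_left distrib_right e5 sc_mult_right sc_add_right sc_sc power2_eq_square)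
  also have "\<dots> * y r * y j = sc q (A i r * (sc q (B i j r * y r) + sc (inverse q) (A i r * y r)) * y j)"
    by (simp add: sc_mult_left sc_mult_right distrib_left distrib_right mult.assoc)
  also have "\<dots> = sc q (A i r * y r * (A i j * y j))"
    unfolding e2[symmetric] e3[symmetric] sp by (simp add: distrib_left distrib_right mult.assoc)
  finally show ?thesis by (simp add: qcomm_def)
qed

lemma same_col:
  assumes "1 \<le> i" "i < k" "k \<le> m" "1 \<le> j" "j \<le> n"
  shows "qcomm q (A i j * y j) (A k j * y j)"
proof -
  have "qcomm (q * q) (A i j) (A k j * y j)"
    using assms by (intro qcomm_mult_right A_A_col A_y) auto
  moreover have "qcomm (inverse q * 1) (y j) (A k j * y j)"
    using qcomm_sym[OF A_y[of k j j]] assms q by (intro qcomm_mult_right) auto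
  ultimately have "qcomm (q * q * (inverse q * 1)) (A i j * y j) (A k j * y j)"
    by (rule qcomm_mult_left)
  then show ?thesis using q by (simp add: mult.assoc)
qed

lemma antidiagonal:
  assumes "1 \<le> i" "i < k" "k \<le> m" "1 \<le> r" "r < j" "j \<le> n"
  shows "qcomm 1 (A i j * y j) (A k r * y r)"
proof -
  have e1: "y r * y j = sc q (y j * y r)" using qcommD[OF y] assms by simp
  have e1': "y j * y r = sc (inverse q) (y r * y j)" using e1 q by (simp add: sc_sc)
  have e2: "y j * B k r j = sc q (B k r j * y j)"
    using qcommD[OF qcomm_sym[OF B_y[of k r j]]] assms q by simp
  have e3: "y j * A k j = sc (inverse q) (A k j * y j)"
    using qcommD[OF qcomm_sym[OF A_y[of k j j]]] assms q by simp
  have e4: "y r * A i j = sc (inverse q) (A i j * y r)"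
    using qcommD[OF qcomm_sym[OF A_y[of i r j]]] assms q by simp
  have e5: "A i j * B k r j = sc (inverse q) (B k r j * A i j)"
    using qcommD[OF A_B_cross] assms by simp
  have e6: "A i j * A k j = sc q (A k j * A i j)"
    using qcommD[OF A_A_col] assms by simp
  have sp: "A k r = B k r j + A k j" using A_split[of r j k] assms by simp
  have "A i j * y j * (A k r * y r) = A i j * (sc q (B k r j * y j) + sc (inverse q) (A k j * y j)) * y r"
    unfolding e2[symmetric] e3[symmetric] sp by (simp add: distrib_left distrib_right mult.assoc)
  also have "\<dots> = (sc q (A i j * B k r j) + sc (inverse q) (A i j * A k j)) * y j * y r"
    by (simp add: sc_mult_left sc_mult_right distrib_left distrib_right mult.assoc)
  also have "\<dots> = A k r * A i j * y j * y r"
    unfolding e5 e6 sp using q by (simp add: sc_sc distrib_right)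
  also have "\<dots> = A k r * (y r * A i j) * y j"
    using q by (simp add: e4 mult.assoc e1' sc_mult_left sc_mult_right)
  finally show ?thesis by (simp add: qcomm_def mult.assoc)
qed

lemma diagonal:
  assumes "1 \<le> i" "i < k" "k \<le> m" "1 \<le> j" "j < r" "r \<le> n"
  shows "A i j * y j * (A k r * y r) =
    A k r * y r * (A i j * y j) + sc (q - inverse q) (A i r * y r * (A k j * y j))"
proof -
  \<comment> \<open>Every product below is brought to the form of an expression in \<open>A\<close>
    and \<open>B\<close> times \<open>w\<close>, so the pivots drop out and only the relations
    between tail and block sums remain.\<close>
  define w where "w = y r * y j"
  have e1: "y j * y r = sc q w" using qcommD[OF y] assms by (simp add: w_def)
  have e2: "y r * B i j r = sc q (B i j r * y r)" if "i \<in> {1..m}" for i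
    using qcommD[OF qcomm_sym[OF B_y[of i j r]]] assms q that by simp
  have e3: "y r * A i r = sc (inverse q) (A i r * y r)" if "i \<in> {1..m}" for i
    using qcommD[OF qcomm_sym[OF A_y[of i r r]]] assms q that by simp
  have e4: "y j * A k r = sc (inverse q) (A k r * y j)"
    using qcommD[OF qcomm_sym[OF A_y[of k j r]]] assms q by simp
  have e5: "B i j r * A k r = sc q (A k r * B i j r) + sc (q\<^sup>2 - 1) (A i r * B k j r)"
    using B_A_cross assms by simp
  have e6: "A k r * A i r = sc (inverse q) (A i r * A k r)"
    using qcommD[OF qcomm_sym[OF A_A_col]] assms q by simp
  have sp: "A i j = B i j r + A i r" for i using A_split[of j r i] assms by simp
  have yA: "y r * A i j * y j = (sc q (B i j r) + sc (inverse q) (A i r)) * w" if "i \<in> {1..m}" for i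
    unfolding sp w_def using e2[OF that] e3[OF that]
    by (simp add: distrib_left distrib_right mult.assoc[symmetric] sc_mult_left)
  have ik: "i \<in> {1..m}" "k \<in> {1..m}" using assms by auto
  have L: "A i j * y j * (A k r * y r) = (B i j r * A k r + A i r * A k r) * w"
  proof -
    have "A i j * y j * (A k r * y r) = A i j * (y j * A k r) * y r" by (simp add: mult.assoc)
    also have "\<dots> = A i j * A k r * w"
      using q by (simp add: e4 sc_mult_left sc_mult_right mult.assoc e1 sc_sc)
    finally show ?thesis by (simp add: sp distrib_right)
  qed
  have R1: "A k r * y r * (A i j * y j) = A k r * (sc q (B i j r) + sc (inverse q) (A i r)) * w"
    using yA[OF ik(1)] by (simp add: mult.assoc)
  have R2: "A i r * y r * (A k j * y j) = A i r * (sc q (B k j r) + sc (inverse q) (A k r)) * w"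
    using yA[OF ik(2)] by (simp add: mult.assoc)
  have s1: "(q - inverse q) * q = q\<^sup>2 - 1" "(q - inverse q) * inverse q = 1 - inverse q * inverse q"
    using q by (simp_all add: left_diff_distrib power2_eq_square)
  have "A k r * (sc q (B i j r) + sc (inverse q) (A i r)) +
      sc (q - inverse q) (A i r * (sc q (B k j r) + sc (inverse q) (A k r))) =
      sc q (A k r * B i j r) + sc (q\<^sup>2 - 1) (A i r * B k j r) +
      (sc (inverse q * inverse q) (A i r * A k r) + sc (1 - inverse q * inverse q) (A i r * A k r))"
    by (simp add: distrib_left sc_mult_right e6 sc_sc sc_add_right s1 add_ac)
  also have "sc (inverse q * inverse q) (A i r * A k r) + sc (1 - inverse q * inverse q) (A i r * A k r) = A i r * A k r"
    by (simp add: sc_add_left[symmetric])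
  finally have "B i j r * A k r + A i r * A k r = A k r * (sc q (B i j r) + sc (inverse q) (A i r)) +
      sc (q - inverse q) (A i r * (sc q (B k j r) + sc (inverse q) (A k r)))"
    by (simp add: e5)
  then show ?thesis
    unfolding L R1 R2 by (simp add: distrib_right sc_mult_left)
qed

lemma quantum_matrix_step: "quantum_matrix q (Suc m) n W'"
  unfolding quantum_matrix_def
proof (intro conjI allI impI)
  fix i k j assume "1 \<le> i \<and> i < k \<and> k \<le> Suc m \<and> j \<in> {1..n}"
  then show "qcomm q (W' i j) (W' k j)"
    using col_last[of i j] same_col[of i k j] by (auto simp: W'_def le_Suc_eq)
next
  fix i j r assume "i \<in> {1..Suc m} \<and> 1 \<le> j \<and> j < r \<and> r \<le> n"
  then show "qcomm q (W' i j) (W' i r)"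
    using y[of j r] same_row[of i j r] by (auto simp: W'_def le_Suc_eq)
next
  fix i k j r assume "1 \<le> i \<and> i < k \<and> k \<le> Suc m \<and> 1 \<le> r \<and> r < j \<and> j \<le> n"
  then show "qcomm 1 (W' i j) (W' k r)"
    using antidiagonal_last[of i r j] antidiagonal[of i k r j] by (auto simp: W'_def le_Suc_eq)
next
  fix i k j r assume "1 \<le> i \<and> i < k \<and> k \<le> Suc m \<and> 1 \<le> j \<and> j < r \<and> r \<le> n"
  then show "W' i j * W' k r = W' k r * W' i j + sc (q - inverse q) (W' i r * W' k j)"
    using diagonal_last[of i j r] diagonal[of i k j r] by (auto simp: W'_def le_Suc_eq)
qed

end

section \<open>Powers at a root of unity\<close>

text \<open>The Pascal rule that fits \<open>u * v = sc p (v * u)\<close>: a new \<open>u\<close>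
  placed in front has to pass \<open>v ^ Suc j\<close> at the cost \<open>p ^ Suc j\<close>.\<close>

fun gauss_binomial :: "'k::comm_ring_1 \<Rightarrow> nat \<Rightarrow> nat \<Rightarrow> 'k" where
  "gauss_binomial p k 0 = 1"
| "gauss_binomial p 0 (Suc j) = 0"
| "gauss_binomial p (Suc k) (Suc j) = p ^ Suc j * gauss_binomial p k (Suc j) + gauss_binomial p k j"

lemma gauss_binomial_eq_0: "k < j \<Longrightarrow> gauss_binomial p k j = 0"
  by (induction p k j rule: gauss_binomial.induct) auto

lemma gauss_binomial_self [simp]: "gauss_binomial p k k = 1"
  by (induction k) (auto simp: gauss_binomial_eq_0)

text \<open>A division-free substitute for the product formula. With \<open>Suc k = l\<close> and
  \<open>p\<close> a primitive root of unity the right side vanishes, whereas the factor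
  \<open>1 - p ^ Suc j\<close> does not for \<open>Suc j < l\<close>.\<close>

lemma gauss_binomial_absorption:
  "(1 - p ^ Suc j) * gauss_binomial p (Suc k) (Suc j) = (1 - p ^ Suc k) * gauss_binomial p k j"
proof (induction k arbitrary: j)
  case 0
  then show ?case by (cases j) auto
next
  case (Suc k)
  \<comment> \<open>The companion recursion in the upper index; for positive \<open>j\<close> it is
    the induction hypothesis at \<open>j - 1\<close> combined with the Pascal rule.\<close>
  have e: "(1 - p ^ Suc k) * p ^ j * gauss_binomial p k j = (p ^ j - p ^ Suc k) * gauss_binomial p (Suc k) j"
  proof (cases j)
    case 0
    then show ?thesis by simp
  next
    case (Suc i)
    have "(1 - p ^ Suc k) * p ^ j * gauss_binomial p k j =
        (1 - p ^ Suc k) * (gauss_binomial p (Suc k) j - gauss_binomial p k i)"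
      by (simp add: Suc mult.assoc)
    also have "\<dots> = (1 - p ^ Suc k) * gauss_binomial p (Suc k) j - (1 - p ^ j) * gauss_binomial p (Suc k) j"
      unfolding Suc right_diff_distrib[of _ "gauss_binomial p (Suc k) _"] Suc.IH ..
    finally show ?thesis by (simp add: algebra_simps)
  qed
  have "(1 - p ^ Suc j) * gauss_binomial p (Suc (Suc k)) (Suc j) =
      p ^ Suc j * ((1 - p ^ Suc j) * gauss_binomial p (Suc k) (Suc j)) + (1 - p ^ Suc j) * gauss_binomial p (Suc k) j"
    by (simp add: algebra_simps)
  also have "\<dots> = p * ((1 - p ^ Suc k) * p ^ j * gauss_binomial p k j) + (1 - p ^ Suc j) * gauss_binomial p (Suc k) j"
    unfolding Suc.IH by (simp add: algebra_simps)
  also have "\<dots> = (1 - p ^ Suc (Suc k)) * gauss_binomial p (Suc k) j"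
    unfolding e by (simp add: algebra_simps)
  finally show ?case .
qed

lemma primitive_root_of_unityD:
  assumes "primitive_root_of_unity l p"
  shows "0 < l" "p ^ l = 1" "\<And>k. 0 < k \<Longrightarrow> k < l \<Longrightarrow> p ^ k \<noteq> 1" "p \<noteq> 0"
  using assms by (auto simp: primitive_root_of_unity_def power_0_left)

lemma gauss_binomial_root_of_unity:
  fixes p :: "'k::field"
  assumes "primitive_root_of_unity l p" "0 < j" "j < l"
  shows "gauss_binomial p l j = 0"
proof -
  obtain i k where "j = Suc i" "l = Suc k" using assms by (metis gr0_conv_Suc order.strict_trans)
  moreover have "p ^ j \<noteq> 1" "p ^ l = 1"
    using primitive_root_of_unityD[OF assms(1)] assms(2,3) by blast+
  ultimately show ?thesis using gauss_binomial_absorption[of p i k]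
    by (auto simp del: gauss_binomial.simps power_Suc)
qed

lemma primitive_root_dvd:
  assumes "primitive_root_of_unity l (p::'k::field)" "p ^ k = 1"
  shows "l dvd k"
proof -
  note D = primitive_root_of_unityD[OF assms(1)]
  have "p ^ (k mod l) = p ^ (k mod l) * (p ^ l) ^ (k div l)" using D by simp
  also have "\<dots> = p ^ k"
    by (metis power_add power_mult mod_mult_div_eq)
  finally have "p ^ (k mod l) = 1" using assms(2) by simp
  then have "\<not> 0 < k mod l" using D(1,3) by force
  then show ?thesis by (simp add: dvd_eq_mod_eq_0)
qed

text \<open>2 is invertible modulo an odd \<open>l\<close>. The square is needed because the
  summands of a path sum commute up to \<open>q\<^sup>2\<close>, not up to q.\<close>

lemma primitive_root_square:
  assumes "primitive_root_of_unity l (p::'k::field)" "odd l"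
  shows "primitive_root_of_unity l (p\<^sup>2)"
  unfolding primitive_root_of_unity_def
proof (intro conjI allI impI)
  note D = primitive_root_of_unityD[OF assms(1)]
  show "0 < l" by (rule D)
  show "(p\<^sup>2) ^ l = 1"
    by (metis D(2) power_mult mult.commute power_one)
  fix k assume k: "0 < k \<and> k < l"
  show "(p\<^sup>2) ^ k \<noteq> 1"
  proof
    assume "(p\<^sup>2) ^ k = 1"
    then have "l dvd 2 * k" using primitive_root_dvd[OF assms(1), of "2 * k"] by (simp add: power_mult)
    then have "l dvd k" using assms(2) by (simp add: coprime_dvd_mult_right_iff)
    then show False using k by (auto dest: dvd_imp_le)
  qed
qed

context scalar_algebra
begin

lemma qcomm_power_right: "qcomm c u v \<Longrightarrow> qcomm (c ^ k) u (v ^ k)"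
proof (induction k)
  case 0
  then show ?case by (simp add: qcomm_def)
next
  case (Suc k)
  then show ?case using qcomm_mult_right[of c u v "c ^ k" "v ^ k"] by simp
qed

lemma quantum_binomial:
  assumes "qcomm p u v"
  shows "(u + v) ^ k = (\<Sum>j\<le>k. sc (gauss_binomial p k j) (v ^ j * u ^ (k - j)))"
proof (induction k)
  case 0
  then show ?case by simp
next
  case (Suc k)
  let ?g = "gauss_binomial p"
  have u: "u * (v ^ j * u ^ (k - j)) = sc (p ^ j) (v ^ j * u ^ (Suc k - j))" if "j \<le> k" for j
    using qcomm_left_commute[OF qcomm_power_right[OF assms], of j "u ^ (k - j)"] that
    by (simp add: Suc_diff_le)
  have "(u + v) ^ Suc k =
      (\<Sum>j\<le>k. sc (?g k j) (u * (v ^ j * u ^ (k - j)))) + (\<Sum>j\<le>k. sc (?g k j) (v ^ Suc j * u ^ (k - j)))"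
    by (simp add: Suc distrib_right sum_distrib_left sc_mult_right mult.assoc sc_add_right sum.distrib)
  also have "(\<Sum>j\<le>k. sc (?g k j) (u * (v ^ j * u ^ (k - j)))) =
      (\<Sum>j\<le>k. sc (p ^ j * ?g k j) (v ^ j * u ^ (Suc k - j)))"
    by (intro sum.cong) (auto simp: u sc_sc mult.commute)
  also have "\<dots> = (\<Sum>j\<le>Suc k. sc (p ^ j * ?g k j) (v ^ j * u ^ (Suc k - j)))"
    by (simp add: gauss_binomial_eq_0)
  also have "\<dots> = u ^ Suc k + (\<Sum>j\<le>k. sc (p ^ Suc j * ?g k (Suc j)) (v ^ Suc j * u ^ (k - j)))"
    by (subst sum.atMost_Suc_shift) simp
  finally have "(u + v) ^ Suc k = u ^ Suc k + (\<Sum>j\<le>k. sc (?g (Suc k) (Suc j)) (v ^ Suc j * u ^ (k - j)))"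
    by (simp add: sc_add_left sum.distrib add.assoc)
  also have "\<dots> = (\<Sum>j\<le>Suc k. sc (?g (Suc k) j) (v ^ j * u ^ (Suc k - j)))"
    by (subst sum.atMost_Suc_shift) simp
  finally show ?case .
qed

lemma quantum_freshman:
  assumes "qcomm p u v" "primitive_root_of_unity l p"
  shows "(u + v) ^ l = u ^ l + v ^ l"
proof -
  note D = primitive_root_of_unityD[OF assms(2)]
  have "(u + v) ^ l = (\<Sum>j\<in>{0, l}. sc (gauss_binomial p l j) (v ^ j * u ^ (l - j)))"
    unfolding quantum_binomial[OF assms(1)]
    by (rule sum.mono_neutral_right) (auto simp: gauss_binomial_root_of_unity[OF assms(2)])
  then show ?thesis using D(1) by simp
qed

lemma quantum_freshman_sum:
  fixes j n :: nat
  assumes "primitive_root_of_unity l p"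
    and "\<And>s t. j \<le> s \<Longrightarrow> s < t \<Longrightarrow> t \<le> n \<Longrightarrow> qcomm p (b s) (b t)"
  shows "(\<Sum>s\<in>{j..n}. b s) ^ l = (\<Sum>s\<in>{j..n}. b s ^ l)"
  using assms(2)
proof (induction "Suc n - j" arbitrary: j)
  case 0
  then show ?case using primitive_root_of_unityD(1)[OF assms(1)] by (simp add: power_0_left)
next
  case (Suc d)
  then have j: "j \<le> n" by simp
  have "qcomm p (b j) (\<Sum>s\<in>{Suc j..n}. b s)"
    using Suc.prems by (intro qcomm_sum_right) auto
  then have "(b j + (\<Sum>s\<in>{Suc j..n}. b s)) ^ l = b j ^ l + (\<Sum>s\<in>{Suc j..n}. b s) ^ l"
    by (rule quantum_freshman[OF _ assms(1)])
  moreover have "(\<Sum>s\<in>{Suc j..n}. b s) ^ l = (\<Sum>s\<in>{Suc j..n}. b s ^ l)"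
    using Suc by (intro Suc.hyps) auto
  ultimately show ?case
    using j by (simp add: sum.atLeast_Suc_atMost)
qed

text \<open>Sorting \<open>(u * v) ^ k\<close> moves a \<open>v\<close> past a \<open>u\<close> once
  for every pair of factors, hence k(k-1)/2 times.\<close>

lemma qcomm_mult_power:
  assumes "qcomm c u v" "c \<noteq> 0"
  shows "(u * v) ^ k = sc (inverse c ^ (k * (k - 1) div 2)) (u ^ k * v ^ k)"
proof (induction k)
  case 0
  then show ?case by simp
next
  case (Suc k)
  have e: "v * u ^ k = sc (inverse c ^ k) (u ^ k * v)"
    by (rule qcommD[OF qcomm_power_right[OF qcomm_sym[OF assms]]])
  have "(u * v) ^ Suc k = sc (inverse c ^ (k * (k - 1) div 2)) (u * (v * u ^ k) * v ^ k)"
    by (simp add: Suc sc_mult_right mult.assoc)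
  also have "\<dots> = sc (inverse c ^ (k * (k - 1) div 2 + k)) (u ^ Suc k * v ^ Suc k)"
    by (simp add: e sc_mult_right sc_mult_left sc_sc mult.assoc power_add)
  also have "k * (k - 1) div 2 + k = Suc k * (Suc k - 1) div 2"
  proof -
    have "k * (k - 1) div 2 + k = (k * (k - 1) + k * 2) div 2" by simp
    also have "k * (k - 1) + k * 2 = Suc k * k" by (cases k) auto
    finally show ?thesis by simp
  qed
  finally show ?case .
qed

text \<open>For odd \<open>l\<close> the exponent l(l-1)/2 is a multiple of \<open>l\<close>, so the
  scalar disappears.\<close>

lemma qcomm_mult_power_root:
  assumes "qcomm c u v" "odd l" "c ^ l = 1"
  shows "(u * v) ^ l = u ^ l * v ^ l"
proof -
  have "c \<noteq> 0" using assms by (auto simp: power_0_left split: if_splits)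
  obtain h where h: "l = 2 * h + 1" using assms(2) by (auto elim: oddE)
  then have "l * (l - 1) div 2 = l * h" by simp
  then have "inverse c ^ (l * (l - 1) div 2) = 1"
    using assms(3) by (simp add: power_mult power_inverse)
  then show ?thesis using qcomm_mult_power[OF assms(1) \<open>c \<noteq> 0\<close>, of l] by simp
qed

end

text \<open>
  Entries of the matrix of weighted path sums of a triangular network: they invert Cauchon's
  deleting derivations algorithm with the pivots of one row removed at a time.
\<close>

fun path_matrix ::
  "(nat \<Rightarrow> nat \<Rightarrow> 'a::ring_1) \<Rightarrow> (nat \<Rightarrow> nat \<Rightarrow> 'a) \<Rightarrow> nat \<Rightarrow> nat \<Rightarrow> nat \<Rightarrow> nat \<Rightarrow> 'a" where
  "path_matrix T Ti n 0 i j = 0"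
| "path_matrix T Ti n (Suc m) i j =
     (if i = Suc m then T (Suc m) j
      else (\<Sum>s\<in>{j..n}. path_matrix T Ti n m i s * Ti (Suc m) s) * T (Suc m) j)"

section \<open>Path matrices over a quantum torus and their powers\<close>

locale quantum_torus_matrix = scalar_algebra sc for sc :: "'k::field \<Rightarrow> 'a::ring_1 \<Rightarrow> 'a" +
  fixes q :: 'k and M n :: nat and T Ti :: "nat \<Rightarrow> nat \<Rightarrow> 'a"
  assumes q: "q \<noteq> 0"
    and T_Ti: "\<And>i j. T i j * Ti i j = 1" "\<And>i j. Ti i j * T i j = 1"
    and T_cols: "\<And>i k s j. \<lbrakk>1 \<le> i; i < k; k \<le> M; 1 \<le> s; s \<le> n; 1 \<le> j; j \<le> n\<rbrakk> \<Longrightarrow>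
      qcomm (if s = j then q else 1) (T i s) (T k j)"
    and T_row: "\<And>i j r. \<lbrakk>1 \<le> i; i \<le> M; 1 \<le> j; j < r; r \<le> n\<rbrakk> \<Longrightarrow> qcomm q (T i j) (T i r)"
begin

abbreviation "PM \<equiv> path_matrix T Ti n"

text \<open>Each summand pairs an entry of column \<open>t\<close> with an inverse pivot of the same
  column, and their factors cancel; a later row only sees the final pivot in column
  \<open>s\<close>. This is the hypothesis on pivots that the next row step requires.\<close>

lemma path_matrix_T:
  "\<lbrakk>1 \<le> i; i \<le> m; m < k; k \<le> M; 1 \<le> s; s \<le> n; 1 \<le> j; j \<le> n\<rbrakk> \<Longrightarrow>
    qcomm (if s = j then q else 1) (PM m i s) (T k j)"
proof (induction m arbitrary: s)
  case (Suc m)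
  show ?case
  proof (cases "i = Suc m")
    case True
    then show ?thesis using T_cols[of i k s j] Suc.prems by simp
  next
    case False
    have 1: "qcomm (inverse (if t = j then q else 1)) (Ti (Suc m) t) (T k j)" if "1 \<le> t" "t \<le> n" for t
      using qcomm_inverse_left[OF T_cols _ T_Ti, of "Suc m" k t j] Suc.prems q that by simp
    have "qcomm 1 (PM m i t * Ti (Suc m) t) (T k j)" if "t \<in> {s..n}" for t
      using qcomm_mult_left[OF Suc.IH[of t] 1[of t]] that Suc.prems False q by (auto split: if_splits)
    then have "qcomm 1 (\<Sum>t\<in>{s..n}. PM m i t * Ti (Suc m) t) (T k j)"
      by (rule qcomm_sum_left)
    from qcomm_mult_left[OF this T_cols[of "Suc m" k s j]] show ?thesis
      using False Suc.prems by simp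
  qed
qed simp

lemma row_step:
  assumes "quantum_matrix q m n (PM m)" "Suc m \<le> M"
  shows "quantum_row_step sc q m (if Suc m \<le> M then n else 0) (PM m) (T (Suc m)) (Ti (Suc m))"
  using assms q T_Ti T_row[of "Suc m"] path_matrix_T[of _ m "Suc m"] by unfold_locales auto

lemma quantum_matrix_path_matrix: "m \<le> M \<Longrightarrow> quantum_matrix q m n (PM m)"
proof (induction m)
  case 0
  then show ?case by (simp add: quantum_matrix_def)
next
  case (Suc m)
  then interpret S: quantum_row_step sc q m n "PM m" "T (Suc m)" "Ti (Suc m)"
    using row_step[of m] by simp
  have "S.W' = PM (Suc m)" by (auto simp: S.W'_def S.A_def S.a_def fun_eq_iff)
  with S.quantum_matrix_step show ?case by (simp only:)
qed

text \<open>The summands of one entry commute pairwise up to \<open>q\<^sup>2\<close>, so the power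
  of the sum is the sum of the powers; inside a summand the three factors q-commute, so the power is
  distributed over them.\<close>

lemma path_matrix_power:
  assumes "primitive_root_of_unity l q" "odd l"
  shows "\<lbrakk>1 \<le> i; i \<le> m; m \<le> M; 1 \<le> j; j \<le> n\<rbrakk> \<Longrightarrow>
    PM m i j ^ l = path_matrix (\<lambda>i j. T i j ^ l) (\<lambda>i j. Ti i j ^ l) n m i j"
proof (induction m arbitrary: j)
  case (Suc m)
  show ?case
  proof (cases "i = Suc m")
    case True
    then show ?thesis by simp
  next
    case False
    note D = primitive_root_of_unityD[OF assms(1)]
    interpret S: quantum_row_step sc q m n "PM m" "T (Suc m)" "Ti (Suc m)"
      using row_step[of m] quantum_matrix_path_matrix[of m] Suc.prems by simp
    have i: "1 \<le> i" "i \<le> m" using False Suc.prems by auto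
    let ?y = "T (Suc m) j"
    have ay: "qcomm q (S.a i s) ?y" if "s \<in> {j..n}" for s
      using S.a_y[of i s j] that i Suc.prems by simp
    \<comment> \<open>The common right factor \<open>?y\<close> does not change the factor of the
      two terms: the q gained on one side is lost on the other.\<close>
    have "qcomm (q\<^sup>2) (S.a i s * ?y) (S.a i t * ?y)" if st: "j \<le> s" "s < t" "t \<le> n" for s t
    proof -
      have "qcomm (q\<^sup>2 * q) (S.a i s) (S.a i t * ?y)"
        using st i Suc.prems ay[of s] by (intro qcomm_mult_right S.a_a_same_row) auto
      moreover have "qcomm (inverse q * 1) ?y (S.a i t * ?y)"
        using st qcomm_sym[OF ay[of t]] q by (intro qcomm_mult_right) auto
      ultimately have "qcomm (q\<^sup>2 * q * (inverse q * 1)) (S.a i s * ?y) (S.a i t * ?y)"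
        by (rule qcomm_mult_left)
      then show ?thesis using q by (simp add: mult.assoc)
    qed
    then have "(\<Sum>s\<in>{j..n}. S.a i s * ?y) ^ l = (\<Sum>s\<in>{j..n}. (S.a i s * ?y) ^ l)"
      by (intro quantum_freshman_sum[OF primitive_root_square[OF assms]])
    also have "\<dots> = (\<Sum>s\<in>{j..n}. PM m i s ^ l * Ti (Suc m) s ^ l * ?y ^ l)"
    proof (rule sum.cong[OF refl])
      fix s assume s: "s \<in> {j..n}"
      have "(S.a i s * ?y) ^ l = S.a i s ^ l * ?y ^ l"
        by (rule qcomm_mult_power_root[OF ay[OF s] assms(2) D(2)])
      also have "S.a i s ^ l = PM m i s ^ l * Ti (Suc m) s ^ l"
        unfolding S.a_def using S.Wyi[of i s s] s Suc.prems i D(2)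
        by (intro qcomm_mult_power_root[OF _ assms(2), of "inverse q"]) (auto simp: power_inverse)
      finally show "(S.a i s * ?y) ^ l = PM m i s ^ l * Ti (Suc m) s ^ l * ?y ^ l" .
    qed
    also have "\<dots> = (\<Sum>s\<in>{j..n}. path_matrix (\<lambda>i j. T i j ^ l) (\<lambda>i j. Ti i j ^ l) n m i s * Ti (Suc m) s ^ l * ?y ^ l)"
      using Suc.IH i Suc.prems by (intro sum.cong) auto
    finally show ?thesis
      using False by (simp add: S.a_def sum_distrib_right[symmetric])
  qed
qed simp

end

section \<open>Solid minors of classical path matrices\<close>

locale classical_path_matrix =
  fixes t ti :: "nat \<Rightarrow> nat \<Rightarrow> 'a::idom" and n :: nat
  assumes t_ti: "\<And>i j. t i j * ti i j = 1"
begin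

abbreviation "PM \<equiv> path_matrix t ti n"

lemma ti_t: "ti i j * t i j = 1"
  using t_ti by (simp add: mult.commute)

text \<open>The base change of one row step on the \<open>d\<close> columns from \<open>b\<close>
  on. Its diagonal is 1 and it is triangular, so it preserves minors.\<close>

definition ratio_matrix :: "nat \<Rightarrow> nat \<Rightarrow> nat \<Rightarrow> 'a mat" where
  "ratio_matrix k b d = mat d d (\<lambda>(s, j). if j \<le> s then ti k (b + s) * t k (b + j) else 0)"

lemma det_ratio_matrix: "det (ratio_matrix k b d) = 1"
proof -
  have "det (ratio_matrix k b d) = prod_list (diag_mat (ratio_matrix k b d))"
    by (rule det_lower_triangular[of d]) (auto simp: ratio_matrix_def)
  also have "\<dots> = 1"
    by (simp add: prod_list_diag_prod ratio_matrix_def ti_t)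
  finally show ?thesis .
qed

lemma sum_window:
  fixes b d j :: nat
  assumes "j < d"
  shows "(\<Sum>s<d. g s * (if j \<le> s then h s else 0)) = (\<Sum>s\<in>{b + j..<b + d}. g (s - b) * (h (s - b) :: 'a))"
proof -
  have "(\<Sum>s<d. g s * (if j \<le> s then h s else 0)) = (\<Sum>s\<in>{j..<d}. g s * h s)"
    by (rule sum.mono_neutral_cong_right) auto
  also have "\<dots> = (\<Sum>s\<in>{b + j..<b + d}. g (s - b) * h (s - b))"
    by (rule sum.reindex_bij_witness[of _ "\<lambda>s. s - b" "\<lambda>s. s + b"]) auto
  finally show ?thesis .
qed

definition solid_minor :: "nat \<Rightarrow> nat \<Rightarrow> nat \<Rightarrow> nat \<Rightarrow> 'a" where
  "solid_minor m a b d = det (mat d d (\<lambda>(r, s). PM m (a + r) (b + s)))"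

text \<open>The tail sums run up to column \<open>n\<close> and stay inside a window that ends
  there, so the row step only multiplies the window by a unitriangular matrix.\<close>

lemma solid_minor_right:
  assumes "a + d \<le> Suc m" "b + d = Suc n"
  shows "solid_minor (Suc m) a b d = solid_minor m a b d"
proof -
  let ?A = "mat d d (\<lambda>(r, s). PM m (a + r) (b + s))"
  have "mat d d (\<lambda>(r, s). PM (Suc m) (a + r) (b + s)) = ?A * ratio_matrix (Suc m) b d"
  proof (rule eq_matI)
    fix r j assume "r < dim_row (?A * ratio_matrix (Suc m) b d)" "j < dim_col (?A * ratio_matrix (Suc m) b d)"
    then have r: "r < d" and j: "j < d" by (auto simp: ratio_matrix_def)
    have "(?A * ratio_matrix (Suc m) b d) $$ (r, j) =
        (\<Sum>s<d. PM m (a + r) (b + s) * (if j \<le> s then ti (Suc m) (b + s) * t (Suc m) (b + j) else 0))"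
      using r j by (simp add: ratio_matrix_def scalar_prod_def atLeast0LessThan)
    also have "\<dots> = (\<Sum>s\<in>{b + j..<b + d}. PM m (a + r) (b + (s - b)) * (ti (Suc m) (b + (s - b)) * t (Suc m) (b + j)))"
      by (rule sum_window[OF j])
    also have "\<dots> = (\<Sum>s\<in>{b + j..n}. PM m (a + r) s * ti (Suc m) s) * t (Suc m) (b + j)"
      unfolding sum_distrib_right using assms(2) by (intro sum.cong) (auto simp: mult.assoc)
    also have "\<dots> = PM (Suc m) (a + r) (b + j)" using assms r by auto
    finally show "mat d d (\<lambda>(r, s). PM (Suc m) (a + r) (b + s)) $$ (r, j) = (?A * ratio_matrix (Suc m) b d) $$ (r, j)"
      using r j by simp
  qed (auto simp: ratio_matrix_def)
  moreover have "det (?A * ratio_matrix (Suc m) b d) = det ?A * det (ratio_matrix (Suc m) b d)"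
    by (rule det_mult[of _ d]) (auto simp: ratio_matrix_def)
  ultimately show ?thesis by (simp add: solid_minor_def det_ratio_matrix)
qed

text \<open>Here the tail sums leave the window. The part beyond it is carried by the new entry in
  the last column of the window, so after splitting off the unitriangular factor only that column is
  new, and the bottom row has the pivot as its single nonzero entry.\<close>

lemma solid_minor_bottom_step:
  assumes "a + d = Suc m" "b + d \<le> n"
  shows "solid_minor (Suc m) a b (Suc d) = t (Suc m) (b + d) * solid_minor m a b d"
proof -
  let ?A = "mat (Suc d) (Suc d) (\<lambda>(r, s). if r < d then if s < d then PM m (a + r) (b + s)
      else PM (Suc m) (a + r) (b + d) else if s < d then 0 else t (Suc m) (b + d))"
  let ?U = "ratio_matrix (Suc m) b (Suc d)"
  have "mat (Suc d) (Suc d) (\<lambda>(r, s). PM (Suc m) (a + r) (b + s)) = ?A * ?U"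
  proof (rule eq_matI)
    fix r j assume "r < dim_row (?A * ?U)" "j < dim_col (?A * ?U)"
    then have r: "r < Suc d" and j: "j < Suc d" by (auto simp: ratio_matrix_def)
    have e: "(?A * ?U) $$ (r, j) =
        (\<Sum>s<Suc d. ?A $$ (r, s) * (if j \<le> s then ti (Suc m) (b + s) * t (Suc m) (b + j) else 0))"
      using r j by (simp add: ratio_matrix_def scalar_prod_def atLeast0LessThan)
    show "mat (Suc d) (Suc d) (\<lambda>(r, s). PM (Suc m) (a + r) (b + s)) $$ (r, j) = (?A * ?U) $$ (r, j)"
    proof (cases "r < d")
      case False
      then have "r = d" using r by simp
      then have "(?A * ?U) $$ (r, j) = t (Suc m) (b + d) * ti (Suc m) (b + d) * t (Suc m) (b + j)"
        unfolding e using j by (simp add: mult.assoc)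
      then show ?thesis using assms \<open>r = d\<close> j by (simp add: t_ti)
    next
      case True
      have "(?A * ?U) $$ (r, j) =
          (\<Sum>s<d. PM m (a + r) (b + s) * (if j \<le> s then ti (Suc m) (b + s) * t (Suc m) (b + j) else 0))
          + PM (Suc m) (a + r) (b + d) * (ti (Suc m) (b + d) * t (Suc m) (b + j))"
        unfolding e using True j by simp
      also have "(\<Sum>s<d. PM m (a + r) (b + s) * (if j \<le> s then ti (Suc m) (b + s) * t (Suc m) (b + j) else 0))
          = (\<Sum>s\<in>{b + j..<b + d}. PM m (a + r) s * ti (Suc m) s) * t (Suc m) (b + j)"
      proof (cases "j < d")
        case True
        show ?thesis
          unfolding sum_window[OF True, of _ _ b] sum_distrib_right by (intro sum.cong) (auto simp: mult.assoc)
      next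
        case False
        then have "j = d" using j by simp
        then show ?thesis by simp
      qed
      also have "PM (Suc m) (a + r) (b + d) * (ti (Suc m) (b + d) * t (Suc m) (b + j)) =
          (\<Sum>s\<in>{b + d..n}. PM m (a + r) s * ti (Suc m) s) * t (Suc m) (b + j)"
      proof -
        have "PM (Suc m) (a + r) (b + d) = (\<Sum>s\<in>{b + d..n}. PM m (a + r) s * ti (Suc m) s) * t (Suc m) (b + d)"
          using True assms by simp
        moreover have "t (Suc m) (b + d) * (ti (Suc m) (b + d) * x) = x" for x
          by (simp add: mult.assoc[symmetric] t_ti)
        ultimately show ?thesis by (simp only: mult.assoc)
      qed
      also have "(\<Sum>s\<in>{b + j..<b + d}. PM m (a + r) s * ti (Suc m) s) * t (Suc m) (b + j) + \<dots> =
          (\<Sum>s\<in>{b + j..n}. PM m (a + r) s * ti (Suc m) s) * t (Suc m) (b + j)"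
      proof -
        have "{b + j..n} = {b + j..<b + d} \<union> {b + d..n}" "{b + j..<b + d} \<inter> {b + d..n} = {}"
          using j assms by auto
        then show ?thesis by (simp add: sum.union_disjoint distrib_right)
      qed
      finally show ?thesis using True assms j r by simp
    qed
  qed (auto simp: ratio_matrix_def)
  moreover have "det (?A * ?U) = det ?A * det ?U"
    by (rule det_mult[of _ "Suc d"]) (auto simp: ratio_matrix_def)
  moreover have "det ?A = t (Suc m) (b + d) * solid_minor m a b d"
  proof -
    have "det ?A = (\<Sum>j<Suc d. ?A $$ (d, j) * cofactor ?A d j)"
      by (rule laplace_expansion_row[of _ "Suc d"]) auto
    also have "\<dots> = t (Suc m) (b + d) * cofactor ?A d d" by simp
    also have "mat_delete ?A d d = mat d d (\<lambda>(r, s). PM m (a + r) (b + s))"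
      by (rule eq_matI) (auto simp: mat_delete_def)
    then have "cofactor ?A d d = solid_minor m a b d"
      by (simp add: cofactor_def solid_minor_def)
    finally show ?thesis .
  qed
  ultimately show ?thesis
    unfolding solid_minor_def[of "Suc m"] det_ratio_matrix by simp
qed

lemma solid_minor_bottom:
  "\<lbrakk>1 \<le> a; a + d = Suc m; b + d \<le> Suc n\<rbrakk> \<Longrightarrow> solid_minor m a b d = (\<Prod>r<d. t (a + r) (b + r))"
proof (induction d arbitrary: m)
  case 0
  then show ?case by (simp add: solid_minor_def)
next
  case (Suc d)
  then obtain k where k: "m = Suc k" "a + d = Suc k" by (cases m) auto
  have "solid_minor m a b (Suc d) = t (Suc k) (b + d) * solid_minor k a b d"
    unfolding k(1) using Suc.prems k by (intro solid_minor_bottom_step) auto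
  also have "solid_minor k a b d = (\<Prod>r<d. t (a + r) (b + r))"
    using Suc.prems k by (intro Suc.IH) auto
  finally show ?case using k by (simp add: mult.commute)
qed

text \<open>Right after the lowest row of the minor has been appended, the minor is its diagonal
  product; if the window ends at the last column, rows appended below no longer change it. Every
  minor of the theorem touches the bottom row or the last column.\<close>

lemma solid_minor_frozen:
  assumes "1 \<le> a" "a + d \<le> Suc m" "b + d \<le> Suc n" "a + d = Suc m \<or> b + d = Suc n"
  shows "solid_minor m a b d = (\<Prod>r<d. t (a + r) (b + r))"
proof (cases "a + d = Suc m")
  case True
  then show ?thesis using assms by (intro solid_minor_bottom) auto
next
  case False
  have *: "solid_minor (a + d - 1 + k) a b d = solid_minor (a + d - 1) a b d" for k
  proof (induction k)
    case (Suc k)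
    have "solid_minor (Suc (a + d - 1 + k)) a b d = solid_minor (a + d - 1 + k) a b d"
      by (rule solid_minor_right) (use False assms in auto)
    with Suc show ?case by simp
  qed simp
  have "solid_minor m a b d = solid_minor (a + d - 1) a b d"
    using *[of "m - (a + d - 1)"] assms by simp
  also have "\<dots> = (\<Prod>r<d. t (a + r) (b + r))"
    using assms by (intro solid_minor_bottom) auto
  finally show ?thesis .
qed

end

text \<open>Positions are sorted by column minus row: negative for the lower left minors, above
  \<open>n - m\<close> for the upper right ones, in between for the minors with all rows. The
  witnesses recover the diagonal and the place on it.\<close>

lemma prod_diagonals:
  fixes f :: "nat \<Rightarrow> nat \<Rightarrow> 'a::comm_monoid_mult"
  assumes "0 < m" "m \<le> n"
  shows "(\<Prod>j\<in>{1..m - 1}. (\<Prod>r<j. f (m - j + 1 + r) (1 + r)) * (\<Prod>r<j. f (1 + r) (n - j + 1 + r))) *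
      (\<Prod>k\<in>{1..n - m + 1}. \<Prod>r<m. f (1 + r) (k + r)) = (\<Prod>(i, c)\<in>{1..m} \<times> {1..n}. f i c)"
proof -
  let ?I = "{1..m} \<times> {1..n}"
  have 1: "(\<Prod>j\<in>{1..m - 1}. \<Prod>r<j. f (m - j + 1 + r) (1 + r)) = (\<Prod>(i, c)\<in>{x\<in>?I. snd x < fst x}. f i c)"
    unfolding prod.Sigma[OF finite_atLeastAtMost ballI[OF finite_lessThan]]
    by (rule prod.reindex_bij_witness[of _ "\<lambda>(i, c). (m - i + c, c - 1)" "\<lambda>(j, r). (m - j + 1 + r, 1 + r)"])
      (use assms in auto)
  have 2: "(\<Prod>j\<in>{1..m - 1}. \<Prod>r<j. f (1 + r) (n - j + 1 + r)) =
      (\<Prod>(i, c)\<in>{x\<in>?I. n - m + fst x < snd x}. f i c)"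
    unfolding prod.Sigma[OF finite_atLeastAtMost ballI[OF finite_lessThan]]
    by (rule prod.reindex_bij_witness[of _ "\<lambda>(i, c). (n - c + i, i - 1)" "\<lambda>(j, r). (1 + r, n - j + 1 + r)"])
      (use assms in auto)
  have 3: "(\<Prod>k\<in>{1..n - m + 1}. \<Prod>r<m. f (1 + r) (k + r)) =
      (\<Prod>(i, c)\<in>{x\<in>?I. fst x \<le> snd x \<and> snd x \<le> n - m + fst x}. f i c)"
    unfolding prod.Sigma[OF finite_atLeastAtMost ballI[OF finite_lessThan]]
    by (rule prod.reindex_bij_witness[of _ "\<lambda>(i, c). (c - i + 1, i - 1)" "\<lambda>(k, r). (1 + r, k + r)"])
      (use assms in auto)
  have I: "?I = {x\<in>?I. snd x < fst x} \<union> {x\<in>?I. n - m + fst x < snd x} \<union>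
      {x\<in>?I. fst x \<le> snd x \<and> snd x \<le> n - m + fst x}"
    using assms by auto
  have "(\<Prod>(i, c)\<in>?I. f i c) = (\<Prod>(i, c)\<in>{x\<in>?I. snd x < fst x}. f i c) *
      (\<Prod>(i, c)\<in>{x\<in>?I. n - m + fst x < snd x}. f i c) *
      (\<Prod>(i, c)\<in>{x\<in>?I. fst x \<le> snd x \<and> snd x \<le> n - m + fst x}. f i c)"
    by (subst I, subst prod.union_disjoint, simp, simp, force, subst prod.union_disjoint) (use assms in auto)
  then show ?thesis by (simp only: prod.distrib 1 2 3)
qed

section \<open>Operators of the quantum torus\<close>

abbreviation (input) lookup :: "('a \<Rightarrow>\<^sub>0 'b::zero) \<Rightarrow> 'a \<Rightarrow> 'b" where
  "lookup \<equiv> Poly_Mapping.lookup"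

abbreviation (input) keys :: "('a \<Rightarrow>\<^sub>0 'b::zero) \<Rightarrow> 'a set" where
  "keys \<equiv> Poly_Mapping.keys"

abbreviation (input) single :: "'a \<Rightarrow> 'b \<Rightarrow> 'a \<Rightarrow>\<^sub>0 'b::zero" where
  "single \<equiv> Poly_Mapping.single"

text \<open>\<open>g\<close> transports coefficients and \<open>\<phi>\<close> basis elements; the
  same construction yields operators, evaluation at \<epsilon>, and the representation of the free
  algebra.\<close>

definition lin_ext :: "('b::zero \<Rightarrow> 'c::ring_1) \<Rightarrow> ('a \<Rightarrow> 'c) \<Rightarrow> ('a \<Rightarrow>\<^sub>0 'b) \<Rightarrow> 'c" where
  "lin_ext g \<phi> f = (\<Sum>k\<in>keys f. g (lookup f k) * \<phi> k)"

lemma lin_ext_superset: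
  assumes "finite S" "keys f \<subseteq> S" "g 0 = 0"
  shows "lin_ext g \<phi> f = (\<Sum>k\<in>S. g (lookup f k) * \<phi> k)"
  unfolding lin_ext_def using assms
  by (intro sum.mono_neutral_left) (auto simp: in_keys_iff)

lemma lin_ext_single: "g 0 = 0 \<Longrightarrow> lin_ext g \<phi> (single k c) = g c * \<phi> k"
  by (simp add: lin_ext_def)

lemma lin_ext_add:
  fixes g :: "'b::monoid_add \<Rightarrow> 'c::ring_1"
  assumes "g 0 = 0" "\<And>x y. g (x + y) = g x + g y"
  shows "lin_ext g \<phi> (f + h) = lin_ext g \<phi> f + lin_ext g \<phi> h"
proof -
  let ?S = "keys f \<union> keys h"
  have "lin_ext g \<phi> (f + h) = (\<Sum>k\<in>?S. g (lookup (f + h) k) * \<phi> k)"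
    by (rule lin_ext_superset) (use Poly_Mapping.keys_add[of f h] assms in auto)
  also have "\<dots> = (\<Sum>k\<in>?S. g (lookup f k) * \<phi> k) + (\<Sum>k\<in>?S. g (lookup h k) * \<phi> k)"
    by (simp add: lookup_add assms distrib_right sum.distrib)
  also have "\<dots> = lin_ext g \<phi> f + lin_ext g \<phi> h"
    by (simp add: lin_ext_superset[of ?S] assms)
  finally show ?thesis .
qed

lemma additive_sum:
  fixes H :: "'a::comm_monoid_add \<Rightarrow> 'b::ring_1"
  assumes "\<And>x y. H (x + y) = H x + H y"
  shows "H (sum f S) = (\<Sum>s\<in>S. H (f s))"
proof -
  have "H 0 = 0" using assms[of 0 0] by simp
  then show ?thesis by (induction S rule: infinite_finite_induct) (auto simp: assms)
qed

lemma poly_mapping_sum_single: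
  "(f :: 'a \<Rightarrow>\<^sub>0 'b::comm_monoid_add) =
    (\<Sum>k\<in>keys f. single k (lookup f k))"
proof (rule poly_mapping_eqI)
  fix k
  have "(\<Sum>x\<in>keys f. lookup f x when x = k) =
      (\<Sum>x\<in>keys f. if x = k then lookup f k else 0)"
    by (intro sum.cong) auto
  then show "lookup f k = lookup
      (\<Sum>k\<in>keys f. single k (lookup f k)) k"
    by (simp add: lookup_sum lookup_single in_keys_iff)
qed

lemma additive_mult_ext:
  fixes H :: "('a::monoid_add \<Rightarrow>\<^sub>0 'b::semiring_0) \<Rightarrow> 'c::ring_1"
  assumes add: "\<And>x y. H (x + y) = H x + H y"
    and single: "\<And>a b c d. H (single (a + b) (c * d)) = H (single a c) * H (single b d)"
  shows "H (x * y) = H x * H y"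
proof -
  let ?s = "\<lambda>f k. single k (lookup f k)"
  have "x * y = (\<Sum>a\<in>keys x. ?s x a) * (\<Sum>b\<in>keys y. ?s y b)"
    by (subst poly_mapping_sum_single[of x], subst poly_mapping_sum_single[of y]) simp
  then have "H (x * y) = (\<Sum>a\<in>keys x. \<Sum>b\<in>keys y. H (?s x a) * H (?s y b))"
    by (simp add: sum_product additive_sum[of H, OF add] mult_single single)
  also have "\<dots> = H (\<Sum>a\<in>keys x. ?s x a) * H (\<Sum>b\<in>keys y. ?s y b)"
    by (simp add: sum_product additive_sum[of H, OF add])
  also have "\<dots> = H x * H y"
    by (simp only: poly_mapping_sum_single[symmetric])
  finally show ?thesis .
qed

lemma lin_ext_mult:
  fixes g :: "'b::semiring_0 \<Rightarrow> 'c::ring_1" and \<phi> :: "'a::monoid_add \<Rightarrow> 'c"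
  assumes "g 0 = 0" "\<And>x y. g (x + y) = g x + g y" "\<And>x y. g (x * y) = g x * g y"
    and "\<And>a b. \<phi> (a + b) = \<phi> a * \<phi> b" "\<And>c a. \<phi> a * g c = g c * \<phi> a"
  shows "lin_ext g \<phi> (x * y) = lin_ext g \<phi> x * lin_ext g \<phi> y"
proof (rule additive_mult_ext)
  fix a b c d
  have "g (c * d) * \<phi> (a + b) = g c * \<phi> a * (g d * \<phi> b)"
    by (metis assms(3-5) mult.assoc)
  then show "lin_ext g \<phi> (single (a + b) (c * d)) =
      lin_ext g \<phi> (single a c) * lin_ext g \<phi> (single b d)"
    by (simp only: lin_ext_single[where g = g, OF assms(1)])
qed (rule lin_ext_add[OF assms(1,2)])

section \<open>Linear operators on a commutative Laurent ring\<close>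

type_synonym expo = "(nat \<times> nat) \<Rightarrow>\<^sub>0 int"
type_synonym 'k torus = "expo \<Rightarrow>\<^sub>0 'k"

abbreviation tmon :: "expo \<Rightarrow> 'k::field torus" where
  "tmon a \<equiv> single a 1"

abbreviation cst :: "'k::field \<Rightarrow> 'k torus" where
  "cst c \<equiv> single 0 c"

lemma single_eq_cst_mono: "single a c = cst c * tmon a"
  by (simp add: mult_single)

lemma cst_mult: "cst (c * d) = cst c * cst d"
  by (simp add: mult_single)

text \<open>All linear endomorphisms, whatever \<open>m\<close>, \<open>n\<close> and \<epsilon>
  are, so that composition gives one fixed ring; the quantum torus sits inside it through the
  operators \<open>\<tau> a\<close>.\<close>

typedef (overloaded) 'k::field torus_op =
  "{F :: 'k torus \<Rightarrow> 'k torus. (\<forall>f g. F (f + g) = F f + F g) \<and> (\<forall>c f. F (cst c * f) = cst c * F f)}"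
  morphisms app Torus_Op
  by (rule exI[of _ "\<lambda>_. 0"]) simp

setup_lifting type_definition_torus_op

instantiation torus_op :: (field) ring_1
begin

lift_definition zero_torus_op :: "'a torus_op" is "\<lambda>_. 0" by simp
lift_definition one_torus_op :: "'a torus_op" is "\<lambda>f. f" by simp
lift_definition plus_torus_op :: "'a torus_op \<Rightarrow> 'a torus_op \<Rightarrow> 'a torus_op" is "\<lambda>F G f. F f + G f"
  by (simp add: algebra_simps)
lift_definition uminus_torus_op :: "'a torus_op \<Rightarrow> 'a torus_op" is "\<lambda>F f. - F f"
  by (simp add: algebra_simps)
lift_definition minus_torus_op :: "'a torus_op \<Rightarrow> 'a torus_op \<Rightarrow> 'a torus_op" is "\<lambda>F G f. F f - G f"
  by (simp add: algebra_simps)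
lift_definition times_torus_op :: "'a torus_op \<Rightarrow> 'a torus_op \<Rightarrow> 'a torus_op" is "\<lambda>F G f. F (G f)"
  by simp

instance
proof
  show "(0::'a torus_op) \<noteq> 1"
    by (transfer, metis zero_neq_one)
qed (transfer, simp add: fun_eq_iff algebra_simps)+

end

lemma app_simps [simp]:
  "app 0 f = 0" "app 1 f = f" "app (F + G) f = app F f + app G f" "app (- F) f = - app F f"
  "app (F - G) f = app F f - app G f" "app (F * G) f = app F (app G f)"
  by (simp_all add: zero_torus_op.rep_eq one_torus_op.rep_eq plus_torus_op.rep_eq
    uminus_torus_op.rep_eq minus_torus_op.rep_eq times_torus_op.rep_eq)

lemma app_linear:
  "app F (f + g) = app F f + app F g" "app F (cst c * f) = cst c * app F f"
  using app[of F] by auto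

lemma app_zero [simp]: "app F 0 = 0"
  using app_linear(2)[of F 0 0] by simp

lemma app_sum: "app F (sum h S) = (\<Sum>s\<in>S. app F (h s))"
  by (rule additive_sum) (rule app_linear)

lemma app_sum_op: "app (sum H S) f = (\<Sum>s\<in>S. app (H s) f)"
  by (induction S rule: infinite_finite_induct) auto

lemma app_expand: "app F f = (\<Sum>a\<in>keys f. cst (lookup f a) * app F (tmon a))"
  by (subst poly_mapping_sum_single[of f])
     (simp add: app_sum app_linear(2)[symmetric] single_eq_cst_mono[symmetric])

lemma torus_op_eqI:
  assumes "\<And>a. app F (tmon a) = app G (tmon a)"
  shows "F = G"
proof -
  have "app F f = app G f" for f
    by (simp only: app_expand[of F f] app_expand[of G f] assms)
  then show ?thesis by (simp add: app_inject[symmetric] fun_eq_iff)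
qed

definition mulop :: "'k::field torus \<Rightarrow> 'k torus_op" where
  "mulop f = Torus_Op (\<lambda>g. f * g)"

lemma app_mulop [simp]: "app (mulop f) g = f * g"
  by (simp add: mulop_def Torus_Op_inverse algebra_simps)

lemma mulop_simps:
  "mulop 0 = 0" "mulop 1 = 1" "mulop (f + g) = mulop f + mulop g" "mulop (f * g) = mulop f * mulop g"
  "mulop (- f) = - mulop f"
  by (rule torus_op_eqI, simp add: algebra_simps)+

lemma mulop_inject [simp]: "mulop f = mulop g \<longleftrightarrow> f = g"
proof
  assume "mulop f = mulop g"
  then have "app (mulop f) 1 = app (mulop g) 1" by simp
  then show "f = g" by simp
qed simp

definition lin_op :: "(expo \<Rightarrow> 'k::field torus) \<Rightarrow> 'k torus_op" where
  "lin_op \<phi> = Torus_Op (lin_ext cst \<phi>)"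

lemma app_lin_op [simp]: "app (lin_op \<phi>) (single a c) = cst c * \<phi> a"
proof -
  have "lin_ext cst \<phi> (f + g) = lin_ext cst \<phi> f + lin_ext cst \<phi> g" for f g
    by (rule lin_ext_add) (auto simp: single_add)
  moreover have "lin_ext cst \<phi> (cst c * f) = cst c * lin_ext cst \<phi> f" for c f
  proof -
    have lk: "lookup (cst c * f) k = c * lookup f k" for k
      by (simp add: mult_map_scale_conv_mult[symmetric] Poly_Mapping.map.rep_eq when_def)
    have "lin_ext cst \<phi> (cst c * f) =
        (\<Sum>k\<in>keys f. cst (lookup (cst c * f) k) * \<phi> k)"
      by (rule lin_ext_superset) (auto simp: in_keys_iff lk)
    then show ?thesis
      by (simp add: lk lin_ext_def sum_distrib_left cst_mult mult.assoc)
  qed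
  ultimately show ?thesis
    by (simp add: lin_op_def Torus_Op_inverse lin_ext_single)
qed

definition opscale :: "'k::field \<Rightarrow> 'k torus_op \<Rightarrow> 'k torus_op" where
  "opscale c F = mulop (cst c) * F"

lemma app_opscale [simp]: "app (opscale c F) f = cst c * app F f"
  by (simp add: opscale_def)

interpretation OP: scalar_algebra opscale
proof
  fix c d :: "'a::field" and x y :: "'a torus_op"
  show "opscale c (x + y) = opscale c x + opscale c y" by (simp add: opscale_def distrib_left)
  show "opscale (c + d) x = opscale c x + opscale d x"
    by (simp add: opscale_def single_add mulop_simps distrib_right)
  show "opscale c (opscale d x) = opscale (c * d) x"
    by (simp add: opscale_def cst_mult mulop_simps mult.assoc)
  show "opscale 1 x = x" by (simp add: opscale_def mulop_simps)
  show "opscale c x * y = opscale c (x * y)" by (simp add: opscale_def mult.assoc)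
  show "x * opscale c y = opscale c (x * y)"
    by (rule torus_op_eqI) (simp add: app_linear)
qed

lemma powi_add: "(x::'k::field) \<noteq> 0 \<Longrightarrow> x powi (a + b) = x powi a * x powi b"
  by (simp add: power_int_add)

section \<open>The quantum torus, its right multiplications and its central exponents\<close>

locale quantum_setup =
  fixes m n l :: nat and \<epsilon> :: "'k::field_char_0"
  assumes l: "odd l" and \<epsilon>: "primitive_root_of_unity l \<epsilon>" and mn: "0 < m" "m \<le> n"
begin

lemma eps_nz [simp]: "\<epsilon> \<noteq> 0" and l_pos: "0 < l" and eps_l: "\<epsilon> ^ l = 1"
  using primitive_root_of_unityD[OF \<epsilon>] by auto

definition I :: "(nat \<times> nat) set" where "I = {1..m} \<times> {1..n}"

lemma finite_I [simp]: "finite I"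
  by (simp add: I_def)

text \<open>
  \<open>B\<close> makes \<open>\<tau> (e p)\<close> and \<open>\<tau> (e r)\<close> commute up to the power of \<open>\<epsilon>\<close> that the leading terms of the
  quantum matrix relations prescribe.
\<close>

definition \<beta> :: "nat \<times> nat \<Rightarrow> nat \<times> nat \<Rightarrow> int" where
  "\<beta> p r = (if (fst p < fst r \<and> snd p = snd r) \<or> (fst p = fst r \<and> snd p < snd r) then 1 else 0)"

definition B :: "expo \<Rightarrow> expo \<Rightarrow> int" where
  "B a b = (\<Sum>p\<in>I. \<Sum>r\<in>I. \<beta> p r * lookup a p * lookup b r)"

lemma B_add: "B (a + a') b = B a b + B a' b" "B a (b + b') = B a b + B a b'"
  by (simp_all add: B_def lookup_add algebra_simps sum.distrib)

lemma B_zero [simp]: "B 0 b = 0" "B a 0 = 0"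
  by (simp_all add: B_def)

lemma B_uminus: "B (- a) b = - B a b" "B a (- b) = - B a b"
  by (simp_all add: B_def sum_negf)

lemma B_single:
  "B (single p c) (single r d) = (if p \<in> I \<and> r \<in> I then \<beta> p r * c * d else 0)"
proof -
  have "B (single p c) (single r d) =
      (\<Sum>p'\<in>I. \<Sum>r'\<in>I. if p' = p then if r' = r then \<beta> p r * c * d else 0 else 0)"
    unfolding B_def by (intro sum.cong refl) (auto simp: lookup_single when_def)
  also have "\<dots> = (\<Sum>p'\<in>I. if p' = p then if r \<in> I then \<beta> p r * c * d else 0 else 0)"
    by (intro sum.cong refl) (auto simp: sum.delta)
  finally show ?thesis by (simp add: sum.delta)
qed

text \<open>\<open>\<tau>\<close> and \<open>\<rho>\<close> are left and right multiplication by a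
  monomial for the product twisted by the bicharacter \<open>\<epsilon> powi B a b\<close>;
  associativity of that product is why they commute.\<close>

definition \<tau> :: "expo \<Rightarrow> 'k torus_op" where
  "\<tau> a = lin_op (\<lambda>b. single (a + b) (\<epsilon> powi B a b))"

definition \<rho> :: "expo \<Rightarrow> 'k torus_op" where
  "\<rho> c = lin_op (\<lambda>b. single (b + c) (\<epsilon> powi B b c))"

lemma app_tau: "app (\<tau> a) (single b c) = single (a + b) (c * \<epsilon> powi B a b)"
  by (simp add: \<tau>_def mult_single)

lemma app_rho: "app (\<rho> a) (single b c) = single (b + a) (c * \<epsilon> powi B b a)"
  by (simp add: \<rho>_def mult_single)

lemma tau_mult: "\<tau> a * \<tau> b = opscale (\<epsilon> powi B a b) (\<tau> (a + b))"
  by (rule torus_op_eqI) (simp add: app_tau mult_single B_add powi_add add.assoc mult_ac)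

lemma tau_0 [simp]: "\<tau> 0 = 1"
  by (rule torus_op_eqI) (simp add: app_tau)

lemma tau_rho: "\<tau> a * \<rho> c = \<rho> c * \<tau> a"
  by (rule torus_op_eqI) (simp add: app_tau app_rho B_add powi_add add.assoc mult_ac)

lemma tau_comm: "OP.qcomm (\<epsilon> powi (B a b - B b a)) (\<tau> a) (\<tau> b)"
  by (simp add: OP.qcomm_def tau_mult OP.sc_sc add.commute power_int_diff)

definition e :: "nat \<Rightarrow> nat \<Rightarrow> expo" where "e i j = single (i, j) 1"

definition T :: "nat \<Rightarrow> nat \<Rightarrow> 'k torus_op" where "T i j = \<tau> (e i j)"
definition Ti :: "nat \<Rightarrow> nat \<Rightarrow> 'k torus_op" where "Ti i j = \<tau> (- e i j)"

text \<open>\<open>\<beta>\<close> records each pair of positions in one order only and vanishes on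
  the diagonal, so powers of a single variable carry no scalar and inverses are plain negatives of
  exponents.\<close>

lemma B_self_single [simp]: "B (single p c) (single p d) = 0"
  by (simp add: B_single \<beta>_def)

lemma tau_uminus_single:
  "\<tau> (single p c) * \<tau> (- single p c) = 1"
  "\<tau> (- single p c) * \<tau> (single p c) = 1"
  by (simp_all add: tau_mult B_uminus)

sublocale Q: quantum_torus_matrix opscale \<epsilon> m n T Ti
proof
  fix i j k s :: nat
  show "T i j * Ti i j = 1" "Ti i j * T i j = 1"
    by (simp_all add: T_def Ti_def e_def tau_uminus_single)
  show "OP.qcomm (if s = j then \<epsilon> else 1) (T i s) (T k j)"
    if "1 \<le> i" "i < k" "k \<le> m" "1 \<le> s" "s \<le> n" "1 \<le> j" "j \<le> n"
    using tau_comm[of "e i s" "e k j"] that by (auto simp: T_def e_def B_single I_def \<beta>_def)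
  show "OP.qcomm \<epsilon> (T i j) (T i r)" if "1 \<le> i" "i \<le> m" "1 \<le> j" "j < r" "r \<le> n" for r
    using tau_comm[of "e i j" "e i r"] that by (auto simp: T_def e_def B_single I_def \<beta>_def)
qed simp

text \<open>Entries outside \<open>I\<close> are unrestricted because \<open>B\<close> ignores these
  positions. Thus every exponent is an element of \<open>Lat\<close> plus a unique reduced exponent
  supported in \<open>I\<close>, and monomials with exponent in \<open>Lat\<close> are central in
  the torus.\<close>

definition Lat :: "expo set" where "Lat = {a. \<forall>p\<in>I. int l dvd lookup a p}"

lemma Lat_closed: "0 \<in> Lat" "a \<in> Lat \<Longrightarrow> b \<in> Lat \<Longrightarrow> a + b \<in> Lat" "a \<in> Lat \<Longrightarrow> - a \<in> Lat"
  "a \<in> Lat \<Longrightarrow> b \<in> Lat \<Longrightarrow> a - b \<in> Lat"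
  by (auto simp: Lat_def lookup_add lookup_minus)

lemma eps_powi_dvd: "int l dvd k \<Longrightarrow> \<epsilon> powi k = 1"
  by (auto simp: power_int_mult eps_l)

lemma eps_B_Lat: "a \<in> Lat \<Longrightarrow> \<epsilon> powi B a b = 1" "a \<in> Lat \<Longrightarrow> \<epsilon> powi B b a = 1"
  unfolding B_def by (intro eps_powi_dvd dvd_sum; simp add: Lat_def)+

text \<open>On these exponents the twist is trivial, so left, right and commutative multiplication
  agree.\<close>

lemma tau_Lat: "a \<in> Lat \<Longrightarrow> \<tau> a = mulop (tmon a)"
  by (rule torus_op_eqI) (simp add: app_tau eps_B_Lat mult_single)

lemma rho_Lat: "a \<in> Lat \<Longrightarrow> \<rho> a = mulop (tmon a)"
  by (rule torus_op_eqI) (simp add: app_rho eps_B_Lat mult_single add.commute)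

lemma single_l_Lat: "single p (int l) \<in> Lat" "single p (- int l) \<in> Lat"
  by (auto simp: Lat_def lookup_single when_def)

lemma tau_single_power: "\<tau> (single p c) ^ k = \<tau> (single p (int k * c))"
  by (induction k) (auto simp: tau_mult single_add[symmetric] algebra_simps)

definition t :: "nat \<Rightarrow> nat \<Rightarrow> 'k torus" where "t i j = tmon (single (i, j) (int l))"
definition ti :: "nat \<Rightarrow> nat \<Rightarrow> 'k torus" where "ti i j = tmon (single (i, j) (- int l))"

sublocale C: classical_path_matrix t ti n
  by unfold_locales (simp add: t_def ti_def mult_single single_add[symmetric])

lemma T_power: "T i j ^ l = mulop (t i j)" "Ti i j ^ l = mulop (ti i j)"
  by (simp_all add: T_def Ti_def e_def single_uminus[symmetric] tau_single_power t_def ti_def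
    tau_Lat single_l_Lat)

definition X' :: "nat \<Rightarrow> nat \<Rightarrow> 'k torus_op" where "X' = path_matrix T Ti n m"
definition \<zeta> :: "nat \<Rightarrow> nat \<Rightarrow> 'k torus" where "\<zeta> = path_matrix t ti n m"

lemma mulop_sum: "mulop (sum f S) = (\<Sum>s\<in>S. mulop (f s))"
  by (rule additive_sum) (rule mulop_simps)

lemma mulop_path_matrix:
  "mulop (path_matrix t ti n k i j) = path_matrix (\<lambda>i j. mulop (t i j)) (\<lambda>i j. mulop (ti i j)) n k i j"
  by (induction k arbitrary: j) (auto simp: mulop_simps mulop_sum)

lemma quantum_matrix_X': "OP.quantum_matrix \<epsilon> m n X'"
  unfolding X'_def by (rule Q.quantum_matrix_path_matrix) simp

lemma X'_power: "(i, j) \<in> I \<Longrightarrow> X' i j ^ l = mulop (\<zeta> i j)"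
  using Q.path_matrix_power[OF \<epsilon> l, of i m j]
  by (simp add: X'_def \<zeta>_def I_def mulop_path_matrix T_power)

text \<open>
  The vector \<open>1\<close> is cyclic for the operators \<open>\<rho> c\<close>, so an operator commuting with all of them
  is determined by its value at \<open>1\<close>.
\<close>

definition centralizer :: "'k torus_op set" where
  "centralizer = {F. \<forall>c. F * \<rho> c = \<rho> c * F}"

lemma centralizer_closed:
  "0 \<in> centralizer" "1 \<in> centralizer" "F \<in> centralizer \<Longrightarrow> G \<in> centralizer \<Longrightarrow> F + G \<in> centralizer"
  "F \<in> centralizer \<Longrightarrow> G \<in> centralizer \<Longrightarrow> F * G \<in> centralizer"
  "F \<in> centralizer \<Longrightarrow> - F \<in> centralizer" "F \<in> centralizer \<Longrightarrow> opscale c F \<in> centralizer"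
proof -
  assume "F \<in> centralizer" "G \<in> centralizer"
  then have F: "F * \<rho> c = \<rho> c * F" and G: "G * \<rho> c = \<rho> c * G" for c by (auto simp: centralizer_def)
  have "F * G * \<rho> c = \<rho> c * (F * G)" for c by (metis F G mult.assoc)
  then show "F * G \<in> centralizer" by (simp add: centralizer_def)
qed (auto simp: centralizer_def algebra_simps OP.sc_mult_left OP.sc_mult_right)

lemma centralizer_sum: "(\<And>s. s \<in> S \<Longrightarrow> H s \<in> centralizer) \<Longrightarrow> sum H S \<in> centralizer"
  by (induction S rule: infinite_finite_induct) (auto simp: centralizer_closed)

lemma tau_centralizer: "\<tau> a \<in> centralizer"
  by (simp add: centralizer_def tau_rho)

lemma path_matrix_centralizer: "path_matrix T Ti n k i j \<in> centralizer"
  by (induction k arbitrary: j)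
    (auto simp: centralizer_closed T_def Ti_def tau_centralizer intro!: centralizer_closed centralizer_sum)

lemma X'_centralizer: "X' i j \<in> centralizer"
  by (simp add: X'_def path_matrix_centralizer)

lemma centralizer_app_mono: "F \<in> centralizer \<Longrightarrow> app F (tmon a) = app (\<rho> a) (app F 1)"
proof -
  assume "F \<in> centralizer"
  then have "app (F * \<rho> a) 1 = app (\<rho> a * F) 1" by (simp add: centralizer_def)
  moreover have "app (\<rho> a) 1 = tmon a" using app_rho[of a 0 1] by simp
  ultimately show ?thesis by simp
qed

lemma centralizer_eqI:
  assumes "F \<in> centralizer" "G \<in> centralizer" "app F 1 = app G 1"
  shows "F = G"
  by (rule torus_op_eqI) (simp add: centralizer_app_mono assms)

definition Z :: "'k torus set" where "Z = {f. keys f \<subseteq> Lat}"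

text \<open>For \<open>a\<close> in \<open>Lat\<close>, \<open>\<rho> a\<close> is multiplication by
  a monomial, so commuting with all \<open>\<rho> c\<close> includes linearity over
  \<open>Z\<close>.\<close>

lemma centralizer_Z_linear:
  assumes "F \<in> centralizer" "f \<in> Z"
  shows "app F (f * g) = f * app F g"
proof -
  have tmon: "app F (tmon a * h) = tmon a * app F h" if "a \<in> Lat" for a h
  proof -
    have "app (F * \<rho> a) h = app (\<rho> a * F) h" using assms(1) by (simp add: centralizer_def)
    then show ?thesis by (simp add: rho_Lat that)
  qed
  have f: "f = (\<Sum>a\<in>keys f. cst (lookup f a) * tmon a)"
    by (subst poly_mapping_sum_single) (simp add: single_eq_cst_mono[symmetric])
  have "app F (f * g) = (\<Sum>a\<in>keys f. app F (cst (lookup f a) * (tmon a * g)))"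
    by (subst f) (simp add: sum_distrib_right app_sum mult.assoc)
  also have "\<dots> = (\<Sum>a\<in>keys f. cst (lookup f a) * tmon a) * app F g"
    using assms(2) by (auto simp: Z_def app_linear tmon sum_distrib_right mult.assoc intro!: sum.cong)
  finally show ?thesis by (simp only: f[symmetric])
qed

end

section \<open>Leading exponents\<close>

lemma lookup_single_mult:
  "lookup (single x c * (g :: 'a::ab_group_add \<Rightarrow>\<^sub>0 'b::comm_ring_1)) k =
    c * lookup g (k - x)"
proof -
  have "single x c * g =
      (\<Sum>b\<in>keys g. single (x + b) (c * lookup g b))"
    by (subst poly_mapping_sum_single[of g]) (simp add: sum_distrib_left mult_single)
  then have "lookup (single x c * g) k =
      (\<Sum>b\<in>keys g. c * lookup g b when x + b = k)"
    by (simp add: lookup_sum lookup_single)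
  also have "\<dots> = (\<Sum>b\<in>keys g. if b = k - x then c * lookup g (k - x) else 0)"
    by (intro sum.cong) (auto simp: when_def)
  finally show ?thesis by (simp add: in_keys_iff)
qed

lemma lookup_mult_group:
  "lookup (f * (g :: 'a::ab_group_add \<Rightarrow>\<^sub>0 'b::comm_ring_1)) k =
    (\<Sum>x\<in>keys f. lookup f x * lookup g (k - x))"
  by (subst poly_mapping_sum_single[of f]) (simp add: sum_distrib_right lookup_sum lookup_single_mult)

definition leading :: "'a::linorder \<Rightarrow> ('a \<Rightarrow>\<^sub>0 'b::zero) \<Rightarrow> bool" where
  "leading a f \<longleftrightarrow> lookup f a \<noteq> 0 \<and> (\<forall>b. lookup f b \<noteq> 0 \<longrightarrow> b \<le> a)"

definition below :: "'a::linorder \<Rightarrow> ('a \<Rightarrow>\<^sub>0 'b::zero) \<Rightarrow> bool" where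
  "below a f \<longleftrightarrow> (\<forall>b. lookup f b \<noteq> 0 \<longrightarrow> b < a)"

lemma leading_exists: "f \<noteq> 0 \<Longrightarrow> \<exists>a. leading a f"
proof -
  assume "f \<noteq> 0"
  then have "keys f \<noteq> {}" by (simp add: keys_eq_empty)
  then have "leading (Max (keys f)) f"
    using Max_in[of "keys f"] by (auto simp: leading_def in_keys_iff[symmetric])
  then show ?thesis ..
qed

lemma leading_nonzero: "leading a f \<Longrightarrow> f \<noteq> 0"
  by (auto simp: leading_def)

lemma leading_unique: "leading a f \<Longrightarrow> leading b f \<Longrightarrow> a = b"
  by (auto simp: leading_def intro: antisym)

text \<open>Only upper bounds are assumed, not that they are attained: the coefficient at the sum of
  the bounds is a product even if it is zero. The expansion of a determinant later relies on
  this.\<close>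

lemma bounded_mult:
  fixes f g :: "'a::linordered_ab_group_add \<Rightarrow>\<^sub>0 'b::idom"
  assumes "\<And>x. lookup f x \<noteq> 0 \<Longrightarrow> x \<le> a" "\<And>x. lookup g x \<noteq> 0 \<Longrightarrow> x \<le> b"
  shows "lookup (f * g) k \<noteq> 0 \<Longrightarrow> k \<le> a + b"
    and "lookup (f * g) (a + b) = lookup f a * lookup g b"
proof -
  have "lookup (f * g) (a + b) =
      (\<Sum>x\<in>keys f. if x = a then lookup f a * lookup g b else 0)"
    unfolding lookup_mult_group
  proof (intro sum.cong refl)
    fix x assume x: "x \<in> keys f"
    have "lookup g (a + b - x) = 0" if "x \<noteq> a"
    proof (rule ccontr)
      assume "lookup g (a + b - x) \<noteq> 0"
      from assms(2)[OF this] have "a \<le> x" by (simp add: algebra_simps)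
      then show False using assms(1)[of x] x that by (simp add: in_keys_iff)
    qed
    then show "lookup f x * lookup g (a + b - x) =
        (if x = a then lookup f a * lookup g b else 0)" by auto
  qed
  also have "\<dots> = lookup f a * lookup g b"
    by (simp add: in_keys_iff)
  finally show "lookup (f * g) (a + b) = lookup f a * lookup g b" .
  assume "lookup (f * g) k \<noteq> 0"
  then obtain x where x: "x \<in> keys f" "lookup g (k - x) \<noteq> 0"
    unfolding lookup_mult_group by (metis (no_types, lifting) mult_zero_right sum.neutral)
  from add_mono[OF assms(1)[of x] assms(2)[OF x(2)]] x(1) show "k \<le> a + b" by (simp add: in_keys_iff)
qed

lemma leading_mult:
  fixes f g :: "'a::linordered_ab_group_add \<Rightarrow>\<^sub>0 'b::idom"
  assumes "leading a f" "leading b g"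
  shows "leading (a + b) (f * g)"
  using assms bounded_mult[of f a g b] by (auto simp: leading_def)

lemma leading_single: "c \<noteq> 0 \<Longrightarrow> leading a (single a c)"
  by (auto simp: leading_def lookup_single when_def split: if_splits)

lemma leading_add_below: "leading a f \<Longrightarrow> below a g \<Longrightarrow> leading a (f + g)"
  unfolding leading_def below_def lookup_add
  by (metis add.right_neutral add_0 less_imp_le order_less_irrefl)

lemma leading_below: "leading a f \<Longrightarrow> a < b \<Longrightarrow> below b f"
  by (auto simp: leading_def below_def)

lemma below_zero [simp]: "below a 0"
  by (simp add: below_def)

lemma below_add: "below a f \<Longrightarrow> below a g \<Longrightarrow> below a (f + g)"
  unfolding below_def lookup_add by (metis add.right_neutral)

lemma below_sum: "(\<And>s. s \<in> S \<Longrightarrow> below a (h s)) \<Longrightarrow> below a (sum h S)"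
  by (induction S rule: infinite_finite_induct) (auto intro: below_add)

text \<open>Distinct leading exponents cannot cancel, so the greatest of them leads the sum;
  vanishing summands have no leading exponent and are exempted.\<close>

lemma leading_sum:
  assumes "finite S" "\<And>s. s \<in> S \<Longrightarrow> h s \<noteq> 0 \<Longrightarrow> leading (d s) (h s)"
    and "\<And>s s'. s \<in> S \<Longrightarrow> s' \<in> S \<Longrightarrow> h s \<noteq> 0 \<Longrightarrow> h s' \<noteq> 0 \<Longrightarrow> d s = d s' \<Longrightarrow> s = s'"
    and "\<exists>s\<in>S. h s \<noteq> 0"
  shows "\<exists>s\<in>S. h s \<noteq> 0 \<and> leading (d s) (sum h S)"
proof -
  let ?S = "{s\<in>S. h s \<noteq> 0}"
  have fin: "finite (d ` ?S)" "d ` ?S \<noteq> {}" using assms by auto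
  obtain s where s: "s \<in> ?S" "d s = Max (d ` ?S)" using Max_in[OF fin] by auto
  have "below (d s) (sum h (S - {s}))"
  proof (rule below_sum)
    fix r assume r: "r \<in> S - {s}"
    show "below (d s) (h r)"
    proof (cases "h r = 0")
      case False
      then have "d r \<le> d s" using s r fin by (auto intro: Max_ge)
      moreover have "d r \<noteq> d s" using assms(3)[of r s] False r s by auto
      ultimately show ?thesis using assms(2)[of r] False r by (intro leading_below) auto
    qed simp
  qed
  then have "leading (d s) (h s + sum h (S - {s}))"
    using s(1) by (intro leading_add_below assms(2)) auto
  then show ?thesis using s(1) assms(1) by (auto simp: sum.remove)
qed

section \<open>Leading exponents of operators and of words\<close>

context quantum_setup
begin

lemma lookup_tau: "lookup (app (\<tau> a) f) k = \<epsilon> powi B a (k - a) * lookup f (k - a)"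
proof -
  have "app (\<tau> a) f = (\<Sum>b\<in>keys f. single (a + b) (lookup f b * \<epsilon> powi B a b))"
    by (subst app_expand) (simp add: app_tau mult_single)
  then have "lookup (app (\<tau> a) f) k =
      (\<Sum>b\<in>keys f. lookup f b * \<epsilon> powi B a b when a + b = k)"
    by (simp add: lookup_sum lookup_single)
  also have "\<dots> = (\<Sum>b\<in>keys f. if b = k - a then \<epsilon> powi B a (k - a) * lookup f (k - a) else 0)"
    by (intro sum.cong) (auto simp: when_def)
  finally show ?thesis by (simp add: in_keys_iff)
qed

lemma lookup_rho: "lookup (app (\<rho> a) f) k = \<epsilon> powi B (k - a) a * lookup f (k - a)"
proof -
  have "app (\<rho> a) f = (\<Sum>b\<in>keys f. single (b + a) (lookup f b * \<epsilon> powi B b a))"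
    by (subst app_expand) (simp add: app_rho mult_single)
  then have "lookup (app (\<rho> a) f) k =
      (\<Sum>b\<in>keys f. lookup f b * \<epsilon> powi B b a when b + a = k)"
    by (simp add: lookup_sum lookup_single)
  also have "\<dots> = (\<Sum>b\<in>keys f. if b = k - a then \<epsilon> powi B (k - a) a * lookup f (k - a) else 0)"
    by (intro sum.cong) (auto simp: when_def)
  finally show ?thesis by (simp add: in_keys_iff)
qed

text \<open>Phrased as a shift of leading exponents, the notion is multiplicative under composition,
  so products of path sums need not be expanded. Leading coefficients are not recorded; that they do
  not vanish is enough.\<close>

definition op_leading :: "expo \<Rightarrow> 'k torus_op \<Rightarrow> bool" where
  "op_leading a F \<longleftrightarrow> (\<forall>b f. leading b f \<longrightarrow> leading (a + b) (app F f))"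

definition op_below :: "expo \<Rightarrow> 'k torus_op \<Rightarrow> bool" where
  "op_below a F \<longleftrightarrow> (\<forall>b f. leading b f \<longrightarrow> below (a + b) (app F f))"

lemma op_leading_tau: "op_leading a (\<tau> a)"
  by (auto simp: op_leading_def leading_def lookup_tau algebra_simps)

lemma op_leading_T: "op_leading (e i j) (T i j)"
  by (simp add: T_def op_leading_tau)

lemma op_leading_Ti: "op_leading (- e i j) (Ti i j)"
  by (simp add: Ti_def op_leading_tau)

lemma op_leading_mult: "op_leading a F \<Longrightarrow> op_leading b G \<Longrightarrow> op_leading (a + b) (F * G)"
  by (auto simp: op_leading_def add.assoc)

lemma op_leading_below: "op_leading a F \<Longrightarrow> a < b \<Longrightarrow> op_below b F"
  unfolding op_leading_def op_below_def by (meson add_strict_right_mono leading_below)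

lemma op_leading_add_below: "op_leading a F \<Longrightarrow> op_below a G \<Longrightarrow> op_leading a (F + G)"
  by (auto simp: op_leading_def op_below_def intro: leading_add_below)

lemma op_below_sum: "(\<And>s. s \<in> S \<Longrightarrow> op_below a (H s)) \<Longrightarrow> op_below a (sum H S)"
  by (auto simp: op_below_def app_sum_op intro!: below_sum)

text \<open>
  In the lexicographic order this makes \<open>T i j\<close> dominate all other terms of the path sum.
\<close>

lemma e_less:
  assumes "i < k" "j < s"
  shows "e i s + (- e k s) + e k j < e i j"
  unfolding less_poly_mapping.rep_eq less_fun_def
\<comment> \<open>\<open>(i, j)\<close> is the first position at which the two exponents differ:
  \<open>(i, s)\<close>, \<open>(k, s)\<close> and \<open>(k, j)\<close> all come later in the
  lexicographic order.\<close>
proof (intro exI[of _ "(i, j)"] conjI allI impI)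
  show "lookup (e i s + - e k s + e k j) (i, j) < lookup (e i j) (i, j)"
    using assms by (simp add: e_def lookup_add lookup_minus lookup_single)
  fix p :: "nat \<times> nat" assume "p < (i, j)"
  then have "p \<noteq> (i, s)" "p \<noteq> (k, s)" "p \<noteq> (k, j)" "p \<noteq> (i, j)" using assms by auto
  then show "lookup (e i s + - e k s + e k j) p = lookup (e i j) p"
    by (simp add: e_def lookup_add lookup_minus lookup_single when_def)
qed

text \<open>In the term \<open>s = j\<close> the inverse pivot and the pivot cancel in the exponent,
  so it keeps the leading exponent of the previous stage; \<open>e_less\<close> puts all other terms
  below it.\<close>

lemma op_leading_path_matrix:
  "\<lbrakk>1 \<le> i; i \<le> k; j \<le> n\<rbrakk> \<Longrightarrow> op_leading (e i j) (path_matrix T Ti n k i j)"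
proof (induction k arbitrary: j)
  case (Suc k)
  show ?case
  proof (cases "i = Suc k")
    case True
    then show ?thesis by (simp add: T_def op_leading_tau)
  next
    case False
    let ?b = "\<lambda>s. path_matrix T Ti n k i s * Ti (Suc k) s * T (Suc k) j"
    have l: "op_leading (e i s + (- e (Suc k) s) + e (Suc k) j) (?b s)" if "s \<le> n" for s
      using Suc.prems False that
      by (intro op_leading_mult op_leading_T op_leading_Ti Suc.IH) auto
    have "op_below (e i j) (\<Sum>s\<in>{Suc j..n}. ?b s)"
      by (intro op_below_sum op_leading_below[OF l] e_less) (use Suc.prems False in auto)
    moreover have "op_leading (e i j) (?b j)"
      using l[of j] Suc.prems by (simp add: add.assoc)
    ultimately have "op_leading (e i j) (?b j + (\<Sum>s\<in>{Suc j..n}. ?b s))"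
      by (intro op_leading_add_below)
    then show ?thesis using False Suc.prems
      by (simp add: sum_distrib_right sum.atLeast_Suc_atMost distrib_right)
  qed
qed simp

definition word :: "(nat \<times> nat) list \<Rightarrow> 'k torus_op" where
  "word w = prod_list (map (\<lambda>(i, j). X' i j) w)"

definition wdeg :: "(nat \<times> nat) list \<Rightarrow> expo" where
  "wdeg w = sum_list (map (\<lambda>(i, j). e i j) w)"

lemma word_simps [simp]: "word [] = 1" "word ((i, j) # w) = X' i j * word w" "word (v @ w) = word v * word w"
  by (simp_all add: word_def)

lemma wdeg_simps [simp]: "wdeg [] = 0" "wdeg ((i, j) # w) = e i j + wdeg w"
  "wdeg (v @ w) = wdeg v + wdeg w"
  by (simp_all add: wdeg_def)

lemma op_leading_X': "(i, j) \<in> I \<Longrightarrow> op_leading (e i j) (X' i j)"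
  by (auto simp: X'_def I_def intro: op_leading_path_matrix)

lemma op_leading_word: "set w \<subseteq> I \<Longrightarrow> op_leading (wdeg w) (word w)"
proof (induction w)
  case Nil
  then show ?case by (simp add: op_leading_def)
next
  case (Cons p w)
  then show ?case by (cases p) (auto intro: op_leading_mult op_leading_X')
qed

lemma leading_word: "set w \<subseteq> I \<Longrightarrow> leading (wdeg w) (app (word w) 1)"
  using op_leading_word[of w] leading_single[of "1::'k" "0::expo"] by (force simp: op_leading_def)

lemma word_centralizer: "word w \<in> centralizer"
  by (induction w) (auto simp: word_def centralizer_closed X'_centralizer split: prod.split)

lemma lookup_wdeg: "lookup (wdeg w) p = int (count_list w p)"
  by (induction w) (auto simp: e_def lookup_add lookup_minus lookup_single when_def)

text \<open>The degree counts the letters, and a sorted word is determined by its letter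
  counts.\<close>

lemma sorted_word_wdeg_inj:
  assumes "sorted v" "sorted w" "wdeg v = wdeg w"
  shows "v = w"
proof -
  have "count_list v p = count_list w p" for p
    using arg_cong[OF assms(3), of "\<lambda>a. lookup a p"] by (simp add: lookup_wdeg)
  then have "mset v = mset w" by (simp add: multiset_eq_iff count_mset)
  then show ?thesis using assms by (metis properties_for_sort)
qed

text \<open>The independence half of a Poincare-Birkhoff-Witt theorem, sharpened: the leading
  exponent of a nontrivial combination is the degree of an actual word, hence nonnegative.\<close>

lemma sorted_words_leading:
  assumes "finite S" "\<And>w. w \<in> S \<Longrightarrow> sorted w \<and> set w \<subseteq> I" "\<exists>w\<in>S. c w \<noteq> 0"
  shows "\<exists>w\<in>S. leading (wdeg w) (app (\<Sum>w\<in>S. opscale (c w) (word w)) 1)"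
proof -
  let ?h = "\<lambda>w. cst (c w) * app (word w) 1"
  have l: "leading (wdeg w) (?h w)" if "w \<in> S" "c w \<noteq> 0" for w
    using leading_mult[OF leading_single leading_word, of "c w" w 0] assms(2)[OF that(1)] that(2)
    by simp
  have nz: "?h w \<noteq> 0 \<longleftrightarrow> c w \<noteq> 0" if "w \<in> S" for w
    using leading_nonzero[OF l[OF that]] by (cases "c w = 0") auto
  have "\<exists>w\<in>S. ?h w \<noteq> 0 \<and> leading (wdeg w) (\<Sum>w\<in>S. ?h w)"
  proof (rule leading_sum[OF assms(1)])
    fix v w assume "v \<in> S" "w \<in> S" "wdeg v = wdeg w"
    then show "v = w" using assms(2) by (intro sorted_word_wdeg_inj) auto
  qed (use assms(3) l nz in blast)+
  then show ?thesis by (auto simp: app_sum_op)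
qed

end

section \<open>Quantum matrices as operators\<close>

lemma ring_free_algebra: "ring (free_algebra V :: ('x fword \<Rightarrow>\<^sub>0 'r::comm_ring_1) ring)"
proof -
  let ?R = "free_algebra V :: ('x fword \<Rightarrow>\<^sub>0 'r) ring"
  define C where "C = {p::'x fword \<Rightarrow>\<^sub>0 'r. \<forall>w\<in>keys p. set (letters w) \<subseteq> V}"
  have R: "?R = \<lparr>carrier = C, monoid.mult = (*), one = 1, ring.zero = 0, add = (+)\<rparr>"
    by (simp add: free_algebra_def C_def)
  have add: "p + q \<in> C" if "p \<in> C" "q \<in> C" for p q
    using that Poly_Mapping.keys_add[of p q] by (force simp: C_def)
  have mult: "p * q \<in> C" if "p \<in> C" "q \<in> C" for p q
    using that keys_mult[of p q] by (fastforce simp: plus_fword_def C_def)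
  have one: "0 \<in> C" "1 \<in> C" by (simp_all add: zero_fword_def C_def)
  have uminus: "- p \<in> C" if "p \<in> C" for p
    using that by (simp add: in_keys_iff C_def)
  show ?thesis
    unfolding R
  proof (rule ringI)
    show "abelian_group \<lparr>carrier = C, monoid.mult = (*), one = 1, ring.zero = 0, add = (+)\<rparr>"
    proof (rule abelian_groupI)
      fix x assume "x \<in> carrier \<lparr>carrier = C, monoid.mult = (*), one = 1, ring.zero = 0, add = (+)\<rparr>"
      then show "\<exists>y\<in>carrier \<lparr>carrier = C, monoid.mult = (*), one = 1, ring.zero = 0, add = (+)\<rparr>.
          y \<oplus>\<^bsub>\<lparr>carrier = C, monoid.mult = (*), one = 1, ring.zero = 0, add = (+)\<rparr>\<^esub> x =
          \<zero>\<^bsub>\<lparr>carrier = C, monoid.mult = (*), one = 1, ring.zero = 0, add = (+)\<rparr>\<^esub>"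
        by (intro bexI[of _ "- x"]) (auto simp: uminus)
    qed (auto simp: add one add.assoc add.commute)
    show "Group.monoid \<lparr>carrier = C, monoid.mult = (*), one = 1, ring.zero = 0, add = (+)\<rparr>"
      by (rule monoidI) (auto simp: mult.assoc mult one)
  qed (simp_all add: distrib_left distrib_right)
qed

lemma (in ring) ideal_central_multiples:
  assumes "c \<in> carrier R" "\<And>r. r \<in> carrier R \<Longrightarrow> c \<otimes> r = r \<otimes> c"
  shows "ideal ((\<lambda>r. c \<otimes> r) ` carrier R) R"
proof (rule idealI)
  show "ring R" by (rule ring_axioms)
  show "subgroup ((\<lambda>r. c \<otimes> r) ` carrier R) (add_monoid R)"
  proof (rule subgroup.intro)
    show "(\<lambda>r. c \<otimes> r) ` carrier R \<subseteq> carrier (add_monoid R)" using assms by auto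
    show "\<one>\<^bsub>add_monoid R\<^esub> \<in> (\<lambda>r. c \<otimes> r) ` carrier R"
      using assms(1) by (auto intro!: image_eqI[of _ _ \<zero>])
    fix x y assume "x \<in> (\<lambda>r. c \<otimes> r) ` carrier R" "y \<in> (\<lambda>r. c \<otimes> r) ` carrier R"
    then obtain r s where "x = c \<otimes> r" "y = c \<otimes> s" "r \<in> carrier R" "s \<in> carrier R" by auto
    then show "x \<otimes>\<^bsub>add_monoid R\<^esub> y \<in> (\<lambda>r. c \<otimes> r) ` carrier R"
      using assms(1) by (auto simp: r_distr intro!: image_eqI[of _ _ "r \<oplus> s"])
  next
    fix x assume "x \<in> (\<lambda>r. c \<otimes> r) ` carrier R"
    then obtain r where "x = c \<otimes> r" "r \<in> carrier R" by auto
    then show "inv\<^bsub>add_monoid R\<^esub> x \<in> (\<lambda>r. c \<otimes> r) ` carrier R"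
      using assms(1) by (auto simp: a_inv_def[symmetric] r_minus intro!: image_eqI[of _ _ "\<ominus> r"])
  qed
next
  fix a x assume "a \<in> (\<lambda>r. c \<otimes> r) ` carrier R" and x: "x \<in> carrier R"
  then obtain r where r: "a = c \<otimes> r" "r \<in> carrier R" by auto
  have "x \<otimes> a = c \<otimes> (x \<otimes> r)"
    using r x assms by (metis m_assoc)
  then show "x \<otimes> a \<in> (\<lambda>r. c \<otimes> r) ` carrier R" using r x by auto
  have "a \<otimes> x = c \<otimes> (r \<otimes> x)" using r x assms by (simp add: m_assoc)
  then show "a \<otimes> x \<in> (\<lambda>r. c \<otimes> r) ` carrier R" using r x by auto
qed

text \<open>Telescoping for positive \<open>k\<close>; negative powers reduce to positive ones
  because q and \<epsilon> are invertible. This lets Laurent coefficients act through evaluation at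
  \<epsilon>.\<close>

lemma qpow_diff_dvd: "(qpow 1 - lconst \<epsilon>) dvd (qpow k - lconst (\<epsilon> powi k))" if "(\<epsilon>::'k::field) \<noteq> 0"
proof -
  have nat: "(qpow 1 - lconst \<epsilon>) dvd (qpow (int k) - lconst (\<epsilon> ^ k))" for k
  proof (induction k)
    case 0
    then show ?case by (simp add: qpow_def lconst_def)
  next
    case (Suc k)
    have "qpow (int (Suc k)) - lconst (\<epsilon> ^ Suc k) =
        qpow 1 * (qpow (int k) - lconst (\<epsilon> ^ k)) + (qpow 1 - lconst \<epsilon>) * lconst (\<epsilon> ^ k)"
      by (simp add: qpow_def lconst_def algebra_simps mult_single)
    then show ?case using Suc by simp
  qed
  show ?thesis
  proof (cases "k \<ge> 0")
    case True
    then show ?thesis using nat[of "nat k"] by (simp add: power_int_def)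
  next
    case False
    then obtain j where j: "k = - int j" by (metis nat_0_le nle_le neg_0_le_iff_le add.inverse_inverse)
    have "qpow k - lconst (\<epsilon> powi k) =
        - (qpow (- int j) * lconst (inverse (\<epsilon> ^ j)) * (qpow (int j) - lconst (\<epsilon> ^ j)))"
      using that by (simp add: j qpow_def lconst_def algebra_simps mult_single power_int_minus)
    then show ?thesis using nat[of j] by simp
  qed
qed

section \<open>The double quotient as an image of the free algebra\<close>

context quantum_setup
begin

abbreviation FA :: "'k qfree ring" where "FA \<equiv> qfree_algebra m n"

lemma FA_simps:
  "x \<in> carrier FA \<longleftrightarrow> (\<forall>w\<in>keys x. set (letters w) \<subseteq> I)"
  "x \<otimes>\<^bsub>FA\<^esub> y = x * y" "\<one>\<^bsub>FA\<^esub> = 1" "\<zero>\<^bsub>FA\<^esub> = 0" "x \<oplus>\<^bsub>FA\<^esub> y = x + y"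
  by (simp_all add: qfree_algebra_def free_algebra_def I_def)

sublocale FA: ring FA
  unfolding qfree_algebra_def by (rule ring_free_algebra)

lemma FA_closed [intro]:
  "x \<in> carrier FA \<Longrightarrow> y \<in> carrier FA \<Longrightarrow> x + y \<in> carrier FA"
  "x \<in> carrier FA \<Longrightarrow> y \<in> carrier FA \<Longrightarrow> x * y \<in> carrier FA"
  "x \<in> carrier FA \<Longrightarrow> - x \<in> carrier FA"
  "x \<in> carrier FA \<Longrightarrow> y \<in> carrier FA \<Longrightarrow> x - y \<in> carrier FA"
  "0 \<in> carrier FA" "1 \<in> carrier FA"
  "p \<in> I \<Longrightarrow> gen p \<in> carrier FA" "scal c \<in> carrier FA"
  "set w \<subseteq> I \<Longrightarrow> single (FWord w) a \<in> carrier FA"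
proof -
  show add: "x \<in> carrier FA \<Longrightarrow> y \<in> carrier FA \<Longrightarrow> x + y \<in> carrier FA" for x y
    using FA.add.m_closed[of x y] by (simp add: FA_simps(5))
  show "x \<in> carrier FA \<Longrightarrow> y \<in> carrier FA \<Longrightarrow> x * y \<in> carrier FA"
    using FA.m_closed[of x y] by (simp add: FA_simps(2))
  show um: "x \<in> carrier FA \<Longrightarrow> - x \<in> carrier FA" for x by (simp add: FA_simps(1) in_keys_iff)
  show "x \<in> carrier FA \<Longrightarrow> y \<in> carrier FA \<Longrightarrow> x - y \<in> carrier FA" using add[OF _ um, of x y] by simp
qed (auto simp: FA_simps(1) gen_def scal_def zero_fword_def split: if_splits)

lemma qmat_relations_carrier: "qmat_relations m n \<subseteq> carrier FA"
  unfolding qmat_relations_def by (auto intro!: FA_closed simp: I_def simp del: FA_simps)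

sublocale QI: ideal "qmat_ideal m n" FA
  unfolding qmat_ideal_def by (rule FA.genideal_ideal[OF qmat_relations_carrier])

sublocale Rq: ring "Rq m n :: 'k qfree set ring"
  unfolding Rq_def by (rule QI.quotient_is_ring)

lemma Rq_class_hom: "Rq_class m n \<in> Ring.ring_hom FA (Rq m n)"
proof -
  have "Rq_class m n = (+>\<^bsub>FA\<^esub>) (qmat_ideal m n)" by (auto simp: Rq_class_def fun_eq_iff)
  then show ?thesis unfolding Rq_def using QI.rcos_ring_hom by simp
qed

lemma Rq_carrier: "carrier (Rq m n) = Rq_class m n ` carrier FA"
  by (auto simp: Rq_def FactRing_def A_RCOSETS_def RCOSETS_def a_r_coset_def Rq_class_def)

lemma scal_comm: "scal c * x = x * scal c" for x :: "'k qfree"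
proof -
  have "scal c * (single a b :: 'k qfree) = single a b * scal c" for a b
    by (simp add: scal_def mult_single mult.commute)
  then show ?thesis
    by (subst (1 2) poly_mapping_sum_single[of x]) (simp add: sum_distrib_left sum_distrib_right)
qed

sublocale SI: ideal "spec_ideal m n \<epsilon>" "Rq m n :: 'k qfree set ring"
  unfolding spec_ideal_def
proof (rule Rq.ideal_central_multiples)
  let ?c = "Rq_class m n (scal (qpow 1 - lconst \<epsilon>))"
  show "?c \<in> carrier (Rq m n)" using Rq_class_hom by (auto simp: Ring.ring_hom_def)
  fix r :: "'k qfree set" assume "r \<in> carrier (Rq m n)"
  then obtain p where p: "p \<in> carrier FA" "r = Rq_class m n p" by (auto simp: Rq_carrier)
  show "?c \<otimes>\<^bsub>Rq m n\<^esub> r = r \<otimes>\<^bsub>Rq m n\<^esub> ?c"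
    unfolding p(2) using ring_hom_mult[OF Rq_class_hom p(1) FA_closed(8)]
      ring_hom_mult[OF Rq_class_hom FA_closed(8) p(1)]
    by (metis FA_simps(2) scal_comm)
qed

abbreviation R :: "'k qfree set set ring" where "R \<equiv> Reps m n \<epsilon>"

sublocale R: ring R
  unfolding Reps_def by (rule SI.quotient_is_ring)

text \<open>The composite of both projections, so that elements are handled through noncommutative
  polynomials instead of cosets of cosets.\<close>

definition Q :: "'k qfree \<Rightarrow> 'k qfree set set" where
  "Q p = sigma m n \<epsilon> (Rq_class m n p)"

lemma Q_hom: "Q \<in> Ring.ring_hom FA R"
proof -
  have "sigma m n \<epsilon> = (+>\<^bsub>Rq m n\<^esub>) (spec_ideal m n \<epsilon>)" by (auto simp: sigma_def fun_eq_iff)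
  then have "sigma m n \<epsilon> \<in> Ring.ring_hom (Rq m n) R" unfolding Reps_def using SI.rcos_ring_hom by simp
  from ring_hom_trans[OF Rq_class_hom this] show ?thesis by (simp add: Q_def[abs_def] comp_def)
qed

lemma R_carrier: "carrier R = Q ` carrier FA"
proof -
  have "carrier R = sigma m n \<epsilon> ` carrier (Rq m n)"
    by (auto simp: Reps_def FactRing_def A_RCOSETS_def RCOSETS_def a_r_coset_def sigma_def)
  then show ?thesis by (auto simp: Rq_carrier Q_def)
qed

lemma Q_simps:
  "x \<in> carrier FA \<Longrightarrow> Q x \<in> carrier R"
  "x \<in> carrier FA \<Longrightarrow> y \<in> carrier FA \<Longrightarrow> Q (x * y) = Q x \<otimes>\<^bsub>R\<^esub> Q y"
  "x \<in> carrier FA \<Longrightarrow> y \<in> carrier FA \<Longrightarrow> Q (x + y) = Q x \<oplus>\<^bsub>R\<^esub> Q y"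
  "Q 1 = \<one>\<^bsub>R\<^esub>"
  using Q_hom by (auto simp: Ring.ring_hom_def FA_simps(2-))

sublocale QH: ring_hom_ring FA R Q
  by (rule ring_hom_ringI2[OF FA.ring_axioms R.ring_axioms Q_hom])

lemma Q_zero: "Q 0 = \<zero>\<^bsub>R\<^esub>"
  using QH.hom_zero by (simp add: FA_simps(4))

lemma Q_diff_zero:
  assumes "x \<in> carrier FA" "y \<in> carrier FA" "Q (x - y) = \<zero>\<^bsub>R\<^esub>"
  shows "Q x = Q y"
proof -
  have "Q x = Q ((x - y) + y)" by simp
  also have "\<dots> = Q (x - y) \<oplus>\<^bsub>R\<^esub> Q y" by (rule Q_simps(3)) (use assms in auto)
  also have "\<dots> = Q y" using assms(2,3) Q_simps(1) by simp
  finally show ?thesis .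
qed

lemma Q_spec: "r \<in> carrier FA \<Longrightarrow> Q (scal (qpow 1 - lconst \<epsilon>) * r) = \<zero>\<^bsub>R\<^esub>"
proof -
  assume r: "r \<in> carrier FA"
  have "Rq_class m n (scal (qpow 1 - lconst \<epsilon>) * r) =
      Rq_class m n (scal (qpow 1 - lconst \<epsilon>)) \<otimes>\<^bsub>Rq m n\<^esub> Rq_class m n r"
    using ring_hom_mult[OF Rq_class_hom FA_closed(8) r] by (simp add: FA_simps(2))
  also have "\<dots> \<in> spec_ideal m n \<epsilon>"
    using r by (auto simp: spec_ideal_def Rq_carrier)
  finally have "sigma m n \<epsilon> (Rq_class m n (scal (qpow 1 - lconst \<epsilon>) * r)) = spec_ideal m n \<epsilon>"
    unfolding sigma_def by (rule SI.a_rcos_const)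
  then show ?thesis by (simp add: Q_def Reps_def FactRing_def)
qed

lemma Q_relation: "p \<in> qmat_relations m n \<Longrightarrow> Q p = \<zero>\<^bsub>R\<^esub>"
proof -
  assume p: "p \<in> qmat_relations m n"
  have "p \<in> qmat_ideal m n" unfolding qmat_ideal_def
    using FA.genideal_self[OF qmat_relations_carrier] p by auto
  then have "Rq_class m n p = qmat_ideal m n" unfolding Rq_class_def by (rule QI.a_rcos_const)
  also have "\<dots> = Rq_class m n 0" unfolding Rq_class_def
    by (rule QI.a_rcos_const[symmetric]) (use QI.zero_closed in \<open>simp add: FA_simps\<close>)
  finally have "Q p = Q 0" by (simp add: Q_def)
  then show ?thesis by (simp add: Q_zero)
qed

definition ev :: "'k laurent \<Rightarrow> 'k" where "ev = lin_ext (\<lambda>c. c) (\<lambda>k. \<epsilon> powi k)"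

lemma ev_simps: "ev (f + g) = ev f + ev g" "ev (f * g) = ev f * ev g" "ev (qpow k) = \<epsilon> powi k"
  "ev (lconst c) = c" "ev 0 = 0" "ev 1 = 1"
proof -
  show "ev (f + g) = ev f + ev g" unfolding ev_def by (rule lin_ext_add) auto
  show "ev (f * g) = ev f * ev g" unfolding ev_def
    by (rule lin_ext_mult) (auto simp: powi_add mult.commute)
  show "ev (qpow k) = \<epsilon> powi k" "ev (lconst c) = c" "ev 0 = 0" "ev 1 = 1"
    using lin_ext_single[of "\<lambda>c::'k. c" "\<lambda>k. \<epsilon> powi k" 0 1]
    by (simp_all add: ev_def qpow_def lconst_def lin_ext_single) (simp add: lin_ext_def)
qed

lemma ev_minus: "ev (f - g) = ev f - ev g"
  using ev_simps(1)[of "f - g" g] by simp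

lemma ev_dvd: "(qpow 1 - lconst \<epsilon>) dvd (f - lconst (ev f))"
proof -
  have "f - lconst (ev f) = (\<Sum>k\<in>keys f. lconst (lookup f k) * (qpow k - lconst (\<epsilon> powi k)))"
  proof -
    have "f = (\<Sum>k\<in>keys f. lconst (lookup f k) * qpow k)"
      by (subst poly_mapping_sum_single) (simp add: lconst_def qpow_def mult_single)
    moreover have "lconst (ev f) = (\<Sum>k\<in>keys f. lconst (lookup f k) * lconst (\<epsilon> powi k))"
      unfolding ev_def lin_ext_def lconst_def mult_single
      by (simp add: additive_sum[of "single 0", OF single_add])
    ultimately show ?thesis by (metis (no_types, lifting) right_diff_distrib sum.cong sum_subtractf)
  qed
  then show ?thesis using qpow_diff_dvd[OF eps_nz] by (auto intro!: dvd_sum)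
qed

lemma scal_simps: "scal (f * g) = scal f * scal g" "scal (f + g) = scal f + scal g"
  "scal (f - g) = scal f - scal g" "scal 1 = 1"
  by (simp_all add: scal_def mult_single single_add single_diff)

lemma Q_scal: "Q (scal f) = Q (scal (lconst (ev f)))"
proof -
  obtain g where g: "f - lconst (ev f) = (qpow 1 - lconst \<epsilon>) * g" using ev_dvd by (auto elim: dvdE)
  have "(scal f :: 'k qfree) - scal (lconst (ev f)) = scal (qpow 1 - lconst \<epsilon>) * scal g"
    by (simp only: scal_simps(3)[symmetric] g scal_simps(1))
  then have "Q (scal f - scal (lconst (ev f))) = \<zero>\<^bsub>R\<^esub>"
    by (simp only: Q_spec[OF FA_closed(8)])
  then show ?thesis by (intro Q_diff_zero FA_closed(8))
qed

end

section \<open>Straightening: sorted words span\<close>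

lemma not_sorted_descent:
  fixes w :: "'a::linorder list"
  assumes "\<not> sorted w"
  shows "\<exists>u a b v. w = u @ [a, b] @ v \<and> b < a"
  using assms
proof (induction w)
  case (Cons x w)
  show ?case
  proof (cases "sorted w")
    case False
    with Cons.IH obtain u a b v where "w = u @ [a, b] @ v" "b < a" by blast
    then show ?thesis by (intro exI[of _ "x # u"]) auto
  next
    case True
    with Cons.prems obtain y v where "w = y # v" "y < x"
      by (cases w) (auto dest: order_le_less_trans)
    then show ?thesis by (intro exI[of _ "[]"]) auto
  qed
qed simp

context quantum_setup
begin

definition wm :: "(nat \<times> nat) list \<Rightarrow> 'k qfree" where
  "wm w = single (FWord w) 1"

lemma wm_simps: "wm [] = 1" "gen p = wm [p]" "wm (u @ v) = wm u * wm v"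
  by (simp_all add: wm_def gen_def mult_single plus_fword_def zero_fword_def[symmetric])

lemma wm_closed: "set w \<subseteq> I \<Longrightarrow> wm w \<in> carrier FA"
  unfolding wm_def by (rule FA_closed)

abbreviation cs :: "'k \<Rightarrow> 'k qfree" where "cs c \<equiv> scal (lconst c)"

lemma cs_simps: "cs (a * b) = cs a * cs b" "cs (a + b) = cs a + cs b" "cs 0 = 0" "cs 1 = 1"
  by (simp_all add: scal_def lconst_def mult_single single_add)

text \<open>Membership in the carrier is built in, so that congruences can be chained, added and
  multiplied without side conditions.\<close>

definition congr :: "'k qfree \<Rightarrow> 'k qfree \<Rightarrow> bool" (infix \<open>\<asymp>\<close> 50) where
  "x \<asymp> y \<longleftrightarrow> x \<in> carrier FA \<and> y \<in> carrier FA \<and> Q x = Q y"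

lemma congr_refl: "x \<in> carrier FA \<Longrightarrow> x \<asymp> x"
  and congr_sym: "x \<asymp> y \<Longrightarrow> y \<asymp> x"
  and congr_trans [trans]: "x \<asymp> y \<Longrightarrow> y \<asymp> z \<Longrightarrow> x \<asymp> z"
  by (auto simp: congr_def)

lemma congr_add: "x \<asymp> x' \<Longrightarrow> y \<asymp> y' \<Longrightarrow> x + y \<asymp> x' + y'"
  by (auto simp: congr_def Q_simps(3))

lemma congr_mult: "x \<asymp> x' \<Longrightarrow> y \<asymp> y' \<Longrightarrow> x * y \<asymp> x' * y'"
  by (auto simp: congr_def Q_simps(2))

lemma congr_scal: "scal f \<asymp> cs (ev f)"
  using Q_scal[of f] by (auto simp: congr_def)

lemma congr_relation:
  assumes "x - y \<in> qmat_relations m n" "x \<in> carrier FA" "y \<in> carrier FA"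
  shows "x \<asymp> y"
  unfolding congr_def using assms Q_relation[OF assms(1)] Q_diff_zero by auto

lemma qmat_relationsI:
  "\<lbrakk>i \<in> {1..m}; k \<in> {1..m}; j \<in> {1..n}; i < k\<rbrakk> \<Longrightarrow>
    gen (i,j) * gen (k,j) - scal (qpow 1) * (gen (k,j) * gen (i,j)) \<in> (qmat_relations m n :: 'k qfree set)"
  "\<lbrakk>i \<in> {1..m}; j \<in> {1..n}; r \<in> {1..n}; j < r\<rbrakk> \<Longrightarrow>
    gen (i,j) * gen (i,r) - scal (qpow 1) * (gen (i,r) * gen (i,j)) \<in> (qmat_relations m n :: 'k qfree set)"
  "\<lbrakk>i \<in> {1..m}; k \<in> {1..m}; j \<in> {1..n}; r \<in> {1..n}; i < k; r < j\<rbrakk> \<Longrightarrow>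
    gen (i,j) * gen (k,r) - gen (k,r) * gen (i,j) \<in> (qmat_relations m n :: 'k qfree set)"
  "\<lbrakk>i \<in> {1..m}; k \<in> {1..m}; j \<in> {1..n}; r \<in> {1..n}; i < k; j < r\<rbrakk> \<Longrightarrow>
    (gen (i,j) * gen (k,r) - gen (k,r) * gen (i,j)) - scal (qpow 1 - qpow (- 1)) * (gen (i,r) * gen (k,j))
      \<in> (qmat_relations m n :: 'k qfree set)"
  unfolding qmat_relations_def by blast+

lemma swap_qcomm:
  assumes "gen b * gen a - scal (qpow 1) * (gen a * gen b) \<in> (qmat_relations m n :: 'k qfree set)" "a \<in> I" "b \<in> I"
  shows "wm [a, b] \<asymp> cs (inverse \<epsilon>) * wm [b, a]"
proof -
  have ab: "gen a * gen b \<in> carrier FA" "gen b * gen a \<in> carrier FA"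
    using assms by auto
  have "gen b * gen a \<asymp> scal (qpow 1) * (gen a * gen b)"
    using assms ab by (intro congr_relation) auto
  also have "\<dots> \<asymp> cs \<epsilon> * (gen a * gen b)"
    using congr_scal[of "qpow 1"] by (intro congr_mult congr_refl ab) (simp add: ev_simps)
  finally have "cs (inverse \<epsilon>) * (gen b * gen a) \<asymp> cs (inverse \<epsilon>) * (cs \<epsilon> * (gen a * gen b))"
    by (rule congr_mult[OF congr_refl[OF FA_closed(8)]])
  also have "cs (inverse \<epsilon>) * (cs \<epsilon> * (gen a * gen b)) = gen a * gen b"
    by (simp add: mult.assoc[symmetric] cs_simps(1)[symmetric] cs_simps(4))
  finally show ?thesis
    by (simp add: wm_simps(2) wm_simps(3)[symmetric] congr_sym)
qed

text \<open>Both words on the right begin with a letter below \<open>a\<close>, which makes the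
  rewriting terminate. In the cases without a correction term the second word is a dummy with
  coefficient 0.\<close>

lemma swap_descent:
  assumes "a \<in> I" "b \<in> I" "b < a"
  shows "\<exists>c c' a' b'. a' \<in> I \<and> b' \<in> I \<and> b' < a \<and> wm [a, b] \<asymp> cs c * wm [b, a] + cs c' * wm [b', a']"
proof -
  obtain k r where a: "a = (k, r)" by (cases a)
  obtain i j where b: "b = (i, j)" by (cases b)
  have ab: "wm [a, b] \<in> carrier FA" "wm [b, a] \<in> carrier FA" using assms by (auto intro!: wm_closed)
  have I: "1 \<le> i" "i \<le> m" "1 \<le> k" "k \<le> m" "1 \<le> j" "j \<le> n" "1 \<le> r" "r \<le> n"
    using assms by (auto simp: a b I_def)
  consider "i = k" "j < r" | "i < k" "j = r" | "i < k" "r < j" | "i < k" "j < r"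
  proof -
    have "i < k \<or> i = k \<and> j < r" using assms(3) by (auto simp: a b)
    then show ?thesis using that linorder_less_linear[of j r] by blast
  qed
  then show ?thesis
  proof cases
    case 1
    have "gen b * gen a - scal (qpow 1) * (gen a * gen b) \<in> (qmat_relations m n :: 'k qfree set)"
      unfolding a b using qmat_relationsI(2) 1 I by simp
    from swap_qcomm[OF this] have "wm [a, b] \<asymp> cs (inverse \<epsilon>) * wm [b, a] + cs 0 * wm [b, a]"
      using assms by (simp add: cs_simps)
    then show ?thesis using assms by blast
  next
    case 2
    have "gen b * gen a - scal (qpow 1) * (gen a * gen b) \<in> (qmat_relations m n :: 'k qfree set)"
      unfolding a b using qmat_relationsI(1) 2 I by simp
    from swap_qcomm[OF this] have "wm [a, b] \<asymp> cs (inverse \<epsilon>) * wm [b, a] + cs 0 * wm [b, a]"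
      using assms by (simp add: cs_simps)
    then show ?thesis using assms by blast
  next
    case 3
    have "gen b * gen a - gen a * gen b \<in> (qmat_relations m n :: 'k qfree set)"
      unfolding a b using qmat_relationsI(3) 3 I by simp
    then have "gen b * gen a \<asymp> gen a * gen b"
      using ab by (intro congr_relation) (simp_all add: wm_simps(2) wm_simps(3)[symmetric])
    then have "wm [a, b] \<asymp> cs 1 * wm [b, a] + cs 0 * wm [b, a]"
      by (simp add: cs_simps wm_simps(2) wm_simps(3)[symmetric] congr_sym)
    then show ?thesis using assms by blast
  next
    case 4
    have cd: "(i, r) \<in> I" "(k, j) \<in> I" "(i, r) < a" using 4 I by (auto simp: I_def a)
    define y where "y = wm [(i, r), (k, j)]"
    have y: "y \<in> carrier FA" unfolding y_def using cd by (intro wm_closed) auto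
    have "(gen b * gen a - gen a * gen b) - scal (qpow 1 - qpow (- 1)) * (gen (i, r) * gen (k, j))
        \<in> (qmat_relations m n :: 'k qfree set)"
      unfolding a b using qmat_relationsI(4) 4 I by simp
    then have "(wm [b, a] - wm [a, b]) - scal (qpow 1 - qpow (- 1)) * y \<in> qmat_relations m n"
      by (simp add: wm_simps(2) wm_simps(3)[symmetric] y_def)
    then have "wm [b, a] - wm [a, b] \<asymp> scal (qpow 1 - qpow (- 1)) * y"
      using ab y by (intro congr_relation) auto
    also have "\<dots> \<asymp> cs (\<epsilon> - inverse \<epsilon>) * y"
      using congr_scal[of "qpow 1 - qpow (- 1)"]
      by (intro congr_mult congr_refl y) (simp add: ev_simps ev_minus power_int_minus)
    \<comment> \<open>Solves the relation for \<open>wm [a, b]\<close>: multiply by -1, then add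
      \<open>wm [b, a]\<close>.\<close>
    finally have "cs (-1) * (wm [b, a] - wm [a, b]) + wm [b, a] \<asymp> cs (-1) * (cs (\<epsilon> - inverse \<epsilon>) * y) + wm [b, a]"
      using ab by (intro congr_mult congr_add congr_refl FA_closed)
    moreover have "cs (-1) = - 1"
      using cs_simps(2)[of "1" "-1"] by (simp add: cs_simps eq_neg_iff_add_eq_0 add.commute)
    ultimately have "wm [a, b] \<asymp> cs 1 * wm [b, a] + cs (- 1 * (\<epsilon> - inverse \<epsilon>)) * y"
      unfolding cs_simps(1) by (simp add: cs_simps add.commute)
    then show ?thesis unfolding y_def using cd by blast
  qed
qed

definition straight :: "'k qfree \<Rightarrow> bool" where
  "straight p \<longleftrightarrow> (\<exists>S c. finite S \<and> (\<forall>w\<in>S. sorted w \<and> set w \<subseteq> I) \<and> p \<asymp> (\<Sum>w\<in>S. cs (c w) * wm w))"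

lemma straight_congr: "p \<asymp> p' \<Longrightarrow> straight p' \<Longrightarrow> straight p"
  unfolding straight_def using congr_trans by blast

lemma straight_add:
  assumes "straight p" "straight p'" shows "straight (p + p')"
proof -
  obtain S c where S: "finite S" "\<forall>w\<in>S. sorted w \<and> set w \<subseteq> I" "p \<asymp> (\<Sum>w\<in>S. cs (c w) * wm w)"
    using assms(1) unfolding straight_def by blast
  obtain S' c' where S': "finite S'" "\<forall>w\<in>S'. sorted w \<and> set w \<subseteq> I" "p' \<asymp> (\<Sum>w\<in>S'. cs (c' w) * wm w)"
    using assms(2) unfolding straight_def by blast
  let ?d = "\<lambda>w. (if w \<in> S then c w else 0) + (if w \<in> S' then c' w else 0)"
  have "(\<Sum>w\<in>S. cs (c w) * wm w) = (\<Sum>w\<in>S \<union> S'. cs (if w \<in> S then c w else 0) * wm w)"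
    using S S' by (intro sum.mono_neutral_cong_left) (auto simp: cs_simps)
  moreover have "(\<Sum>w\<in>S'. cs (c' w) * wm w) = (\<Sum>w\<in>S \<union> S'. cs (if w \<in> S' then c' w else 0) * wm w)"
    using S S' by (intro sum.mono_neutral_cong_left) (auto simp: cs_simps)
  ultimately have "p + p' \<asymp> (\<Sum>w\<in>S \<union> S'. cs (?d w) * wm w)"
    using congr_add[OF S(3) S'(3)] by (simp only: cs_simps(2) distrib_right sum.distrib)
  then show ?thesis unfolding straight_def using S S'
    by (intro exI[of _ "S \<union> S'"] exI[of _ ?d]) auto
qed

lemma straight_scale:
  assumes "straight p" shows "straight (cs a * p)"
proof -
  obtain S c where S: "finite S" "\<forall>w\<in>S. sorted w \<and> set w \<subseteq> I" "p \<asymp> (\<Sum>w\<in>S. cs (c w) * wm w)"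
    using assms(1) unfolding straight_def by blast
  have "cs a * p \<asymp> cs a * (\<Sum>w\<in>S. cs (c w) * wm w)"
    by (intro congr_mult congr_refl S FA_closed)
  also have "cs a * (\<Sum>w\<in>S. cs (c w) * wm w) = (\<Sum>w\<in>S. cs (a * c w) * wm w)"
    by (simp add: sum_distrib_left cs_simps mult.assoc)
  finally show ?thesis unfolding straight_def using S
    by (intro exI[of _ S] exI[of _ "\<lambda>w. a * c w"]) simp
qed

lemma straight_sum: "finite S \<Longrightarrow> (\<And>s. s \<in> S \<Longrightarrow> straight (f s)) \<Longrightarrow> straight (sum f S)"
proof (induction S rule: finite_induct)
  case empty
  have "straight 0" unfolding straight_def by (intro exI[of _ "{}"]) (auto intro: congr_refl)
  then show ?case by simp
qed (auto intro: straight_add)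

text \<open>Rewriting preserves the length; comparing lengths first makes the lexicographic order on
  words well founded.\<close>

lemma wf_words: "wf (lenlex {(x, y :: nat \<times> nat). x < y})"
  by (rule wf_lenlex) (rule wf)

lemma straight_word: "set w \<subseteq> I \<Longrightarrow> straight (wm w)"
proof (induction w rule: wf_induct_rule[OF wf_words])
  case (1 w)
  show ?case
  proof (cases "sorted w")
    case True
    then have "wm w \<asymp> (\<Sum>w\<in>{w}. cs 1 * wm w)" using 1 by (simp add: cs_simps congr_refl wm_closed)
    then show ?thesis unfolding straight_def using True 1 by (intro exI[of _ "{w}"]) auto
  next
    case False
    then obtain u a b v where w: "w = u @ [a, b] @ v" "b < a" using not_sorted_descent by blast
    then have ab: "a \<in> I" "b \<in> I" and uv: "set u \<subseteq> I" "set v \<subseteq> I" using 1 by auto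
    obtain c c' a' b' where sw: "a' \<in> I" "b' \<in> I" "b' < a"
      "wm [a, b] \<asymp> cs c * wm [b, a] + cs c' * wm [b', a']"
      using swap_descent[OF ab w(2)] by blast
    have less: "(u @ [x, y] @ v, w) \<in> lenlex {(x, y). x < y}" if "x < a" for x y
    proof -
      have "(x # y # v, a # b # v) \<in> lex {(x, y). x < y}" using that by simp
      from lex_append_leftI[OF this] show ?thesis by (simp add: w lenlex_conv)
    qed
    have st: "straight (wm (u @ [x, y] @ v))" if "x < a" "x \<in> I" "y \<in> I" for x y
      using that uv by (intro 1 less) auto
    have "wm w \<asymp> wm u * (cs c * wm [b, a] + cs c' * wm [b', a']) * wm v"
      unfolding w wm_simps(3) mult.assoc[symmetric]
      by (intro congr_mult congr_refl sw wm_closed uv)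
    also have "wm u * (cs c * wm [b, a] + cs c' * wm [b', a']) * wm v =
        cs c * wm (u @ [b, a] @ v) + cs c' * wm (u @ [b', a'] @ v)"
    proof -
      have mv: "x * (cs c * y) = cs c * (x * y)" for x y :: "'k qfree" and c
        by (simp only: mult.assoc[symmetric] scal_comm[of "lconst c" x])
      show ?thesis unfolding wm_simps(3)
        by (simp only: distrib_left distrib_right mv) (simp only: mult.assoc)
    qed
    finally show ?thesis
      by (rule straight_congr) (intro straight_add straight_scale st w sw ab)
  qed
qed

lemma straightening: "p \<in> carrier FA \<Longrightarrow> straight p"
proof -
  assume p: "p \<in> carrier FA"
  have "p = (\<Sum>w\<in>keys p. scal (lookup p w) * wm (letters w))"
    by (subst poly_mapping_sum_single[of p]) (simp add: scal_def wm_def mult_single)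
  moreover have "straight \<dots>"
  proof (rule straight_sum)
    fix w assume "w \<in> keys p"
    then have w: "set (letters w) \<subseteq> I" using p by (auto simp: FA_simps(1))
    have "scal (lookup p w) * wm (letters w) \<asymp> cs (ev (lookup p w)) * wm (letters w)"
      by (intro congr_mult congr_scal congr_refl wm_closed w)
    then show "straight (scal (lookup p w) * wm (letters w))"
      by (rule straight_congr) (intro straight_scale straight_word w)
  qed simp
  ultimately show ?thesis by simp
qed

text \<open>
  \<open>hh\<close> evaluates a noncommutative polynomial at the operators \<open>X' i j\<close> and at \<open>q = \<epsilon>\<close>.
\<close>

definition hh :: "'k qfree \<Rightarrow> 'k torus_op" where
  "hh = lin_ext (\<lambda>f. mulop (cst (ev f))) (\<lambda>w. word (letters w))"

lemma mulop_cst: "mulop (cst c) = opscale c 1"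
  by (simp add: opscale_def)

lemma hh_add: "hh (x + y) = hh x + hh y"
  unfolding hh_def by (rule lin_ext_add) (simp_all add: ev_simps single_add mulop_simps)

lemma hh_mult: "hh (x * y) = hh x * hh y"
  unfolding hh_def
  by (rule lin_ext_mult)
    (simp_all add: ev_simps single_add mulop_simps cst_mult plus_fword_def mulop_cst OP.sc_mult_left
      OP.sc_mult_right OP.sc_sc OP.sc_add_left)

lemma hh_basic: "hh (scal f) = opscale (ev f) 1" "hh (wm w) = word w" "hh 0 = 0" "hh 1 = 1"
proof -
  show "hh (scal f) = opscale (ev f) 1"
    by (simp add: hh_def scal_def lin_ext_single ev_simps mulop_simps zero_fword_def mulop_cst)
  show w: "hh (wm w) = word w" for w
    by (simp add: hh_def wm_def lin_ext_single ev_simps mulop_simps)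
  show "hh 0 = 0" by (simp add: hh_def lin_ext_def)
  show "hh 1 = 1" using w[of "[]"] by (simp add: wm_simps)
qed

lemma hh_gen: "hh (gen (i, j)) = X' i j"
  by (simp add: wm_simps(2) hh_basic)

lemma hh_minus: "hh (x - y) = hh x - hh y"
  using hh_add[of "x - y" y] by simp

lemma hh_cs: "hh (cs c * x) = opscale c (hh x)"
  by (simp add: hh_mult hh_basic ev_simps OP.sc_mult_left)

lemma hh_sum: "hh (sum f S) = (\<Sum>s\<in>S. hh (f s))"
  by (rule additive_sum) (rule hh_add)

lemma hh_scal_mult: "hh (scal f * x) = opscale (ev f) (hh x)"
  by (simp add: hh_mult hh_basic OP.sc_mult_left)

lemma hh_gen_gen: "hh (gen (i, j) * gen (k, r)) = X' i j * X' k r"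
  by (simp add: hh_mult hh_gen)

lemma hh_relation: "p \<in> qmat_relations m n \<Longrightarrow> hh p = 0"
  unfolding qmat_relations_def
proof (elim UnE CollectE exE conjE)
  note D = OP.quantum_matrixD[OF quantum_matrix_X']
  fix i k j
  assume p: "p = gen (i,j) * gen (k,j) - scal (qpow 1) * (gen (k,j) * gen (i,j))"
    and "i \<in> {1..m}" "k \<in> {1..m}" "j \<in> {1..n}" "i < k"
  then have "X' i j * X' k j = opscale \<epsilon> (X' k j * X' i j)"
    using OP.qcommD[OF D(1)[of i k j]] by simp
  then show ?thesis by (simp only: p hh_minus hh_gen_gen hh_scal_mult) (simp add: ev_simps)
next
  note D = OP.quantum_matrixD[OF quantum_matrix_X']
  fix i j r
  assume p: "p = gen (i,j) * gen (i,r) - scal (qpow 1) * (gen (i,r) * gen (i,j))"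
    and "i \<in> {1..m}" "j \<in> {1..n}" "r \<in> {1..n}" "j < r"
  then have "X' i j * X' i r = opscale \<epsilon> (X' i r * X' i j)"
    using OP.qcommD[OF D(2)[of i j r]] by simp
  then show ?thesis by (simp only: p hh_minus hh_gen_gen hh_scal_mult) (simp add: ev_simps)
next
  note D = OP.quantum_matrixD[OF quantum_matrix_X']
  fix i k j r
  assume p: "p = gen (i,j) * gen (k,r) - gen (k,r) * gen (i,j)"
    and "i \<in> {1..m}" "k \<in> {1..m}" "j \<in> {1..n}" "r \<in> {1..n}" "i < k" "j > r"
  then have "X' i j * X' k r = X' k r * X' i j"
    using OP.qcommD[OF D(3)[of i k r j]] by simp
  then show ?thesis by (simp add: p hh_minus hh_gen_gen)
next
  note D = OP.quantum_matrixD[OF quantum_matrix_X']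
  fix i k j r
  assume p: "p = (gen (i,j) * gen (k,r) - gen (k,r) * gen (i,j))
      - scal (qpow 1 - qpow (- 1)) * (gen (i,r) * gen (k,j))"
    and "i \<in> {1..m}" "k \<in> {1..m}" "j \<in> {1..n}" "r \<in> {1..n}" "i < k" "j < r"
  then have "X' i j * X' k r = X' k r * X' i j + opscale (\<epsilon> - inverse \<epsilon>) (X' i r * X' k j)"
    using D(4)[of i k j r] by simp
  then show ?thesis
    by (simp only: p hh_minus hh_gen_gen hh_scal_mult) (simp add: ev_simps ev_minus power_int_minus)
qed

lemma ideal_hh: "ideal {p \<in> carrier FA. hh p = 0} FA"
proof (rule idealI[OF FA.ring_axioms])
  show "subgroup {p \<in> carrier FA. hh p = 0} (add_monoid FA)"
  proof (rule FA.add.subgroupI)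
    show "\<ominus>\<^bsub>FA\<^esub> a \<in> {p \<in> carrier FA. hh p = 0}" if "a \<in> {p \<in> carrier FA. hh p = 0}" for a
    proof -
      have "\<ominus>\<^bsub>FA\<^esub> a = - a" using that by (intro FA.minus_equality) (auto simp: FA_simps(4,5))
      then show ?thesis using that hh_minus[of 0 a] by (auto simp: hh_basic)
    qed
  qed (use hh_basic in \<open>auto simp: FA_simps(4,5) hh_add\<close>)
qed (auto simp: FA_simps(2) hh_mult)

lemma qmat_ideal_hh: "p \<in> qmat_ideal m n \<Longrightarrow> hh p = 0"
proof -
  have "qmat_ideal m n \<subseteq> {p \<in> carrier FA. hh p = 0}"
    unfolding qmat_ideal_def
    by (rule FA.genideal_minimal[OF ideal_hh]) (use qmat_relations_carrier hh_relation in auto)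
  then show "p \<in> qmat_ideal m n \<Longrightarrow> hh p = 0" by auto
qed

text \<open>A polynomial that vanishes in the algebra is a multiple of q - \<epsilon> up to the
  relation ideal. \<open>hh\<close> kills both: the ideal because the operators satisfy the
  relations, the multiple because \<open>ev\<close> sends q to \<epsilon>.\<close>

lemma hh_kernel:
  assumes p: "p \<in> carrier FA" and Q: "Q p = \<zero>\<^bsub>R\<^esub>"
  shows "hh p = 0"
proof -
  let ?c = "scal (qpow 1 - lconst \<epsilon>)"
  have "spec_ideal m n \<epsilon> +>\<^bsub>Rq m n\<^esub> Rq_class m n p = spec_ideal m n \<epsilon>"
    using Q by (simp add: Q_def sigma_def Reps_def FactRing_def)
  then have "Rq_class m n p \<in> spec_ideal m n \<epsilon>"
    by (rule SI.rcos_const_imp_mem[rotated]) (use p in \<open>auto simp: Rq_carrier\<close>)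
  then obtain s where s: "s \<in> carrier FA" "Rq_class m n p = Rq_class m n ?c \<otimes>\<^bsub>Rq m n\<^esub> Rq_class m n s"
    by (auto simp: spec_ideal_def Rq_carrier)
  then have e: "Rq_class m n p = Rq_class m n (?c * s)"
    using ring_hom_mult[OF Rq_class_hom FA_closed(8) s(1)] by (simp add: FA_simps(2))
  have cs: "?c * s \<in> carrier FA" using s by auto
  have "p \<ominus>\<^bsub>FA\<^esub> (?c * s) \<in> qmat_ideal m n"
    using FA.quotient_eq_iff_same_a_r_cos[OF QI.ideal_axioms p cs] e by (simp add: Rq_class_def)
  moreover have "p \<ominus>\<^bsub>FA\<^esub> (?c * s) = p - ?c * s"
  proof -
    have "\<ominus>\<^bsub>FA\<^esub> (?c * s) = - (?c * s)"
      using cs by (intro FA.minus_equality) (auto simp: FA_simps(4,5))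
    then show ?thesis by (simp add: a_minus_def FA_simps(5))
  qed
  ultimately have "hh (p - ?c * s) = 0" by (simp add: qmat_ideal_hh)
  then show ?thesis by (simp add: hh_minus hh_scal_mult ev_minus ev_simps)
qed

text \<open>A representative is chosen; by \<open>hh_kernel\<close> the value does not depend on the
  choice.\<close>

definition h :: "'k qfree set set \<Rightarrow> 'k torus_op" where
  "h s = hh (SOME p. p \<in> carrier FA \<and> Q p = s)"

lemma h_Q: "p \<in> carrier FA \<Longrightarrow> h (Q p) = hh p"
proof -
  assume p: "p \<in> carrier FA"
  define p' where "p' = (SOME p'. p' \<in> carrier FA \<and> Q p' = Q p)"
  have p': "p' \<in> carrier FA" "Q p' = Q p"
    unfolding p'_def using someI[of "\<lambda>p'. p' \<in> carrier FA \<and> Q p' = Q p" p] p by auto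
  have d: "p' - p \<in> carrier FA" using p p' by (intro FA_closed)
  have "Q (p' - p) \<oplus>\<^bsub>R\<^esub> Q p = Q p"
    using Q_simps(3)[OF d p] p' by simp
  then have "Q (p' - p) = \<zero>\<^bsub>R\<^esub>"
    using R.add.r_cancel_one[OF Q_simps(1)[OF p] Q_simps(1)[OF d]] by simp
  then have "hh (p' - p) = 0" using p p' by (intro hh_kernel) auto
  then show ?thesis by (simp add: h_def p'_def[symmetric] hh_minus)
qed

lemma h_hom:
  "x \<in> carrier R \<Longrightarrow> y \<in> carrier R \<Longrightarrow> h (x \<otimes>\<^bsub>R\<^esub> y) = h x * h y"
  "x \<in> carrier R \<Longrightarrow> y \<in> carrier R \<Longrightarrow> h (x \<oplus>\<^bsub>R\<^esub> y) = h x + h y"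
  "h \<zero>\<^bsub>R\<^esub> = 0" "h \<one>\<^bsub>R\<^esub> = 1"
proof -
  assume "x \<in> carrier R" "y \<in> carrier R"
  then obtain p q where pq: "p \<in> carrier FA" "q \<in> carrier FA" "x = Q p" "y = Q q" by (auto simp: R_carrier)
  show "h (x \<otimes>\<^bsub>R\<^esub> y) = h x * h y"
    using h_Q[of "p * q"] pq by (auto simp: Q_simps h_Q hh_mult)
  show "h (x \<oplus>\<^bsub>R\<^esub> y) = h x + h y"
    using h_Q[of "p + q"] pq by (auto simp: Q_simps h_Q hh_add)
next
  show "h \<zero>\<^bsub>R\<^esub> = 0" "h \<one>\<^bsub>R\<^esub> = 1"
    using h_Q[of 0] h_Q[of 1] by (auto simp: Q_simps Q_zero hh_basic)
qed

text \<open>The same \<open>S\<close> and \<open>c\<close> describe the element and its operator, so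
  that a statement about coefficients on the operator side says something about the element.\<close>

lemma R_sorted_expansion:
  assumes "s \<in> carrier R"
  shows "\<exists>S c. finite S \<and> (\<forall>w\<in>S. sorted w \<and> set w \<subseteq> I) \<and> s = Q (\<Sum>w\<in>S. cs (c w) * wm w) \<and>
    h s = (\<Sum>w\<in>S. opscale (c w) (word w))"
proof -
  obtain p where p: "p \<in> carrier FA" "s = Q p" using assms by (auto simp: R_carrier)
  obtain S c where S: "finite S" "\<forall>w\<in>S. sorted w \<and> set w \<subseteq> I" "p \<asymp> (\<Sum>w\<in>S. cs (c w) * wm w)"
    using straightening[OF p(1)] unfolding straight_def by blast
  then have e: "s = Q (\<Sum>w\<in>S. cs (c w) * wm w)" "(\<Sum>w\<in>S. cs (c w) * wm w) \<in> carrier FA"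
    using p by (auto simp: congr_def)
  have "h s = (\<Sum>w\<in>S. opscale (c w) (word w))"
    unfolding e(1) h_Q[OF e(2)] by (simp add: hh_sum hh_cs hh_basic)
  with S e show ?thesis by (intro exI[of _ S] exI[of _ c]) simp
qed

text \<open>No information is lost, since \<open>h s\<close> commutes with all
  \<open>\<rho> c\<close> and is determined by its value at 1. The map is additive, and it respects
  the commutative product when the left factor lies in the central subring.\<close>

definition \<Theta> :: "'k qfree set set \<Rightarrow> 'k torus" where "\<Theta> s = app (h s) 1"

text \<open>Existence of a leading exponent yields injectivity of \<Theta>; its nonnegativity later
  forces units of the central subring to be scalars.\<close>

lemma Theta_leading:
  assumes "s \<in> carrier R" "s \<noteq> \<zero>\<^bsub>R\<^esub>"
  shows "\<exists>a. leading a (\<Theta> s) \<and> (\<forall>p. 0 \<le> lookup a p)"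
proof -
  obtain S c where S: "finite S" "\<forall>w\<in>S. sorted w \<and> set w \<subseteq> I" "s = Q (\<Sum>w\<in>S. cs (c w) * wm w)"
    "h s = (\<Sum>w\<in>S. opscale (c w) (word w))"
    using R_sorted_expansion[OF assms(1)] by blast
  have "\<exists>w\<in>S. c w \<noteq> 0"
  proof (rule ccontr)
    assume "\<not> (\<exists>w\<in>S. c w \<noteq> 0)"
    then have "(\<Sum>w\<in>S. cs (c w) * wm w) = 0" by (intro sum.neutral) (auto simp: cs_simps)
    then show False using S(3) assms(2) by (simp add: Q_zero)
  qed
  then have "\<exists>w\<in>S. leading (wdeg w) (\<Theta> s)"
    unfolding \<Theta>_def S(4) using S by (intro sorted_words_leading) auto
  then show ?thesis by (auto simp: lookup_wdeg)
qed

lemma Theta_hom: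
  "x \<in> carrier R \<Longrightarrow> y \<in> carrier R \<Longrightarrow> \<Theta> (x \<otimes>\<^bsub>R\<^esub> y) = app (h x) (\<Theta> y)"
  "x \<in> carrier R \<Longrightarrow> y \<in> carrier R \<Longrightarrow> \<Theta> (x \<oplus>\<^bsub>R\<^esub> y) = \<Theta> x + \<Theta> y"
  "\<Theta> \<zero>\<^bsub>R\<^esub> = 0" "\<Theta> \<one>\<^bsub>R\<^esub> = 1"
  by (simp_all add: \<Theta>_def h_hom)

lemma Theta_inj: "x \<in> carrier R \<Longrightarrow> y \<in> carrier R \<Longrightarrow> \<Theta> x = \<Theta> y \<Longrightarrow> x = y"
proof -
  assume xy: "x \<in> carrier R" "y \<in> carrier R" "\<Theta> x = \<Theta> y"
  have "\<Theta> (x \<ominus>\<^bsub>R\<^esub> y) + \<Theta> y = \<Theta> x"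
    using Theta_hom(2)[of "x \<ominus>\<^bsub>R\<^esub> y" y] xy by (simp add: a_minus_def R.a_assoc R.l_neg)
  then have "\<Theta> (x \<ominus>\<^bsub>R\<^esub> y) = 0" using xy by simp
  then have "x \<ominus>\<^bsub>R\<^esub> y = \<zero>\<^bsub>R\<^esub>"
    using Theta_leading[of "x \<ominus>\<^bsub>R\<^esub> y"] xy by (auto dest: leading_nonzero)
  then show "x = y" using xy by simp
qed

lemma h_centralizer: "s \<in> carrier R \<Longrightarrow> h s \<in> centralizer"
  using R_sorted_expansion[of s] by (force intro!: centralizer_sum centralizer_closed word_centralizer)

lemma h_inj: "x \<in> carrier R \<Longrightarrow> y \<in> carrier R \<Longrightarrow> h x = h y \<Longrightarrow> x = y"
  by (rule Theta_inj) (auto simp: \<Theta>_def)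

end

section \<open>The algebra over its central subring\<close>

lemma prod_list_mult_commuting:
  fixes f g :: "'b \<Rightarrow> 'a::monoid_mult"
  assumes "\<And>p x. p \<in> set ps \<Longrightarrow> x \<in> S \<Longrightarrow> f p * x = x * f p"
    and "\<And>p. p \<in> set ps \<Longrightarrow> g p \<in> S" "1 \<in> S" "\<And>x y. x \<in> S \<Longrightarrow> y \<in> S \<Longrightarrow> x * y \<in> S"
    and "\<And>p. p \<in> set ps \<Longrightarrow> f p \<in> S"
  shows "prod_list (map (\<lambda>p. f p * g p) ps) = prod_list (map f ps) * prod_list (map g ps)"
  using assms(1,2,5)
proof (induction ps)
  case (Cons p ps)
  have c: "g p * prod_list (map f ps) = prod_list (map f ps) * g p"
    using Cons.prems(1,2)
  proof (induction ps)
    case (Cons q ps)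
    then have "g p * prod_list (map f ps) = prod_list (map f ps) * g p" "f q * g p = g p * f q" by auto
    then show ?case by (metis (no_types, lifting) list.simps(9) mult.assoc prod_list.Cons)
  qed simp
  have "f p * g p * (prod_list (map f ps) * prod_list (map g ps)) =
      f p * (g p * prod_list (map f ps)) * prod_list (map g ps)"
    by (simp add: mult.assoc)
  also have "\<dots> = f p * prod_list (map f ps) * (g p * prod_list (map g ps))"
    by (simp add: c mult.assoc)
  finally show ?case using Cons by simp
qed simp

context quantum_setup
begin

section \<open>The central subring inside the Laurent ring \<open>Z\<close>\<close>

lemma Z_closed:
  "0 \<in> Z" "1 \<in> Z" "f \<in> Z \<Longrightarrow> g \<in> Z \<Longrightarrow> f + g \<in> Z" "f \<in> Z \<Longrightarrow> g \<in> Z \<Longrightarrow> f * g \<in> Z" "f \<in> Z \<Longrightarrow> - f \<in> Z"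
  "cst c \<in> Z" "a \<in> Lat \<Longrightarrow> single a c \<in> Z"
proof -
  show "f \<in> Z \<Longrightarrow> g \<in> Z \<Longrightarrow> f + g \<in> Z" using Poly_Mapping.keys_add[of f g] by (auto simp: Z_def)
  assume fg: "f \<in> Z" "g \<in> Z"
  show "f * g \<in> Z" unfolding Z_def
  proof (intro CollectI subsetI)
    fix x assume "x \<in> keys (f * g)"
    then obtain a b where "x = a + b" "a \<in> keys f" "b \<in> keys g"
      using keys_mult[of f g] by blast
    then show "x \<in> Lat" using fg Lat_closed(2)[of a b] by (auto simp: Z_def)
  qed
qed (auto simp: Z_def Lat_closed in_keys_iff split: if_splits)

lemma Z_sum: "(\<And>s. s \<in> S \<Longrightarrow> f s \<in> Z) \<Longrightarrow> sum f S \<in> Z"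
  by (induction S rule: infinite_finite_induct) (auto intro: Z_closed)

lemma t_Z: "t i j \<in> Z" "ti i j \<in> Z"
  by (auto simp: t_def ti_def intro!: Z_closed single_l_Lat)

lemma zeta_Z: "\<zeta> i j \<in> Z"
proof -
  have "path_matrix t ti n k i j \<in> Z" for k
    by (induction k arbitrary: j) (auto intro!: Z_closed Z_sum t_Z)
  then show ?thesis by (simp add: \<zeta>_def)
qed

lemma mulop_centralizer: "f \<in> Z \<Longrightarrow> mulop f \<in> centralizer"
proof -
  assume f: "f \<in> Z"
  have "mulop f = (\<Sum>a\<in>keys f. opscale (lookup f a) (mulop (tmon a)))"
    by (subst poly_mapping_sum_single[of f]) (simp add: mulop_sum opscale_def mulop_simps(4)[symmetric] mult_single)
  also have "\<dots> \<in> centralizer"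
    using f by (intro centralizer_sum centralizer_closed) (auto simp: Z_def tau_Lat[symmetric] tau_centralizer)
  finally show ?thesis .
qed

lemma mulop_central: "f \<in> Z \<Longrightarrow> F \<in> centralizer \<Longrightarrow> mulop f * F = F * mulop f"
  by (rule centralizer_eqI)
    (use centralizer_Z_linear[of F f 1] in \<open>auto intro!: centralizer_closed mulop_centralizer\<close>)

definition C :: "'k qfree set set set" where "C = Ceps_carrier m n l \<epsilon>"

lemma Reps_scalar_Q: "Reps_scalar m n \<epsilon> a = Q (cs a)"
  by (simp add: Reps_scalar_def Q_def)

lemma zgen_Q: "zgen m n l \<epsilon> i j = Q (gen (i, j)) [^]\<^bsub>R\<^esub> l"
  by (simp add: zgen_def Q_def)

lemma h_pow: "s \<in> carrier R \<Longrightarrow> h (s [^]\<^bsub>R\<^esub> (k::nat)) = h s ^ k"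
  by (induction k) (simp_all add: h_hom power_commutes)

lemma h_Reps_scalar: "h (Reps_scalar m n \<epsilon> a) = mulop (cst a)" "Reps_scalar m n \<epsilon> a \<in> carrier R"
  by (simp_all add: Reps_scalar_Q h_Q hh_basic ev_simps mulop_cst Q_simps FA_closed)

lemma h_zgen: "(i, j) \<in> I \<Longrightarrow> h (zgen m n l \<epsilon> i j) = mulop (\<zeta> i j)"
  and zgen_carrier: "(i, j) \<in> I \<Longrightarrow> zgen m n l \<epsilon> i j \<in> carrier R"
  by (simp_all add: zgen_Q h_pow Q_simps FA_closed h_Q hh_gen X'_power)

abbreviation C_gens :: "'k qfree set set set" where
  "C_gens \<equiv> range (Reps_scalar m n \<epsilon>) \<union> {zgen m n l \<epsilon> i j | i j. i \<in> {1..m} \<and> j \<in> {1..n}}"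

lemma C_gens_carrier: "C_gens \<subseteq> carrier R"
  using h_Reps_scalar(2) zgen_carrier by (auto simp: I_def)

lemma C_eq: "C = generate_ring R C_gens"
  by (simp add: C_def Ceps_carrier_def)

lemma C_carrier: "c \<in> C \<Longrightarrow> c \<in> carrier R"
  using R.generate_ring_in_carrier[OF C_gens_carrier] by (simp add: C_eq)

lemma C_subring: "subring C R"
  unfolding C_eq by (rule R.generate_ring_is_subring[OF C_gens_carrier])

lemma C_mem: "Reps_scalar m n \<epsilon> a \<in> C" "(i, j) \<in> I \<Longrightarrow> zgen m n l \<epsilon> i j \<in> C"
  unfolding C_eq by (auto intro!: generate_ring.incl simp: I_def)

lemma h_uminus: "s \<in> carrier R \<Longrightarrow> h (\<ominus>\<^bsub>R\<^esub> s) = - h s"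
  using h_hom(2)[of "\<ominus>\<^bsub>R\<^esub> s" s] by (simp add: R.l_neg h_hom eq_neg_iff_add_eq_0)

text \<open>By induction over the generation of the subring: \<open>zgen\<close> acts as
  multiplication by the classical path matrix entry \<open>\<zeta> i j\<close>, and multiplication
  operators are closed under the ring operations.\<close>

lemma h_C_aux: "c \<in> C \<Longrightarrow> \<exists>f\<in>Z. h c = mulop f"
  unfolding C_eq
proof (induction rule: generate_ring.induct)
  note cc = C_carrier[unfolded C_eq]
  {
    case one
    show ?case by (rule bexI[of _ 1]) (simp_all add: h_hom mulop_simps Z_closed)
  next
    case (incl c)
    then show ?case using h_Reps_scalar h_zgen Z_closed(6) zeta_Z by (auto simp: I_def)
  next
    case (a_inv c)
    then obtain f where "f \<in> Z" "h c = mulop f" by blast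
    then show ?case using cc[OF a_inv.hyps]
      by (intro bexI[of _ "- f"]) (simp_all add: h_uminus mulop_simps Z_closed)
  next
    case (eng_add c d)
    then obtain f g where "f \<in> Z" "h c = mulop f" "g \<in> Z" "h d = mulop g" by blast
    then show ?case using cc[OF eng_add.hyps(1)] cc[OF eng_add.hyps(2)]
      by (intro bexI[of _ "f + g"]) (simp_all add: h_hom mulop_simps Z_closed)
  next
    case (eng_mult c d)
    then obtain f g where "f \<in> Z" "h c = mulop f" "g \<in> Z" "h d = mulop g" by blast
    then show ?case using cc[OF eng_mult.hyps(1)] cc[OF eng_mult.hyps(2)]
      by (intro bexI[of _ "f * g"]) (simp_all add: h_hom mulop_simps Z_closed)
  }
qed

lemma h_C: "c \<in> C \<Longrightarrow> h c = mulop (\<Theta> c)" and Theta_C_Z: "c \<in> C \<Longrightarrow> \<Theta> c \<in> Z"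
  using h_C_aux[of c] by (auto simp: \<Theta>_def)

lemma Theta_C_mult: "c \<in> C \<Longrightarrow> s \<in> carrier R \<Longrightarrow> \<Theta> (c \<otimes>\<^bsub>R\<^esub> s) = \<Theta> c * \<Theta> s"
  using Theta_hom(1)[OF C_carrier] by (simp add: h_C)

text \<open>Centrality is not computed from the relations: multiplication by an element of
  \<open>Z\<close> commutes with the whole centralizer, and \<open>h\<close> is injective.\<close>

lemma C_central: "c \<in> C \<Longrightarrow> s \<in> carrier R \<Longrightarrow> c \<otimes>\<^bsub>R\<^esub> s = s \<otimes>\<^bsub>R\<^esub> c"
  by (rule h_inj) (simp_all add: C_carrier h_hom h_C mulop_central Theta_C_Z h_centralizer)

lemma central_subring_C: "central_subring R C"
  unfolding central_subring_def using C_subring C_central by blast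

abbreviation CC :: "'k qfree set set ring" where "CC \<equiv> R\<lparr>carrier := C\<rparr>"

lemma cring_CC: "cring CC"
proof -
  have "subcring C R" using C_subring by (rule R.subcringI) (rule C_central, assumption, rule C_carrier)
  then show ?thesis using R.subcring_iff[of C] C_carrier by auto
qed

sublocale CC: cring CC by (rule cring_CC)

lemma Theta_CC:
  "c \<in> C \<Longrightarrow> d \<in> C \<Longrightarrow> \<Theta> (c \<otimes>\<^bsub>CC\<^esub> d) = \<Theta> c * \<Theta> d" "c \<in> C \<Longrightarrow> d \<in> C \<Longrightarrow> \<Theta> (c \<oplus>\<^bsub>CC\<^esub> d) = \<Theta> c + \<Theta> d"
  "\<Theta> \<one>\<^bsub>CC\<^esub> = 1" "\<Theta> \<zero>\<^bsub>CC\<^esub> = 0"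
  by (simp_all add: Theta_C_mult Theta_hom C_carrier)

lemma Theta_scalar: "\<Theta> (Reps_scalar m n \<epsilon> a) = cst a"
  by (simp add: \<Theta>_def h_Reps_scalar)

lemma Theta_zgen: "(i, j) \<in> I \<Longrightarrow> \<Theta> (zgen m n l \<epsilon> i j) = \<zeta> i j"
  by (simp add: \<Theta>_def h_zgen)

text \<open>A copy of the central subring inside a commutative ring type, where matrices and
  determinants live.\<close>

definition HC :: "'k torus set" where "HC = \<Theta> ` C"

lemma HC_closed: "0 \<in> HC" "1 \<in> HC" "f \<in> HC \<Longrightarrow> g \<in> HC \<Longrightarrow> f + g \<in> HC" "f \<in> HC \<Longrightarrow> g \<in> HC \<Longrightarrow> f * g \<in> HC"
  "cst a \<in> HC" "(i, j) \<in> I \<Longrightarrow> \<zeta> i j \<in> HC"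
proof -
  show "0 \<in> HC" unfolding HC_def using Theta_CC(4) CC.zero_closed by force
  show "1 \<in> HC" unfolding HC_def using Theta_CC(3) CC.one_closed by force
  {
    assume "f \<in> HC" "g \<in> HC"
    then obtain c d where cd: "c \<in> C" "d \<in> C" "f = \<Theta> c" "g = \<Theta> d" by (auto simp: HC_def)
    have "\<Theta> (c \<oplus>\<^bsub>CC\<^esub> d) = f + g" "c \<oplus>\<^bsub>CC\<^esub> d \<in> C"
      using cd Theta_CC(2)[of c d] CC.add.m_closed[of c d] by auto
    then show "f + g \<in> HC" unfolding HC_def by (metis imageI)
    have "\<Theta> (c \<otimes>\<^bsub>CC\<^esub> d) = f * g" "c \<otimes>\<^bsub>CC\<^esub> d \<in> C"
      using cd Theta_CC(1)[of c d] CC.m_closed[of c d] by auto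
    then show "f * g \<in> HC" unfolding HC_def by (metis imageI)
  }
  show "cst a \<in> HC" unfolding HC_def using Theta_scalar C_mem(1) by (metis imageI)
  show "(i, j) \<in> I \<Longrightarrow> \<zeta> i j \<in> HC" unfolding HC_def using Theta_zgen C_mem(2) by (metis imageI)
qed

lemma HC_sum: "(\<And>s. s \<in> S \<Longrightarrow> f s \<in> HC) \<Longrightarrow> sum f S \<in> HC"
  by (induction S rule: infinite_finite_induct) (auto intro: HC_closed)

lemma HC_Z: "f \<in> HC \<Longrightarrow> f \<in> Z"
  by (auto simp: HC_def Theta_C_Z)

lemma HC_power: "f \<in> HC \<Longrightarrow> f ^ k \<in> HC"
  by (induction k) (auto intro: HC_closed)

section \<open>Exponents reduced modulo \<open>l\<close>\<close>

definition A :: "expo set" where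
  "A = {\<alpha>. keys \<alpha> \<subseteq> I \<and> (\<forall>p. 0 \<le> lookup \<alpha> p \<and> lookup \<alpha> p < int l)}"

definition of_fun :: "(nat \<times> nat \<Rightarrow> int) \<Rightarrow> expo" where
  "of_fun f = (\<Sum>p\<in>I. single p (f p))"

lemma lookup_of_fun: "lookup (of_fun f) p = (if p \<in> I then f p else 0)"
proof -
  have "lookup (of_fun f) p = (\<Sum>q\<in>I. if q = p then f p else 0)"
    unfolding of_fun_def lookup_sum by (intro sum.cong) (auto simp: lookup_single when_def)
  then show ?thesis by simp
qed

text \<open>The representative in \<open>A\<close> of a class modulo \<open>Lat\<close>; it is zero
  outside \<open>I\<close>, where \<open>Lat\<close> imposes no condition.\<close>

definition red :: "expo \<Rightarrow> expo" where "red a = of_fun (\<lambda>p. lookup a p mod int l)"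

lemma red_A: "red a \<in> A"
  using l_pos by (auto simp: A_def red_def lookup_of_fun in_keys_iff split: if_splits)

lemma red_Lat: "a - red a \<in> Lat"
  by (auto simp: Lat_def red_def lookup_of_fun lookup_minus minus_mod_eq_mult_div)

lemma A_Lat_inj: "\<alpha> \<in> A \<Longrightarrow> \<nu> \<in> A \<Longrightarrow> \<alpha> - \<nu> \<in> Lat \<Longrightarrow> \<alpha> = \<nu>"
proof (rule poly_mapping_eqI)
  fix p assume *: "\<alpha> \<in> A" "\<nu> \<in> A" "\<alpha> - \<nu> \<in> Lat"
  show "lookup \<alpha> p = lookup \<nu> p"
  proof (cases "p \<in> I")
    case True
    then have "int l dvd lookup \<alpha> p - lookup \<nu> p"
      using * by (auto simp: Lat_def lookup_minus)
    then have "lookup \<alpha> p mod int l = lookup \<nu> p mod int l"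
      by (simp add: mod_eq_dvd_iff)
    moreover have "0 \<le> lookup \<alpha> p" "lookup \<alpha> p < int l"
      "0 \<le> lookup \<nu> p" "lookup \<nu> p < int l"
      using *(1,2) unfolding A_def by blast+
    ultimately show ?thesis by simp
  next
    case False
    then have "p \<notin> keys \<alpha>" "p \<notin> keys \<nu>" using *(1,2) by (auto simp: A_def)
    then show ?thesis by (simp add: in_keys_iff)
  qed
qed

lemma red_unique: "\<alpha> \<in> A \<Longrightarrow> a - \<alpha> \<in> Lat \<longleftrightarrow> red a = \<alpha>"
proof
  assume "\<alpha> \<in> A" "a - \<alpha> \<in> Lat"
  then show "red a = \<alpha>"
    using Lat_closed(4)[of "a - \<alpha>" "a - red a"] by (intro A_Lat_inj red_A red_Lat) (auto simp: red_Lat)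
qed (use red_Lat in auto)

text \<open>The version for subsets also counts the reduced exponents that vanish at one position,
  which determines the exponent L of the discriminant.\<close>

lemma card_A_on:
  assumes "J \<subseteq> I"
  shows "finite {\<alpha> \<in> A. keys \<alpha> \<subseteq> J} \<and> card {\<alpha> \<in> A. keys \<alpha> \<subseteq> J} = l ^ card J"
proof -
  let ?B = "J \<rightarrow>\<^sub>E {0..<int l}"
  let ?g = "\<lambda>f. of_fun (\<lambda>p. if p \<in> J then f p else 0)"
  have "bij_betw (\<lambda>\<alpha>. restrict (lookup \<alpha>) J) {\<alpha> \<in> A. keys \<alpha> \<subseteq> J} ?B"
  proof (rule bij_betw_byWitness[of _ ?g])
    show "\<forall>\<alpha>\<in>{\<alpha> \<in> A. keys \<alpha> \<subseteq> J}. ?g (restrict (lookup \<alpha>) J) = \<alpha>"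
    proof (intro ballI poly_mapping_eqI)
      fix \<alpha> p assume "\<alpha> \<in> {\<alpha> \<in> A. keys \<alpha> \<subseteq> J}"
      then have "lookup \<alpha> p = 0" if "p \<notin> J"
        using that by (metis (mono_tags, lifting) in_keys_iff mem_Collect_eq subsetD)
      then show "lookup (?g (restrict (lookup \<alpha>) J)) p = lookup \<alpha> p"
        using assms by (auto simp: lookup_of_fun)
    qed
    show "\<forall>f\<in>?B. restrict (lookup (?g f)) J = f"
      using assms by (auto simp: lookup_of_fun fun_eq_iff PiE_def extensional_def)
    show "(\<lambda>\<alpha>. restrict (lookup \<alpha>) J) ` {\<alpha> \<in> A. keys \<alpha> \<subseteq> J} \<subseteq> ?B"
      by (auto simp: A_def)
    show "?g ` ?B \<subseteq> {\<alpha> \<in> A. keys \<alpha> \<subseteq> J}"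
      using l_pos assms by (auto simp: A_def lookup_of_fun in_keys_iff PiE_def Pi_def split: if_splits)
  qed
  moreover have "finite J" by (rule finite_subset[OF assms finite_I])
  then have "finite ?B" "card ?B = l ^ card J"
    by (simp_all add: finite_PiE card_PiE)
  ultimately show ?thesis
    by (auto simp: bij_betw_finite bij_betw_same_card)
qed

lemma card_A: "finite A" "card A = l ^ (m * n)"
proof -
  have "{\<alpha> \<in> A. keys \<alpha> \<subseteq> I} = A" by (auto simp: A_def)
  then show "finite A" "card A = l ^ (m * n)" using card_A_on[of I] by (simp_all add: I_def)
qed

section \<open>Standard monomials as a basis over the central subring\<close>

definition wd :: "(nat \<times> nat \<Rightarrow> nat) \<Rightarrow> (nat \<times> nat) list" where
  "wd a = concat (map (\<lambda>p. replicate (a p) p) (sorted_list_of_set I))"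

lemma sorted_concat_replicate:
  "sorted ps \<Longrightarrow> sorted (concat (map (\<lambda>p. replicate (a p) p) (ps :: 'b::linorder list)))"
  by (induction ps) (auto simp: sorted_append)

lemma count_concat_replicate:
  "distinct ps \<Longrightarrow> count_list (concat (map (\<lambda>p. replicate (a p) p) ps)) q = (if q \<in> set ps then a q else 0)"
proof (induction ps)
  case (Cons p ps)
  have "count_list (replicate k p) q = (if p = q then k else 0)" for k by (induction k) auto
  then show ?case using Cons by auto
qed simp

lemma wd_props: "sorted (wd a)" "set (wd a) \<subseteq> I" "count_list (wd a) q = (if q \<in> I then a q else 0)"
  unfolding wd_def by (auto simp: sorted_concat_replicate count_concat_replicate split: if_splits)

lemma sorted_word_wd:
  assumes "sorted w" "set w \<subseteq> I" shows "w = wd (count_list w)"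
proof (rule sorted_word_wdeg_inj)
  show "wdeg w = wdeg (wd (count_list w))"
    using assms by (auto intro!: poly_mapping_eqI simp: lookup_wdeg wd_props count_list_0_iff)
qed (use assms wd_props in auto)

lemma word_wd: "word (wd a) = prod_list (map (\<lambda>(i, j). X' i j ^ a (i, j)) (sorted_list_of_set I))"
proof -
  have "word (replicate k p) = (case p of (i, j) \<Rightarrow> X' i j ^ k)" for k p
    by (cases p, induction k) (auto simp: word_def)
  moreover have "word (concat ws) = prod_list (map word ws)" for ws
    by (induction ws) auto
  ultimately show ?thesis
    by (auto simp: wd_def comp_def intro!: arg_cong[where f = prod_list])
qed

text \<open>Each exponent is divided by \<open>l\<close> with remainder. The \<open>l\<close>-th
  powers are multiplications by \<open>\<zeta> i j\<close>, which commute with all \<open>X'\<close>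
  and can be collected in front.\<close>

lemma word_wd_reduce: "\<exists>f\<in>HC. word (wd a) = mulop f * word (wd (\<lambda>p. a p mod l))"
proof -
  let ?f = "\<lambda>p. \<zeta> (fst p) (snd p) ^ (a p div l)"
  let ?g = "\<lambda>p. X' (fst p) (snd p) ^ (a p mod l)"
  let ?ps = "sorted_list_of_set I"
  have fHC: "?f p \<in> HC" if "p \<in> I" for p using that by (auto intro!: HC_power HC_closed)
  have powC: "F ^ k \<in> centralizer" if "F \<in> centralizer" for F k
    using that by (induction k) (auto intro: centralizer_closed)
  have mp: "mulop f ^ k = mulop (f ^ k)" for f :: "'k torus" and k
    by (induction k) (auto simp: mulop_simps)
  have "word (wd a) = prod_list (map (\<lambda>p. mulop (?f p) * ?g p) ?ps)"
    unfolding word_wd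
  proof (intro arg_cong[where f = prod_list] map_cong refl)
    fix p assume "p \<in> set ?ps"
    then have p: "(fst p, snd p) \<in> I" by simp
    have "X' (fst p) (snd p) ^ a p = (X' (fst p) (snd p) ^ l) ^ (a p div l) * ?g p"
      by (metis power_add power_mult mult_div_mod_eq)
    then show "(case p of (i, j) \<Rightarrow> X' i j ^ a (i, j)) = mulop (?f p) * ?g p"
      by (simp add: X'_power[OF p] mp split: prod.split) (auto simp: split_beta)
  qed
  also have "\<dots> = prod_list (map (\<lambda>p. mulop (?f p)) ?ps) * prod_list (map ?g ?ps)"
    by (rule prod_list_mult_commuting[of _ centralizer])
      (auto intro!: mulop_central mulop_centralizer HC_Z fHC powC X'_centralizer intro: centralizer_closed)
  also have "prod_list (map (\<lambda>p. mulop (?f p)) ps) = mulop (prod_list (map ?f ps))" for ps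
    by (induction ps) (auto simp: mulop_simps)
  also have "prod_list (map ?g ?ps) = word (wd (\<lambda>p. a p mod l))"
    by (auto simp: word_wd intro!: arg_cong[where f = prod_list])
  finally have "word (wd a) = mulop (prod_list (map ?f ?ps)) * word (wd (\<lambda>p. a p mod l))" .
  moreover have "prod_list (map ?f ps) \<in> HC" if "set ps \<subseteq> I" for ps
    using that by (induction ps) (auto intro: HC_closed fHC)
  ultimately show ?thesis by (intro bexI[of _ "prod_list (map ?f ?ps)"]) simp_all
qed

definition xm :: "expo \<Rightarrow> 'k qfree set set" where
  "xm \<alpha> = Q (wm (wd (\<lambda>p. nat (lookup \<alpha> p))))"

lemma xm_carrier: "xm \<alpha> \<in> carrier R"
  by (simp add: xm_def Q_simps wm_closed wd_props)

lemma h_xm: "h (xm \<alpha>) = word (wd (\<lambda>p. nat (lookup \<alpha> p)))"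
  by (simp add: xm_def h_Q wm_closed wd_props hh_basic)

lemma leading_xm: "\<alpha> \<in> A \<Longrightarrow> leading \<alpha> (\<Theta> (xm \<alpha>))"
proof -
  assume "\<alpha> \<in> A"
  then have "wdeg (wd (\<lambda>p. nat (lookup \<alpha> p))) = \<alpha>"
    by (auto intro!: poly_mapping_eqI simp: lookup_wdeg wd_props A_def in_keys_iff)
  then show ?thesis
    using leading_word[OF wd_props(2)[of "\<lambda>p. nat (lookup \<alpha> p)"]] by (simp add: \<Theta>_def h_xm)
qed

text \<open>Sorted words are grouped by their exponents modulo \<open>l\<close>; the split-off
  \<open>l\<close>-th powers become coefficients in \<open>HC\<close>.\<close>

lemma xm_span:
  assumes "s \<in> carrier R"
  shows "\<exists>f. (\<forall>\<alpha>\<in>A. f \<alpha> \<in> HC) \<and> \<Theta> s = (\<Sum>\<alpha>\<in>A. f \<alpha> * \<Theta> (xm \<alpha>))"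
proof -
  obtain S c where S: "finite S" "\<forall>w\<in>S. sorted w \<and> set w \<subseteq> I" "h s = (\<Sum>w\<in>S. opscale (c w) (word w))"
    using R_sorted_expansion[OF assms] by blast
  define \<gamma> where "\<gamma> w = of_fun (\<lambda>p. int (count_list w p mod l))" for w
  have \<gamma>A: "\<gamma> w \<in> A" for w
    using l_pos by (auto simp: \<gamma>_def A_def lookup_of_fun in_keys_iff split: if_splits)
  have "\<exists>f. f \<in> HC \<and> app (word w) 1 = f * \<Theta> (xm (\<gamma> w))" if "w \<in> S" for w
  proof -
    obtain f where f: "f \<in> HC" "word (wd (count_list w)) = mulop f * word (wd (\<lambda>p. count_list w p mod l))"
      using word_wd_reduce by blast
    have "wd (\<lambda>p. nat (lookup (\<gamma> w) p)) = wd (\<lambda>p. count_list w p mod l)"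
      by (auto simp: wd_def \<gamma>_def lookup_of_fun intro!: arg_cong[where f = concat])
    then have "app (word w) 1 = f * \<Theta> (xm (\<gamma> w))"
      using f(2) sorted_word_wd[of w] S that by (simp add: \<Theta>_def h_xm)
    then show ?thesis using f by blast
  qed
  then obtain f where f: "\<And>w. w \<in> S \<Longrightarrow> f w \<in> HC \<and> app (word w) 1 = f w * \<Theta> (xm (\<gamma> w))" by metis
  let ?F = "\<lambda>\<alpha>. \<Sum>w\<in>{w\<in>S. \<gamma> w = \<alpha>}. cst (c w) * f w"
  have "\<Theta> s = (\<Sum>w\<in>S. cst (c w) * f w * \<Theta> (xm (\<gamma> w)))"
    unfolding \<Theta>_def[of s] S(3) app_sum_op using f by (intro sum.cong) (auto simp: mult.assoc)
  also have "\<dots> = (\<Sum>\<alpha>\<in>A. \<Sum>w\<in>{w\<in>S. \<gamma> w = \<alpha>}. cst (c w) * f w * \<Theta> (xm (\<gamma> w)))"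
    by (rule sum.group[symmetric]) (use S \<gamma>A card_A in auto)
  also have "\<dots> = (\<Sum>\<alpha>\<in>A. ?F \<alpha> * \<Theta> (xm \<alpha>))"
    by (simp add: sum_distrib_right)
  finally have "\<Theta> s = (\<Sum>\<alpha>\<in>A. ?F \<alpha> * \<Theta> (xm \<alpha>))" .
  moreover have "\<forall>\<alpha>\<in>A. ?F \<alpha> \<in> HC"
    using f by (auto intro!: HC_sum HC_closed)
  ultimately show ?thesis by (intro exI[of _ ?F]) simp
qed

text \<open>Leading exponents of coefficients from \<open>Z\<close> lie in \<open>Lat\<close>, while
  the elements of \<open>A\<close> are distinct modulo \<open>Lat\<close>; so no two summands share
  a leading exponent. Independence thus holds even over the larger ring \<open>Z\<close>.\<close>

lemma xm_independent:
  assumes "\<And>\<alpha>. \<alpha> \<in> A \<Longrightarrow> f \<alpha> \<in> Z" "(\<Sum>\<alpha>\<in>A. f \<alpha> * \<Theta> (xm \<alpha>)) = 0" "\<alpha> \<in> A"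
  shows "f \<alpha> = 0"
proof (rule ccontr)
  assume "f \<alpha> \<noteq> 0"
  define d where "d \<alpha> = (SOME a. leading a (f \<alpha>))" for \<alpha>
  have d: "leading (d \<nu>) (f \<nu>)" if "f \<nu> \<noteq> 0" for \<nu>
    unfolding d_def using leading_exists[OF that] by (rule someI_ex)
  have dL: "d \<nu> \<in> Lat" if "f \<nu> \<noteq> 0" "\<nu> \<in> A" for \<nu>
    using d[OF that(1)] assms(1)[OF that(2)] by (auto simp: leading_def Z_def in_keys_iff subset_iff)
  have "\<exists>\<nu>\<in>A. f \<nu> * \<Theta> (xm \<nu>) \<noteq> 0 \<and> leading (d \<nu> + \<nu>) (\<Sum>\<alpha>\<in>A. f \<alpha> * \<Theta> (xm \<alpha>))"
  proof (rule leading_sum)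
    show "leading (d \<nu> + \<nu>) (f \<nu> * \<Theta> (xm \<nu>))" if "\<nu> \<in> A" "f \<nu> * \<Theta> (xm \<nu>) \<noteq> 0" for \<nu>
      using that by (intro leading_mult d leading_xm) auto
    show "\<nu> = \<nu>'" if "\<nu> \<in> A" "\<nu>' \<in> A" "f \<nu> * \<Theta> (xm \<nu>) \<noteq> 0" "f \<nu>' * \<Theta> (xm \<nu>') \<noteq> 0" "d \<nu> + \<nu> = d \<nu>' + \<nu>'" for \<nu> \<nu>'
    proof (rule A_Lat_inj[OF that(1,2)])
      have "\<nu> - \<nu>' = d \<nu>' - d \<nu>" using that(5) by (simp add: algebra_simps)
      then show "\<nu> - \<nu>' \<in> Lat" using dL[of \<nu>] dL[of \<nu>'] that by (auto intro: Lat_closed)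
    qed
    show "\<exists>\<nu>\<in>A. f \<nu> * \<Theta> (xm \<nu>) \<noteq> 0"
      using \<open>f \<alpha> \<noteq> 0\<close> assms(3) leading_nonzero[OF leading_xm[OF assms(3)]] by auto
  qed (rule card_A)
  then show False using assms(2) leading_nonzero by metis
qed

section \<open>Coordinates with respect to the torus monomials\<close>

definition proj :: "'k torus \<Rightarrow> 'k torus" where
  "proj f = Poly_Mapping.mapp (\<lambda>a c. c when a \<in> Lat) f"

lemma lookup_proj: "lookup (proj f) a = (lookup f a when a \<in> Lat)"
  by (auto simp: proj_def lookup_mapp when_def in_keys_iff)

lemma proj_Z: "proj f \<in> Z"
  by (auto simp: Z_def in_keys_iff lookup_proj when_def split: if_splits)

lemma proj_add: "proj (f + g) = proj f + proj g"
  by (rule poly_mapping_eqI) (auto simp: lookup_proj lookup_add when_def)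

lemma proj_sum: "proj (sum f S) = (\<Sum>s\<in>S. proj (f s))"
  by (rule additive_sum) (rule proj_add)

lemma proj_Z_mult: "f \<in> Z \<Longrightarrow> proj (f * g) = f * proj g"
proof (rule poly_mapping_eqI)
  fix k assume f: "f \<in> Z"
  have "k - x \<in> Lat \<longleftrightarrow> k \<in> Lat" if "x \<in> keys f" for x
  proof -
    have x: "x \<in> Lat" using f that by (auto simp: Z_def)
    show ?thesis using Lat_closed(2)[of "k - x" x] Lat_closed(4)[of k x] x by auto
  qed
  then show "lookup (proj (f * g)) k = lookup (f * proj g) k"
    by (auto simp: lookup_proj lookup_mult_group when_def intro!: sum.cong)
qed

lemma proj_single: "proj (single a c) = (if a \<in> Lat then single a c else 0)"
  by (rule poly_mapping_eqI) (auto simp: lookup_proj lookup_single when_def)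

text \<open>The class of \<alpha> modulo \<open>Lat\<close> is shifted to \<open>Lat\<close> by the
  commutative product, so no power of \<epsilon> enters the coordinates.\<close>

definition coef :: "'k torus \<Rightarrow> expo \<Rightarrow> 'k torus" where
  "coef f \<alpha> = proj (tmon (- \<alpha>) * f)"

lemma lookup_coef: "lookup (coef f \<alpha>) a = (lookup f (a + \<alpha>) when a \<in> Lat)"
  by (simp add: coef_def lookup_proj lookup_single_mult)

lemma coef_Z: "coef f \<alpha> \<in> Z"
  by (simp add: coef_def proj_Z)

lemma coef_expand: "f = (\<Sum>\<alpha>\<in>A. coef f \<alpha> * tmon \<alpha>)"
proof (rule poly_mapping_eqI)
  fix k
  have "lookup (\<Sum>\<alpha>\<in>A. coef f \<alpha> * tmon \<alpha>) k =
      (\<Sum>\<alpha>\<in>A. lookup f k when k - \<alpha> \<in> Lat)"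
    by (simp add: lookup_sum mult.commute[of _ "tmon _"] lookup_single_mult lookup_coef)
  also have "\<dots> = (\<Sum>\<alpha>\<in>A. if \<alpha> = red k then lookup f k else 0)"
    using red_unique by (intro sum.cong) (auto simp: when_def)
  also have "\<dots> = lookup f k" using red_A card_A by simp
  finally show "lookup f k = lookup (\<Sum>\<alpha>\<in>A. coef f \<alpha> * tmon \<alpha>) k" by simp
qed

lemma coef_combination:
  assumes "\<And>\<nu>. \<nu> \<in> A \<Longrightarrow> g \<nu> \<in> Z" "\<alpha> \<in> A"
  shows "coef (\<Sum>\<nu>\<in>A. g \<nu> * tmon \<nu>) \<alpha> = g \<alpha>"
proof -
  have "coef (\<Sum>\<nu>\<in>A. g \<nu> * tmon \<nu>) \<alpha> = (\<Sum>\<nu>\<in>A. proj (g \<nu> * tmon (\<nu> - \<alpha>)))"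
    unfolding coef_def sum_distrib_left proj_sum
    by (intro sum.cong refl arg_cong[where f = proj]) (simp add: mult.left_commute mult_single)
  also have "\<dots> = (\<Sum>\<nu>\<in>A. if \<nu> = \<alpha> then g \<alpha> else 0)"
    using assms A_Lat_inj
    by (intro sum.cong refl) (auto simp: proj_Z_mult proj_single Lat_closed)
  finally show ?thesis using assms card_A by simp
qed

section \<open>The torus monomials lie in the \<open>Z\<close>-span of the algebra\<close>

definition U :: "'k torus set" where
  "U = {f. \<exists>g. (\<forall>\<alpha>\<in>A. g \<alpha> \<in> Z) \<and> f = (\<Sum>\<alpha>\<in>A. g \<alpha> * \<Theta> (xm \<alpha>))}"

lemma U_Theta: "s \<in> carrier R \<Longrightarrow> \<Theta> s \<in> U"
  using xm_span[of s] HC_Z by (fastforce simp: U_def)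

lemma U_add: "f \<in> U \<Longrightarrow> f' \<in> U \<Longrightarrow> f + f' \<in> U"
proof -
  assume "f \<in> U" "f' \<in> U"
  then obtain g g' where "\<forall>\<alpha>\<in>A. g \<alpha> \<in> Z" "f = (\<Sum>\<alpha>\<in>A. g \<alpha> * \<Theta> (xm \<alpha>))"
    "\<forall>\<alpha>\<in>A. g' \<alpha> \<in> Z" "f' = (\<Sum>\<alpha>\<in>A. g' \<alpha> * \<Theta> (xm \<alpha>))" unfolding U_def by blast
  then show ?thesis unfolding U_def
    by (intro CollectI exI[of _ "\<lambda>\<alpha>. g \<alpha> + g' \<alpha>"]) (auto simp: distrib_right sum.distrib Z_closed)
qed

lemma U_scale: "z \<in> Z \<Longrightarrow> f \<in> U \<Longrightarrow> z * f \<in> U"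
proof -
  assume z: "z \<in> Z" and "f \<in> U"
  then obtain g where "\<forall>\<alpha>\<in>A. g \<alpha> \<in> Z" "f = (\<Sum>\<alpha>\<in>A. g \<alpha> * \<Theta> (xm \<alpha>))" unfolding U_def by blast
  then show ?thesis unfolding U_def using z
    by (intro CollectI exI[of _ "\<lambda>\<alpha>. z * g \<alpha>"]) (auto simp: sum_distrib_left mult.assoc Z_closed)
qed

lemma U_sum: "(\<And>s. s \<in> S \<Longrightarrow> f s \<in> U) \<Longrightarrow> sum f S \<in> U"
proof (induction S rule: infinite_finite_induct)
  case empty
  show ?case using U_Theta[of "\<zero>\<^bsub>R\<^esub>"] by (simp add: Theta_hom)
next
  case (infinite S)
  show ?case using U_Theta[of "\<zero>\<^bsub>R\<^esub>"] infinite by (simp add: Theta_hom)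
qed (auto intro: U_add)

text \<open>These operators form a ring and 1 lies in \<open>U\<close>, so it suffices to bring the
  generators \<open>T i j\<close> into \<open>St\<close> and to apply their products to 1.\<close>

definition St :: "'k torus_op set" where "St = {F. \<forall>f\<in>U. app F f \<in> U}"

lemma St_closed: "F \<in> St \<Longrightarrow> G \<in> St \<Longrightarrow> F + G \<in> St" "F \<in> St \<Longrightarrow> G \<in> St \<Longrightarrow> F * G \<in> St"
  "F \<in> St \<Longrightarrow> G \<in> St \<Longrightarrow> F - G \<in> St" "z \<in> Z \<Longrightarrow> mulop z \<in> St" "1 \<in> St" "0 \<in> St"
  "F \<in> St \<Longrightarrow> opscale c F \<in> St"
proof -
  have n: "- f \<in> U" if "f \<in> U" for f
    using U_scale[of "- 1" f] that Z_closed by auto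
  show "F \<in> St \<Longrightarrow> G \<in> St \<Longrightarrow> F - G \<in> St"
    using U_add n by (fastforce simp: St_def diff_conv_add_uminus simp del: add_uminus_conv_diff)
  show "0 \<in> St" using U_sum[of "{}"] by (simp add: St_def)
qed (auto simp: St_def U_add U_scale Z_closed)

lemma St_power: "F \<in> St \<Longrightarrow> F ^ k \<in> St"
  by (induction k) (auto intro: St_closed)

text \<open>\<open>X' i j\<close> is linear over \<open>Z\<close> and acts on the image of the
  algebra as left multiplication by a generator.\<close>

lemma St_X': "(i, j) \<in> I \<Longrightarrow> X' i j \<in> St"
  unfolding St_def
proof (intro CollectI ballI)
  fix f assume ij: "(i, j) \<in> I" and "f \<in> U"
  then obtain g where g: "\<forall>\<alpha>\<in>A. g \<alpha> \<in> Z" "f = (\<Sum>\<alpha>\<in>A. g \<alpha> * \<Theta> (xm \<alpha>))" unfolding U_def by blast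
  let ?x = "Q (gen (i, j))"
  have x: "?x \<in> carrier R" "h ?x = X' i j" using ij by (auto simp: Q_simps FA_closed h_Q hh_gen)
  have "app (X' i j) f = (\<Sum>\<alpha>\<in>A. g \<alpha> * \<Theta> (?x \<otimes>\<^bsub>R\<^esub> xm \<alpha>))"
    using g by (auto simp: app_sum centralizer_Z_linear[OF X'_centralizer] Theta_hom x xm_carrier intro!: sum.cong)
  also have "\<dots> \<in> U"
    using g x by (intro U_sum U_scale U_Theta) (auto simp: xm_carrier)
  finally show "app (X' i j) f \<in> U" .
qed

text \<open>
  \<open>T i j\<close> is invertible over \<open>Z\<close> because its \<open>l\<close>-th power is multiplication by a monomial.
\<close>

lemma St_Ti:
  assumes "T i j \<in> St"
  shows "Ti i j \<in> St"
proof -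
  have "T i j ^ (l - 1) * T i j = mulop (t i j)"
    using T_power(1)[of i j] l_pos by (metis Suc_diff_1 power_Suc2)
  then have "T i j ^ (l - 1) * (T i j * Ti i j) = mulop (t i j) * Ti i j"
    by (simp add: mult.assoc[symmetric])
  then have "mulop (ti i j) * T i j ^ (l - 1) = mulop (ti i j) * (mulop (t i j) * Ti i j)"
    by (simp add: Q.T_Ti)
  also have "\<dots> = Ti i j"
    by (simp add: mult.assoc[symmetric] mulop_simps(4)[symmetric] C.ti_t mulop_simps)
  finally show ?thesis using assms by (metis St_closed(2,4) St_power t_Z(2))
qed

text \<open>The row steps are undone from \<open>m\<close> downwards. The last row at stage
  \<open>Suc k\<close> supplies the pivots, \<open>St_Ti\<close> their inverses, and the difference
  of two consecutive tail sums isolates one entry of the previous stage.\<close>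

lemma St_path_matrix:
  "k \<le> m \<Longrightarrow> 1 \<le> i \<Longrightarrow> i \<le> k \<Longrightarrow> j \<in> {1..n} \<Longrightarrow> path_matrix T Ti n k i j \<in> St"
proof (induction "m - k" arbitrary: k i j)
  case 0
  then have "k = m" by simp
  then show ?case using St_X'[of i j] 0 by (auto simp: X'_def I_def)
next
  case (Suc d)
  have IH: "path_matrix T Ti n (Suc k) i j \<in> St" if "1 \<le> i" "i \<le> Suc k" "j \<in> {1..n}" for i j
    using Suc.hyps Suc.prems that by (intro Suc.hyps(1)) auto
  have TS: "T (Suc k) j \<in> St" if "j \<in> {1..n}" for j
    using IH[of "Suc k" j] that by simp
  have TiS: "Ti (Suc k) j \<in> St" if "j \<in> {1..n}" for j
    by (rule St_Ti[OF TS[OF that]])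
  let ?A = "\<lambda>j. \<Sum>s\<in>{j..n}. path_matrix T Ti n k i s * Ti (Suc k) s"
  have AS: "?A j \<in> St" if "1 \<le> j" for j
  proof (cases "j \<le> n")
    case True
    have "path_matrix T Ti n (Suc k) i j = ?A j * T (Suc k) j" using Suc.prems by simp
    then have "path_matrix T Ti n (Suc k) i j * Ti (Suc k) j = ?A j"
      by (simp only: mult.assoc Q.T_Ti mult_1_right)
    moreover have "path_matrix T Ti n (Suc k) i j * Ti (Suc k) j \<in> St"
      using True that Suc.prems by (intro St_closed IH TiS) auto
    ultimately show ?thesis by metis
  \<comment> \<open>Beyond \<open>n\<close> the tail sum is empty; this case occurs as
    \<open>Suc j\<close> at the last column.\<close>
  qed (simp add: St_closed)
  have "?A j = path_matrix T Ti n k i j * Ti (Suc k) j + ?A (Suc j)"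
    using Suc.prems by (simp add: sum.atLeast_Suc_atMost)
  then have "path_matrix T Ti n k i j = (?A j - ?A (Suc j)) * T (Suc k) j"
    by (simp add: mult.assoc Q.T_Ti)
  also have "\<dots> \<in> St" using Suc.prems by (intro St_closed AS TS) auto
  finally show ?case .
qed

lemma St_T: "(i, j) \<in> I \<Longrightarrow> T i j \<in> St"
proof -
  assume ij: "(i, j) \<in> I"
  then obtain k where k: "i = Suc k" by (cases i) (auto simp: I_def)
  then show ?thesis using St_path_matrix[of i i j] ij by (auto simp: I_def)
qed

text \<open>\<open>\<tau> \<alpha>\<close> is a scalar multiple of a product of nonnegative powers
  of the \<open>T i j\<close>, and it maps 1 to the monomial.\<close>

lemma tmon_U: "\<alpha> \<in> A \<Longrightarrow> tmon \<alpha> \<in> U"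
proof -
  assume \<alpha>: "\<alpha> \<in> A"
  have add: "\<tau> (a + b) \<in> St" if "\<tau> a \<in> St" "\<tau> b \<in> St" for a b
  proof -
    have "\<tau> (a + b) = opscale (inverse (\<epsilon> powi B a b)) (\<tau> a * \<tau> b)"
      by (simp add: tau_mult OP.sc_sc)
    then show ?thesis using that St_closed by simp
  qed
  have single: "\<tau> (single p (int k)) \<in> St" if "p \<in> I" for p k
  proof (induction k)
    case (Suc k)
    have "\<tau> (single p 1) \<in> St"
      using St_T[of "fst p" "snd p"] that by (simp add: T_def e_def)
    from add[OF this Suc] show ?case by (simp add: single_add)
  qed (simp add: St_closed)
  have "\<tau> (\<Sum>p\<in>S. single p (lookup \<alpha> p)) \<in> St" if "finite S" "S \<subseteq> I" for S
    using that
  proof (induction S rule: finite_induct)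
    case (insert p S)
    have "\<tau> (single p (lookup \<alpha> p)) \<in> St"
    proof -
      have "0 \<le> lookup \<alpha> p" using \<alpha> unfolding A_def by blast
      then show ?thesis using single[of p "nat (lookup \<alpha> p)"] insert.prems by simp
    qed
    then show ?case using insert by (simp add: add)
  qed (simp add: St_closed)
  then have "\<tau> (of_fun (lookup \<alpha>)) \<in> St" by (simp add: of_fun_def)
  moreover have "of_fun (lookup \<alpha>) = \<alpha>"
    using \<alpha> by (intro poly_mapping_eqI) (auto simp: lookup_of_fun A_def in_keys_iff)
  moreover have "1 \<in> U" using U_Theta[of "\<one>\<^bsub>R\<^esub>"] by (simp add: Theta_hom)
  ultimately have "app (\<tau> \<alpha>) 1 \<in> U" by (simp add: St_def)
  then show ?thesis using app_tau[of \<alpha> 0 1] by simp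
qed

end

section \<open>Bases and their discriminants\<close>

lemma bounded_prod:
  fixes f :: "'i \<Rightarrow> 'a::linordered_ab_group_add \<Rightarrow>\<^sub>0 'b::idom"
  assumes "finite S" "\<And>s x. s \<in> S \<Longrightarrow> lookup (f s) x \<noteq> 0 \<Longrightarrow> x \<le> d s"
  shows "(\<forall>x. lookup (prod f S) x \<noteq> 0 \<longrightarrow> x \<le> sum d S) \<and>
    lookup (prod f S) (sum d S) = (\<Prod>s\<in>S. lookup (f s) (d s))"
  using assms
proof (induction S rule: finite_induct)
  case empty
  then show ?case by (simp add: lookup_one when_def)
next
  case (insert s S)
  then have IH: "(\<forall>x. lookup (prod f S) x \<noteq> 0 \<longrightarrow> x \<le> sum d S) \<and>
    lookup (prod f S) (sum d S) = (\<Prod>s\<in>S. lookup (f s) (d s))" by blast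
  have "lookup (f s * prod f S) x \<noteq> 0 \<Longrightarrow> x \<le> d s + sum d S" for x
    by (rule bounded_mult(1)[of "f s" "d s" "prod f S"]) (use insert.prems IH in auto)
  moreover have "lookup (f s * prod f S) (d s + sum d S) =
      lookup (f s) (d s) * lookup (prod f S) (sum d S)"
    by (rule bounded_mult(2)) (use insert.prems IH in auto)
  ultimately show ?case using insert.hyps IH by simp
qed

text \<open>In a product the extreme exponents add without cancellation. If the product is 1, the
  maxima add up to 0 and so do the minima, which forces maximum and minimum of each factor to
  agree.\<close>

lemma group_algebra_unit:
  fixes f g :: "'a::linordered_ab_group_add \<Rightarrow>\<^sub>0 'b::idom"
  assumes "f * g = 1"
  shows "\<exists>a c. c \<noteq> 0 \<and> f = single a c"
proof -
  have nz: "f \<noteq> 0" "g \<noteq> 0" using assms by auto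
  let ?K = "keys"
  have ne: "?K f \<noteq> {}" "?K g \<noteq> {}" using nz by (auto simp: keys_eq_empty)
  have "leading (Max (?K f)) f" "leading (Max (?K g)) g"
    using ne Max_in[of "?K f"] Max_in[of "?K g"] by (auto simp: leading_def in_keys_iff[symmetric])
  from leading_mult[OF this] have "leading (Max (?K f) + Max (?K g)) (1 :: 'a \<Rightarrow>\<^sub>0 'b)"
    by (simp add: assms)
  then have mx: "Max (?K f) + Max (?K g) = 0" by (simp add: leading_def lookup_one)
  \<comment> \<open>The counterpart of \<open>bounded_mult\<close> for the smallest
    exponents.\<close>
  have "lookup (f * g) (Min (?K f) + Min (?K g)) =
      (\<Sum>x\<in>?K f. if x = Min (?K f) then lookup f x * lookup g (Min (?K g)) else 0)"
    unfolding lookup_mult_group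
  proof (intro sum.cong refl)
    fix x assume x: "x \<in> ?K f"
    have "lookup g (Min (?K f) + Min (?K g) - x) = 0" if "x \<noteq> Min (?K f)"
    proof (rule ccontr)
      assume "lookup g (Min (?K f) + Min (?K g) - x) \<noteq> 0"
      then have "Min (?K g) \<le> Min (?K f) + Min (?K g) - x" by (intro Min_le) (auto simp: in_keys_iff)
      then have "x \<le> Min (?K f)" by (simp add: algebra_simps)
      moreover have "Min (?K f) \<le> x" using x by (intro Min_le) auto
      ultimately show False using that by (metis order.antisym)
    qed
    then show "lookup f x * lookup g (Min (?K f) + Min (?K g) - x) =
        (if x = Min (?K f) then lookup f x * lookup g (Min (?K g)) else 0)" by auto
  qed
  also have "\<dots> \<noteq> 0"
    using Min_in[of "?K f"] Min_in[of "?K g"] ne by (simp add: in_keys_iff)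
  finally have mn: "Min (?K f) + Min (?K g) = 0" by (simp add: assms lookup_one)
  have "Min (?K f) \<le> Max (?K f)" "Min (?K g) \<le> Max (?K g)" using ne by (simp_all add: Max_ge)
  then have "Min (?K f) = Max (?K f)" using mx mn
    by (metis add_less_le_mono nless_le)
  then have eq: "x = Max (?K f)" if "x \<in> ?K f" for x
    using that by (metis Max_ge Min_le order.antisym finite_keys)
  have "f = single (Max (?K f)) (lookup f (Max (?K f)))"
    by (rule poly_mapping_eqI) (use eq in \<open>auto simp: lookup_single when_def in_keys_iff\<close>)
  then show ?thesis using Max_in[of "?K f"] ne by (metis finite_keys in_keys_iff)
qed

text \<open>The rectangular case is needed to compare the ranks of two bases before they are known
  to be equal.\<close>

lemma trace_commute:
  fixes M :: "'a::comm_ring_1 mat"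
  assumes "M \<in> carrier_mat a b" "M' \<in> carrier_mat b a"
  shows "(\<Sum>i<a. (M * M') $$ (i, i)) = (\<Sum>k<b. (M' * M) $$ (k, k))"
proof -
  have "(\<Sum>i<a. (M * M') $$ (i, i)) = (\<Sum>i<a. \<Sum>k<b. M $$ (i, k) * M' $$ (k, i))"
    using assms by (intro sum.cong) (auto simp: scalar_prod_def atLeast0LessThan)
  also have "\<dots> = (\<Sum>k<b. \<Sum>i<a. M' $$ (k, i) * M $$ (i, k))"
    by (subst sum.swap) (simp add: mult.commute)
  also have "\<dots> = (\<Sum>k<b. (M' * M) $$ (k, k))"
    using assms by (intro sum.cong) (auto simp: scalar_prod_def atLeast0LessThan)
  finally show ?thesis .
qed

lemma index_mult_mat_sum:
  "M \<in> carrier_mat a b \<Longrightarrow> M' \<in> carrier_mat b d \<Longrightarrow> i < a \<Longrightarrow> j < d \<Longrightarrow>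
    (M * M') $$ (i, j) = (\<Sum>k<b. M $$ (i, k) * M' $$ (k, j))"
  by (auto simp: scalar_prod_def atLeast0LessThan)

lemma combination_mult_mat:
  fixes M :: "'a::comm_ring_1 mat"
  assumes "M \<in> carrier_mat a b" "M' \<in> carrier_mat b d" "i < a" "\<And>k. k < b \<Longrightarrow> u k = (\<Sum>j<d. M' $$ (k, j) * v j)"
  shows "(\<Sum>k<b. M $$ (i, k) * u k) = (\<Sum>j<d. (M * M') $$ (i, j) * v j)"
proof -
  have "(\<Sum>k<b. M $$ (i, k) * u k) = (\<Sum>k<b. \<Sum>j<d. M $$ (i, k) * M' $$ (k, j) * v j)"
    using assms(4) by (intro sum.cong) (auto simp: sum_distrib_left mult.assoc)
  also have "\<dots> = (\<Sum>j<d. (M * M') $$ (i, j) * v j)"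
    by (subst sum.swap) (use assms(1-3) in \<open>auto simp: index_mult_mat_sum sum_distrib_right simp del: index_mult_mat intro!: sum.cong\<close>)
  finally show ?thesis .
qed

section \<open>Transfer of bases and determinants to the Laurent ring\<close>

context quantum_setup
begin

abbreviation N0 :: nat where "N0 \<equiv> l ^ (m * n)"

definition en :: "nat \<Rightarrow> expo" where "en = (SOME f. bij_betw f {..<N0} A)"

lemma bij_en: "bij_betw en {..<N0} A"
  unfolding en_def using ex_bij_betw_nat_finite[OF card_A(1)] card_A(2)
  by (metis (mono_tags) atLeast0LessThan someI_ex)

lemma en_A: "k < N0 \<Longrightarrow> en k \<in> A"
  using bij_en by (auto simp: bij_betw_def)

lemma en_inj: "j < N0 \<Longrightarrow> k < N0 \<Longrightarrow> en j = en k \<longleftrightarrow> j = k"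
  using bij_en by (auto simp: bij_betw_def inj_on_def)

lemma sum_en: "(\<Sum>k<N0. f (en k)) = (\<Sum>\<alpha>\<in>A. f \<alpha>)"
  by (rule sum.reindex_bij_betw[OF bij_en])

definition ix :: "expo \<Rightarrow> nat" where "ix = the_inv_into {..<N0} en"

lemma ix_en: "k < N0 \<Longrightarrow> ix (en k) = k"
  using bij_en by (simp add: ix_def bij_betw_def the_inv_into_f_f)

lemma
  assumes "\<alpha> \<in> A"
  shows ix_A: "ix \<alpha> < N0" and en_ix: "en (ix \<alpha>) = \<alpha>"
proof -
  obtain k where "k < N0" "\<alpha> = en k" using assms bij_en by (auto simp: bij_betw_def)
  then show "ix \<alpha> < N0" "en (ix \<alpha>) = \<alpha>" by (simp_all add: ix_en)
qed

lemma Theta_finsum: "(\<And>i. i \<in> S \<Longrightarrow> f i \<in> carrier R) \<Longrightarrow> finite S \<Longrightarrow>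
    \<Theta> (\<Oplus>\<^bsub>R\<^esub>i\<in>S. f i) = (\<Sum>i\<in>S. \<Theta> (f i))"
proof (induction S rule: infinite_finite_induct)
  case (insert s S)
  then have "f \<in> S \<rightarrow> carrier R" by auto
  with insert show ?case by (simp add: R.finsum_insert Theta_hom R.finsum_closed)
qed (auto simp: Theta_hom)

lemma Theta_finsum_CC: "(\<And>i. i \<in> S \<Longrightarrow> f i \<in> C) \<Longrightarrow> finite S \<Longrightarrow>
    \<Theta> (\<Oplus>\<^bsub>CC\<^esub>i\<in>S. f i) = (\<Sum>i\<in>S. \<Theta> (f i)) \<and> (\<Oplus>\<^bsub>CC\<^esub>i\<in>S. f i) \<in> C"
proof (induction S rule: infinite_finite_induct)
  case empty
  then show ?case using Theta_CC(4) CC.zero_closed by simp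
next
  case (insert s S)
  then have IH: "\<Theta> (\<Oplus>\<^bsub>CC\<^esub>i\<in>S. f i) = (\<Sum>i\<in>S. \<Theta> (f i))" "(\<Oplus>\<^bsub>CC\<^esub>i\<in>S. f i) \<in> C" by auto
  have f: "f \<in> S \<rightarrow> carrier CC" "f s \<in> carrier CC" using insert by auto
  have "(\<Oplus>\<^bsub>CC\<^esub>i\<in>insert s S. f i) = f s \<oplus>\<^bsub>CC\<^esub> (\<Oplus>\<^bsub>CC\<^esub>i\<in>S. f i)"
    using CC.finsum_insert[OF insert.hyps(1,2) f] .
  then show ?case
    using IH Theta_CC(2)[of "f s" "\<Oplus>\<^bsub>CC\<^esub>i\<in>S. f i"] CC.add.m_closed[of "f s" "\<Oplus>\<^bsub>CC\<^esub>i\<in>S. f i"] insert by simp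
qed simp

lemma Theta_finprod_CC: "(\<And>i. i \<in> S \<Longrightarrow> f i \<in> C) \<Longrightarrow> finite S \<Longrightarrow>
    \<Theta> (\<Otimes>\<^bsub>CC\<^esub>i\<in>S. f i) = (\<Prod>i\<in>S. \<Theta> (f i)) \<and> (\<Otimes>\<^bsub>CC\<^esub>i\<in>S. f i) \<in> C"
proof (induction S rule: infinite_finite_induct)
  case empty
  then show ?case using Theta_CC(3) CC.one_closed by simp
next
  case (insert s S)
  then have IH: "\<Theta> (\<Otimes>\<^bsub>CC\<^esub>i\<in>S. f i) = (\<Prod>i\<in>S. \<Theta> (f i))" "(\<Otimes>\<^bsub>CC\<^esub>i\<in>S. f i) \<in> C" by auto
  have f: "f \<in> S \<rightarrow> carrier CC" "f s \<in> carrier CC" using insert by auto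
  have "(\<Otimes>\<^bsub>CC\<^esub>i\<in>insert s S. f i) = f s \<otimes>\<^bsub>CC\<^esub> (\<Otimes>\<^bsub>CC\<^esub>i\<in>S. f i)"
    using CC.finprod_insert[OF insert.hyps(1,2) f] .
  then show ?case
    using IH Theta_CC(1)[of "f s" "\<Otimes>\<^bsub>CC\<^esub>i\<in>S. f i"] CC.m_closed[of "f s" "\<Otimes>\<^bsub>CC\<^esub>i\<in>S. f i"] insert by simp
qed simp

lemma Theta_sign: "c \<in> C \<Longrightarrow> \<Theta> (add_pow CC (sign p) c) = of_int (sign p) * \<Theta> c \<and> add_pow CC (sign p) c \<in> C"
proof -
  assume c: "c \<in> C"
  have "add_pow CC (1::int) c = c" using c CC.add.int_pow_1[of c] by simp
  moreover have "add_pow CC (-1::int) c = \<ominus>\<^bsub>CC\<^esub> c"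
    using c CC.add.int_pow_neg[of c 1] CC.add.int_pow_1[of c] by simp
  moreover have u: "\<ominus>\<^bsub>CC\<^esub> c \<in> C" using CC.a_inv_closed[of c] c by simp
  moreover have "\<Theta> (\<ominus>\<^bsub>CC\<^esub> c) = - \<Theta> c"
  proof -
    have "\<Theta> (\<ominus>\<^bsub>CC\<^esub> c \<oplus>\<^bsub>CC\<^esub> c) = 0" using c CC.l_neg[of c] Theta_CC(4) by simp
    then show ?thesis using Theta_CC(2)[OF u c] by (simp add: eq_neg_iff_add_eq_0)
  qed
  ultimately show ?thesis using c by (cases p rule: sign_cases) auto
qed

text \<open>On \<open>C\<close> the map \<Theta> is a ring homomorphism, so determinants can be
  taken over the Laurent ring, with multiplicativity and adjugates at hand. Membership in
  \<open>C\<close> is carried along for the final appeal to injectivity.\<close>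

lemma Theta_rdet:
  assumes "\<And>i j. i < N \<Longrightarrow> j < N \<Longrightarrow> F i j \<in> C"
  shows "\<Theta> (rdet CC N F) = det (mat N N (\<lambda>(i, j). \<Theta> (F i j))) \<and> rdet CC N F \<in> C"
proof -
  have p: "\<Theta> (\<Otimes>\<^bsub>CC\<^esub>i\<in>{..<N}. F i (p i)) = (\<Prod>i<N. \<Theta> (F i (p i))) \<and> (\<Otimes>\<^bsub>CC\<^esub>i\<in>{..<N}. F i (p i)) \<in> C"
    if "p permutes {..<N}" for p
    using that permutes_in_image[OF that] by (intro Theta_finprod_CC assms) auto
  let ?g = "\<lambda>p. add_pow CC (sign p) (\<Otimes>\<^bsub>CC\<^esub>i\<in>{..<N}. F i (p i))"
  have g: "\<Theta> (?g p) = of_int (sign p) * (\<Prod>i<N. \<Theta> (F i (p i))) \<and> ?g p \<in> C"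
    if "p permutes {..<N}" for p
    using p[OF that] Theta_sign[of "\<Otimes>\<^bsub>CC\<^esub>i\<in>{..<N}. F i (p i)" p] by simp
  have "\<Theta> (rdet CC N F) = (\<Sum>p\<in>{p. p permutes {..<N}}. \<Theta> (?g p)) \<and> rdet CC N F \<in> C"
    unfolding rdet_def by (rule Theta_finsum_CC) (use g finite_permutations in auto)
  moreover have "(\<Sum>p\<in>{p. p permutes {..<N}}. \<Theta> (?g p)) = det (mat N N (\<lambda>(i, j). \<Theta> (F i j)))"
    unfolding det_def using g permutes_in_image
    by (auto simp: atLeast0LessThan intro!: sum.cong prod.cong)
  ultimately show ?thesis by simp
qed

lemma coords_basis:
  assumes "free_basis R C N y" "s \<in> carrier R"
  shows "\<And>i. i < N \<Longrightarrow> coords R C N y s i \<in> C"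
    and "\<Theta> s = (\<Sum>i<N. \<Theta> (coords R C N y s i) * \<Theta> (y i))"
proof -
  have "\<exists>!c. is_coords R C N y s c" using assms unfolding free_basis_def by blast
  then have "is_coords R C N y s (coords R C N y s)"
    unfolding coords_def by (rule theI')
  then have c: "coords R C N y s \<in> {..<N} \<rightarrow>\<^sub>E C"
    and s: "s = (\<Oplus>\<^bsub>R\<^esub>i\<in>{..<N}. coords R C N y s i \<otimes>\<^bsub>R\<^esub> y i)" by (auto simp: is_coords_def)
  show C: "coords R C N y s i \<in> C" if "i < N" for i using c that by auto
  have y: "y i \<in> carrier R" if "i < N" for i using assms that by (auto simp: free_basis_def)
  have "\<Theta> s = (\<Sum>i<N. \<Theta> (coords R C N y s i \<otimes>\<^bsub>R\<^esub> y i))"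
    using arg_cong[OF s, of \<Theta>] Theta_finsum[of "{..<N}" "\<lambda>i. coords R C N y s i \<otimes>\<^bsub>R\<^esub> y i"]
    by (simp add: C C_carrier y)
  then show "\<Theta> s = (\<Sum>i<N. \<Theta> (coords R C N y s i) * \<Theta> (y i))"
    by (simp add: C Theta_C_mult y)
qed

lemma basis_independent:
  assumes "free_basis R C N y" "\<And>i. i < N \<Longrightarrow> f i \<in> HC" "\<And>i. i < N \<Longrightarrow> g i \<in> HC"
    and "(\<Sum>i<N. f i * \<Theta> (y i)) = (\<Sum>i<N. g i * \<Theta> (y i))" "i < N"
  shows "f i = g i"
proof -
  have y: "y i \<in> carrier R" if "i < N" for i using assms(1) that by (auto simp: free_basis_def)
  have "\<forall>i\<in>{..<N}. \<exists>c\<in>C. f i = \<Theta> c" "\<forall>i\<in>{..<N}. \<exists>c\<in>C. g i = \<Theta> c"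
    using assms(2,3) by (auto simp: HC_def)
  then obtain c d where c: "\<forall>i\<in>{..<N}. c i \<in> C \<and> f i = \<Theta> (c i)" and d: "\<forall>i\<in>{..<N}. d i \<in> C \<and> g i = \<Theta> (d i)"
    by (metis (no_types, lifting))
  have k: "\<Theta> (\<Oplus>\<^bsub>R\<^esub>i\<in>{..<N}. restrict k {..<N} i \<otimes>\<^bsub>R\<^esub> y i) = (\<Sum>i<N. \<Theta> (k i) * \<Theta> (y i)) \<and>
      (\<Oplus>\<^bsub>R\<^esub>i\<in>{..<N}. restrict k {..<N} i \<otimes>\<^bsub>R\<^esub> y i) \<in> carrier R" if "\<forall>i\<in>{..<N}. k i \<in> C" for k
    using that by (subst Theta_finsum) (auto simp: C_carrier y Theta_C_mult intro!: R.finsum_closed)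
  let ?s = "\<Oplus>\<^bsub>R\<^esub>i\<in>{..<N}. restrict c {..<N} i \<otimes>\<^bsub>R\<^esub> y i"
  have "\<Theta> ?s = \<Theta> (\<Oplus>\<^bsub>R\<^esub>i\<in>{..<N}. restrict d {..<N} i \<otimes>\<^bsub>R\<^esub> y i)"
    using k[of c] k[of d] c d assms(4) by simp
  then have "?s = (\<Oplus>\<^bsub>R\<^esub>i\<in>{..<N}. restrict d {..<N} i \<otimes>\<^bsub>R\<^esub> y i)"
    using k[of c] k[of d] c d by (intro Theta_inj) auto
  then have "is_coords R C N y ?s (restrict c {..<N})" "is_coords R C N y ?s (restrict d {..<N})"
    using c d by (auto simp: is_coords_def)
  moreover have "?s \<in> carrier R" using k[of c] c by auto
  ultimately have "restrict c {..<N} = restrict d {..<N}"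
    using assms(1) unfolding free_basis_def by blast
  then have "c i = d i" using assms(5) by (metis lessThan_iff restrict_apply')
  then show ?thesis using c d assms(5) by auto
qed

text \<open>Coordinates exist by \<open>xm_span\<close> and are unique by
  \<open>xm_independent\<close>; both facts are pulled back along the injective \<Theta>.\<close>

lemma free_basis_xm: "free_basis R C N0 (\<lambda>k. xm (en k))"
  unfolding free_basis_def
proof (intro conjI ballI)
  show "(\<lambda>k. xm (en k)) \<in> {..<N0} \<rightarrow> carrier R" by (simp add: xm_carrier)
  fix s assume s: "s \<in> carrier R"
  have ik: "is_coords R C N0 (\<lambda>k. xm (en k)) s k \<longleftrightarrow>
      k \<in> {..<N0} \<rightarrow>\<^sub>E C \<and> \<Theta> s = (\<Sum>i<N0. \<Theta> (k i) * \<Theta> (xm (en i)))" for k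
  proof -
    have F: "\<Theta> (\<Oplus>\<^bsub>R\<^esub>i\<in>{..<N0}. k i \<otimes>\<^bsub>R\<^esub> xm (en i)) = (\<Sum>i<N0. \<Theta> (k i) * \<Theta> (xm (en i))) \<and>
       (\<Oplus>\<^bsub>R\<^esub>i\<in>{..<N0}. k i \<otimes>\<^bsub>R\<^esub> xm (en i)) \<in> carrier R" if k: "k \<in> {..<N0} \<rightarrow>\<^sub>E C"
    proof -
      have "k i \<in> C" if "i < N0" for i using k that by auto
      then show ?thesis
        by (subst Theta_finsum) (auto simp: C_carrier xm_carrier Theta_C_mult intro!: R.finsum_closed)
    qed
    show ?thesis unfolding is_coords_def
    proof (rule conj_cong[OF refl])
      assume k: "k \<in> {..<N0} \<rightarrow>\<^sub>E C"
      show "(s = (\<Oplus>\<^bsub>R\<^esub>i\<in>{..<N0}. k i \<otimes>\<^bsub>R\<^esub> xm (en i))) \<longleftrightarrow>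
          (\<Theta> s = (\<Sum>i<N0. \<Theta> (k i) * \<Theta> (xm (en i))))" (is "s = ?F \<longleftrightarrow> _ = ?G")
      proof
        assume "s = ?F"
        then show "\<Theta> s = ?G" using F[OF k] by (simp only:)
      next
        assume "\<Theta> s = ?G"
        then show "s = ?F" using F[OF k] by (intro Theta_inj s) simp_all
      qed
    qed
  qed
  obtain f where f: "\<forall>\<alpha>\<in>A. f \<alpha> \<in> HC" "\<Theta> s = (\<Sum>\<alpha>\<in>A. f \<alpha> * \<Theta> (xm \<alpha>))" using xm_span[OF s] by blast
  then obtain c where c: "\<forall>\<alpha>\<in>A. c \<alpha> \<in> C \<and> f \<alpha> = \<Theta> (c \<alpha>)" unfolding HC_def image_iff by metis
  show "\<exists>!c. is_coords R C N0 (\<lambda>k. xm (en k)) s c"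
  proof (rule ex1I[of _ "restrict (\<lambda>k. c (en k)) {..<N0}"])
    show "is_coords R C N0 (\<lambda>k. xm (en k)) s (restrict (\<lambda>k. c (en k)) {..<N0})"
      unfolding ik f(2) sum_en[of "\<lambda>\<alpha>. f \<alpha> * \<Theta> (xm \<alpha>)", symmetric] using c en_A by (auto intro!: sum.cong)
    fix d assume "is_coords R C N0 (\<lambda>k. xm (en k)) s d"
    then have d: "d \<in> {..<N0} \<rightarrow>\<^sub>E C" "\<Theta> s = (\<Sum>i<N0. \<Theta> (d i) * \<Theta> (xm (en i)))" unfolding ik by auto
    have dC: "d k \<in> C" if "k < N0" for k using d that by auto
    have "\<Theta> s = (\<Sum>\<alpha>\<in>A. \<Theta> (d (ix \<alpha>)) * \<Theta> (xm \<alpha>))"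
      unfolding d(2) sum_en[symmetric] by (intro sum.cong) (auto simp: ix_en)
    then have z: "(\<Sum>\<alpha>\<in>A. (f \<alpha> - \<Theta> (d (ix \<alpha>))) * \<Theta> (xm \<alpha>)) = 0"
      using f(2) by (simp add: left_diff_distrib sum_subtractf)
    have "f \<alpha> - \<Theta> (d (ix \<alpha>)) = 0" if "\<alpha> \<in> A" for \<alpha>
    proof (rule xm_independent[OF _ z that])
      fix \<nu> assume "\<nu> \<in> A"
      then show "f \<nu> - \<Theta> (d (ix \<nu>)) \<in> Z"
        using Z_closed(3)[OF HC_Z[of "f \<nu>"] Z_closed(5)[OF Theta_C_Z[OF dC[OF ix_A]]], of \<nu>] f(1) by simp
    qed
    then have "\<Theta> (c (en k)) = \<Theta> (d k)" if "k < N0" for k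
      using c en_A[OF that] ix_en[OF that] by (metis eq_iff_diff_eq_0)
    then have "c (en k) = d k" if "k < N0" for k
      using that c en_A dC by (intro Theta_inj) (auto simp: C_carrier)
    then show "d = restrict (\<lambda>k. c (en k)) {..<N0}"
      using d(1) by (auto simp: fun_eq_iff PiE_def extensional_def)
  qed
qed

lemma basis_change:
  assumes "free_basis R C N y" "free_basis R C N' x"
  shows "\<exists>M\<in>carrier_mat N N'. (\<forall>i<N. \<forall>k<N'. M $$ (i, k) \<in> HC) \<and>
    (\<forall>i<N. \<Theta> (y i) = (\<Sum>k<N'. M $$ (i, k) * \<Theta> (x k)))"
proof (intro bexI[of _ "mat N N' (\<lambda>(i, k). \<Theta> (coords R C N' x (y i) k))"] conjI allI impI)
  fix i assume i: "i < N"
  then have y: "y i \<in> carrier R" using assms(1) by (auto simp: free_basis_def)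
  show "\<Theta> (y i) = (\<Sum>k<N'. mat N N' (\<lambda>(i, k). \<Theta> (coords R C N' x (y i) k)) $$ (i, k) * \<Theta> (x k))"
    using coords_basis(2)[OF assms(2) y] i by simp
  show "mat N N' (\<lambda>(i, k). \<Theta> (coords R C N' x (y i) k)) $$ (i, k) \<in> HC" if "k < N'" for k
    using coords_basis(1)[OF assms(2) y] i that by (auto simp: HC_def)
qed simp

lemma basis_change_inverse:
  assumes "free_basis R C N y"
    and "M \<in> carrier_mat N N'" "\<forall>i<N. \<forall>k<N'. M $$ (i, k) \<in> HC" "\<forall>i<N. \<Theta> (y i) = (\<Sum>k<N'. M $$ (i, k) * \<Theta> (x k))"
    and "M' \<in> carrier_mat N' N" "\<forall>i<N'. \<forall>k<N. M' $$ (i, k) \<in> HC" "\<forall>i<N'. \<Theta> (x i) = (\<Sum>k<N. M' $$ (i, k) * \<Theta> (y k))"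
  shows "M * M' = 1\<^sub>m N"
proof (rule eq_matI)
  fix i j assume "i < dim_row (1\<^sub>m N :: 'k torus mat)" "j < dim_col (1\<^sub>m N :: 'k torus mat)"
  then have ij: "i < N" "j < N" by auto
  have "\<Theta> (y i) = (\<Sum>k<N'. M $$ (i, k) * \<Theta> (x k))" using assms(4) ij(1) by blast
  also have "\<dots> = (\<Sum>j<N. (M * M') $$ (i, j) * \<Theta> (y j))"
    by (rule combination_mult_mat[OF assms(2,5) ij(1)]) (use assms(7) in blast)
  finally have "\<Theta> (y i) = (\<Sum>j<N. (M * M') $$ (i, j) * \<Theta> (y j))" .
  moreover have "\<Theta> (y i) = (\<Sum>j<N. (if i = j then 1 else 0) * \<Theta> (y j))"
    using ij(1) by (simp add: if_distrib[of "\<lambda>u. u * _"] sum.delta cong: if_cong)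
  moreover have "(M * M') $$ (i, j) \<in> HC" if "j < N" for j
    unfolding index_mult_mat_sum[OF assms(2,5) ij(1) that] using assms(3,6) ij that
    by (intro HC_sum HC_closed) auto
  ultimately have "(M * M') $$ (i, j) = (if i = j then 1 else 0)"
    by (intro basis_independent[OF assms(1), of "\<lambda>j. (M * M') $$ (i, j)" "\<lambda>j. if i = j then 1 else 0"])
      (auto simp: HC_closed ij simp del: index_mult_mat)
  then show "(M * M') $$ (i, j) = 1\<^sub>m N $$ (i, j)" using ij by simp
qed (use assms in auto)

text \<open>
  A unit of the Laurent ring is a monomial, and elements of \<open>HC\<close> have nonnegative leading exponents.
\<close>

lemma HC_unit:
  assumes "f \<in> HC" "g \<in> HC" "f * g = 1"
  shows "\<exists>c. c \<noteq> 0 \<and> f = cst c"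
proof -
  have lead: "\<exists>a. leading a f \<and> (\<forall>p. 0 \<le> lookup a p)" if f: "f \<in> HC" "f \<noteq> 0" for f
  proof -
    obtain c where "c \<in> C" "f = \<Theta> c" using f(1) by (auto simp: HC_def)
    then show ?thesis using Theta_leading[of c] f(2) Theta_hom(3) C_carrier by auto
  qed
  obtain a c where f: "c \<noteq> 0" "f = single a c" using group_algebra_unit[OF assms(3)] by blast
  have nz: "f \<noteq> 0" "g \<noteq> 0" using assms by auto
  obtain b where b: "leading b f" "\<forall>p. 0 \<le> lookup b p" using lead[OF assms(1) nz(1)] by blast
  obtain d where d: "leading d g" "\<forall>p. 0 \<le> lookup d p" using lead[OF assms(2) nz(2)] by blast
  have "leading (b + d) (1 :: 'k torus)" using leading_mult[OF b(1) d(1)] assms(3) by simp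
  then have "b + d = 0" by (simp add: leading_def lookup_one)
  then have "lookup b p + lookup d p = 0" for p
    by (metis lookup_add lookup_zero)
  then have "lookup b p = 0" for p using b(2) d(2) by (metis add_nonneg_eq_0_iff)
  then have "b = 0" by (intro poly_mapping_eqI) simp
  moreover have "a = b" using b(1) f leading_single[of c a] leading_unique by blast
  ultimately show ?thesis using f by auto
qed

lemma HC_sign: "f \<in> HC \<Longrightarrow> of_int (sign p) * f \<in> HC"
proof -
  assume f: "f \<in> HC"
  have "- 1 * f \<in> HC" using HC_closed(4)[OF HC_closed(5)[of "-1"] f] by (simp add: single_uminus)
  then show ?thesis using f by (cases p rule: sign_cases) auto
qed

lemma HC_det:
  assumes "M \<in> carrier_mat N N" "\<forall>i<N. \<forall>k<N. M $$ (i, k) \<in> HC"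
  shows "det M \<in> HC"
proof -
  have pr: "prod f S \<in> HC" if "\<And>s. s \<in> S \<Longrightarrow> f s \<in> HC" for f :: "nat \<Rightarrow> 'k torus" and S
    using that by (induction S rule: infinite_finite_induct) (auto intro: HC_closed)
  show ?thesis unfolding det_def'[OF assms(1)]
  proof (intro HC_sum HC_sign pr)
    fix p i assume "p \<in> {p. p permutes {0..<N}}" "i \<in> {0..<N}"
    then show "M $$ (i, p i) \<in> HC" using assms(2) permutes_in_image[of p "{0..<N}" i] by auto
  qed
qed

section \<open>From standard monomials to torus monomials\<close>

definition PX :: "'k torus mat" where
  "PX = mat N0 N0 (\<lambda>(i, k). coef (\<Theta> (xm (en i))) (en k))"

lemma PX_carrier [simp]: "PX \<in> carrier_mat N0 N0" by (simp add: PX_def)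

lemma PX_dim [simp]: "dim_row PX = N0" "dim_col PX = N0" by (simp_all add: PX_def)

lemma en_expand: "f = (\<Sum>k<N0. coef f (en k) * tmon (en k))"
  using coef_expand[of f] sum_en[of "\<lambda>\<alpha>. coef f \<alpha> * tmon \<alpha>"] by simp

lemma en_unique:
  assumes "\<And>k. k < N0 \<Longrightarrow> f k \<in> Z" "\<And>k. k < N0 \<Longrightarrow> g k \<in> Z"
    and "(\<Sum>k<N0. f k * tmon (en k)) = (\<Sum>k<N0. g k * tmon (en k))" "j < N0"
  shows "f j = g j"
proof -
  have *: "coef (\<Sum>k<N0. f k * tmon (en k)) (en j) = f j" if "\<And>k. k < N0 \<Longrightarrow> f k \<in> Z" for f
  proof -
    have "(\<Sum>k<N0. f k * tmon (en k)) = (\<Sum>k<N0. f (ix (en k)) * tmon (en k))"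
      by (intro sum.cong) (auto simp: ix_en)
    also have "\<dots> = (\<Sum>\<alpha>\<in>A. f (ix \<alpha>) * tmon \<alpha>)" by (rule sum_en)
    finally show ?thesis
      using coef_combination[of "\<lambda>\<alpha>. f (ix \<alpha>)" "en j"] ix_A that en_A[OF assms(4)] ix_en[OF assms(4)] by simp
  qed
  show ?thesis using *[of f] *[of g] assms(1-3) by simp
qed

lemma tmon_X_matrix:
  "\<exists>Y\<in>carrier_mat N0 N0. (\<forall>i<N0. \<forall>k<N0. Y $$ (i, k) \<in> Z) \<and>
    (\<forall>i<N0. tmon (en i) = (\<Sum>k<N0. Y $$ (i, k) * \<Theta> (xm (en k))))"
proof -
  have "\<forall>i\<in>{..<N0}. \<exists>g. (\<forall>\<alpha>\<in>A. g \<alpha> \<in> Z) \<and> tmon (en i) = (\<Sum>\<alpha>\<in>A. g \<alpha> * \<Theta> (xm \<alpha>))"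
    using tmon_U en_A by (fastforce simp: U_def)
  from bchoice[OF this] obtain g where "\<forall>i\<in>{..<N0}. (\<forall>\<alpha>\<in>A. g i \<alpha> \<in> Z) \<and>
      tmon (en i) = (\<Sum>\<alpha>\<in>A. g i \<alpha> * \<Theta> (xm \<alpha>))" by blast
  then have g: "(\<forall>\<alpha>\<in>A. g i \<alpha> \<in> Z) \<and> tmon (en i) = (\<Sum>\<alpha>\<in>A. g i \<alpha> * \<Theta> (xm \<alpha>))" if "i < N0" for i
    using that by blast
  show ?thesis
  proof (intro bexI[of _ "mat N0 N0 (\<lambda>(i, k). g i (en k))"] conjI allI impI)
    fix i assume i: "i < N0"
    show "tmon (en i) = (\<Sum>k<N0. mat N0 N0 (\<lambda>(i, k). g i (en k)) $$ (i, k) * \<Theta> (xm (en k)))"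
      using g[OF i] sum_en[of "\<lambda>\<alpha>. g i \<alpha> * \<Theta> (xm \<alpha>)"] i by simp
  qed (use g en_A in auto)
qed

lemma lookup_sign: "lookup (of_int (sign p) * (f :: 'k torus)) k = of_int (sign p) * lookup f k"
  by (cases p rule: sign_cases) auto

text \<open>
  The determinant is a unit of the Laurent ring, hence a monomial; its coefficient at the exponent
  \<open>0\<close> is not zero, because only the identity permutation contributes to it.
\<close>

lemma det_PX: "\<exists>c. c \<noteq> 0 \<and> det PX = cst c"
proof -
  obtain Y where Y: "Y \<in> carrier_mat N0 N0" "\<forall>i<N0. \<forall>k<N0. Y $$ (i, k) \<in> Z"
    "\<forall>i<N0. tmon (en i) = (\<Sum>k<N0. Y $$ (i, k) * \<Theta> (xm (en k)))" using tmon_X_matrix by blast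
  have X: "\<Theta> (xm (en i)) = (\<Sum>k<N0. PX $$ (i, k) * tmon (en k))" if "i < N0" for i
    using en_expand[of "\<Theta> (xm (en i))"] that by (simp add: PX_def)
  have PZ: "PX $$ (i, k) \<in> Z" if "i < N0" "k < N0" for i k using that by (simp add: PX_def coef_Z)
  have "Y * PX = 1\<^sub>m N0"
  proof (rule eq_matI)
    fix i j assume "i < dim_row (1\<^sub>m N0 :: 'k torus mat)" "j < dim_col (1\<^sub>m N0 :: 'k torus mat)"
    then have ij: "i < N0" "j < N0" by auto
    have "tmon (en i) = (\<Sum>k<N0. Y $$ (i, k) * \<Theta> (xm (en k)))" using Y(3) ij(1) by blast
    also have "\<dots> = (\<Sum>j<N0. (Y * PX) $$ (i, j) * tmon (en j))"
      by (rule combination_mult_mat[OF Y(1) PX_carrier ij(1)]) (rule X)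
    finally have "tmon (en i) = (\<Sum>j<N0. (Y * PX) $$ (i, j) * tmon (en j))" .
    moreover have "tmon (en i) = (\<Sum>j<N0. (if i = j then 1 else 0) * (tmon (en j) :: 'k torus))"
      using ij(1) by (simp add: if_distrib[of "\<lambda>u. u * _"] sum.delta cong: if_cong)
    moreover have "(Y * PX) $$ (i, j) \<in> Z" if "j < N0" for j
      unfolding index_mult_mat_sum[OF Y(1) PX_carrier ij(1) that] using Y(2) PZ ij that
      by (intro Z_sum Z_closed) auto
    ultimately have "(Y * PX) $$ (i, j) = (if i = j then 1 else 0)"
      by (intro en_unique[of "\<lambda>j. (Y * PX) $$ (i, j)" "\<lambda>j. if i = j then 1 else 0"])
        (auto simp: Z_closed ij simp del: index_mult_mat)
    then show "(Y * PX) $$ (i, j) = 1\<^sub>m N0 $$ (i, j)" using ij by simp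
  qed (use Y in auto)
  then have "det PX * det Y = 1" using det_mult[OF Y(1) PX_carrier] by (simp add: mult.commute)
  then obtain a c where ac: "c \<noteq> 0" "det PX = single a c" using group_algebra_unit by blast
  have lk: "lookup (PX $$ (i, k)) x = (lookup (\<Theta> (xm (en i))) (x + en k) when x \<in> Lat)"
    if "i < N0" "k < N0" for i k x using that by (simp add: PX_def lookup_coef)
  have lead: "leading (en i) (\<Theta> (xm (en i)))" if "i < N0" for i by (rule leading_xm[OF en_A[OF that]])
  \<comment> \<open>Exponents in entry (i, k) are at most \<open>en i - en k\<close>, and along a
    permutation these bounds add up to 0. So the coefficient at 0 is the product of the coefficients
    at the bounds, and a bound lies in \<open>Lat\<close> only if the permutation fixes
    \<open>i\<close>.\<close>
  have tm: "lookup (\<Prod>i = 0..<N0. PX $$ (i, p i)) 0 =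
      (if p = id then \<Prod>i = 0..<N0. lookup (\<Theta> (xm (en i))) (en i) else 0)"
    if p: "p permutes {0..<N0}" for p
  proof -
    have pi: "p i < N0" if "i < N0" for i using permutes_in_image[OF p, of i] that by simp
    have bd: "x \<le> en i - en (p i)" if "i \<in> {0..<N0}" "lookup (PX $$ (i, p i)) x \<noteq> 0" for i x
    proof -
      have i: "i < N0" using that by simp
      have "lookup (\<Theta> (xm (en i))) (x + en (p i)) \<noteq> 0"
        using that lk[OF i pi[OF i]] by (auto simp: when_def split: if_splits)
      then have "x + en (p i) \<le> en i" using lead[OF i] by (auto simp: leading_def)
      then show ?thesis by (simp add: algebra_simps)
    qed
    have "(\<Sum>i = 0..<N0. en (p i)) = (\<Sum>i = 0..<N0. en i)"
      using sum.permute[OF p, of en] by (simp add: comp_def)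
    then have "(\<Sum>i = 0..<N0. en i - en (p i)) = 0" by (simp add: sum_subtractf)
    then have "lookup (\<Prod>i = 0..<N0. PX $$ (i, p i)) 0 =
        (\<Prod>i = 0..<N0. lookup (PX $$ (i, p i)) (en i - en (p i)))"
      using bounded_prod[of "{0..<N0}" "\<lambda>i. PX $$ (i, p i)" "\<lambda>i. en i - en (p i)"] bd by auto
    also have "\<dots> = (if p = id then \<Prod>i = 0..<N0. lookup (\<Theta> (xm (en i))) (en i) else 0)"
    proof (cases "p = id")
      case True
      then show ?thesis by (auto simp: lk Lat_closed intro!: prod.cong)
    next
      case False
      then obtain i where i: "i < N0" "p i \<noteq> i"
        using p by (metis atLeastLessThan_iff eq_id_iff permutes_not_in zero_le)
      have "en i - en (p i) \<notin> Lat"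
        using A_Lat_inj[OF en_A[OF i(1)] en_A[OF pi[OF i(1)]]] en_inj[OF i(1) pi[OF i(1)]] i(2) by auto
      then have "lookup (PX $$ (i, p i)) (en i - en (p i)) = 0"
        by (simp add: lk[OF i(1) pi[OF i(1)]])
      then show ?thesis using False i(1) by (auto intro!: prod_zero)
    qed
    finally show ?thesis .
  qed
  have "lookup (det PX) 0 =
      (\<Sum>p\<in>{p. p permutes {0..<N0}}. of_int (sign p) * lookup (\<Prod>i = 0..<N0. PX $$ (i, p i)) 0)"
    by (simp add: det_def'[OF PX_carrier] lookup_sum lookup_sign)
  also have "\<dots> = (\<Sum>p\<in>{p. p permutes {0..<N0}}.
      if p = id then \<Prod>i = 0..<N0. lookup (\<Theta> (xm (en i))) (en i) else 0)"
    by (intro sum.cong) (auto simp: tm sign_id)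
  also have "\<dots> = (\<Prod>i = 0..<N0. lookup (\<Theta> (xm (en i))) (en i))"
    by (simp add: finite_permutations permutes_id)
  also have "\<dots> \<noteq> 0" using lead by (auto simp: leading_def)
  finally have "a = 0" using ac by (auto simp: lookup_single when_def split: if_splits)
  then show ?thesis using ac by auto
qed

text \<open>Two bases are related by mutually inverse matrices over \<open>HC\<close>. The traces of
  the two products give equal ranks, as the characteristic is 0; the determinant is then a scalar by
  \<open>HC_unit\<close>, and \<open>det_PX\<close> carries this over to the torus
  monomials.\<close>

lemma basis_torus:
  assumes "free_basis R C N y"
  shows "N = N0" "\<exists>W\<in>carrier_mat N0 N0. (\<forall>i<N0. \<forall>k<N0. W $$ (i, k) \<in> Z) \<and>
    (\<forall>i<N0. \<Theta> (y i) = (\<Sum>k<N0. W $$ (i, k) * tmon (en k))) \<and> (\<exists>c. c \<noteq> 0 \<and> det W = cst c)"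
proof -
  let ?x = "\<lambda>k. xm (en k)"
  obtain M where M: "M \<in> carrier_mat N N0" "\<forall>i<N. \<forall>k<N0. M $$ (i, k) \<in> HC"
    "\<forall>i<N. \<Theta> (y i) = (\<Sum>k<N0. M $$ (i, k) * \<Theta> (?x k))"
    using basis_change[OF assms free_basis_xm] by blast
  obtain M' where M': "M' \<in> carrier_mat N0 N" "\<forall>i<N0. \<forall>k<N. M' $$ (i, k) \<in> HC"
    "\<forall>i<N0. \<Theta> (?x i) = (\<Sum>k<N. M' $$ (i, k) * \<Theta> (y k))"
    using basis_change[OF free_basis_xm assms] by blast
  have MM': "M * M' = 1\<^sub>m N" by (rule basis_change_inverse[OF assms M M'])
  have M'M: "M' * M = 1\<^sub>m N0" by (rule basis_change_inverse[OF free_basis_xm M' M])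
  have "of_nat N = (of_nat N0 :: 'k torus)"
    using trace_commute[OF M(1) M'(1)] by (simp add: MM' M'M)
  then show N: "N = N0" by (simp only: of_nat_eq_iff)
  have "det M * det M' = 1" using det_mult[of M N0 M'] M M' MM' N by simp
  moreover have "det M \<in> HC" "det M' \<in> HC" using M M' N by (auto intro!: HC_det)
  ultimately obtain c where c: "c \<noteq> 0" "det M = cst c" using HC_unit by blast
  obtain d where d: "d \<noteq> 0" "det PX = cst d" using det_PX by blast
  have M0: "M \<in> carrier_mat N0 N0" using M N by simp
  show "\<exists>W\<in>carrier_mat N0 N0. (\<forall>i<N0. \<forall>k<N0. W $$ (i, k) \<in> Z) \<and>
    (\<forall>i<N0. \<Theta> (y i) = (\<Sum>k<N0. W $$ (i, k) * tmon (en k))) \<and> (\<exists>c. c \<noteq> 0 \<and> det W = cst c)"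
  proof (intro bexI[of _ "M * PX"] conjI allI impI)
    show "M * PX \<in> carrier_mat N0 N0" using M0 by simp
    fix i assume i: "i < N0"
    show "(M * PX) $$ (i, k) \<in> Z" if "k < N0" for k
    proof -
      have "M $$ (i, j) \<in> Z" "PX $$ (j, k) \<in> Z" if "j < N0" for j
        using M(2) N i \<open>k < N0\<close> that by (auto simp: PX_def coef_Z intro!: HC_Z)
      then show ?thesis
        unfolding index_mult_mat_sum[OF M0 PX_carrier i that] by (intro Z_sum Z_closed) auto
    qed
    have X: "\<Theta> (?x k) = (\<Sum>j<N0. PX $$ (k, j) * tmon (en j))" if "k < N0" for k
      using en_expand[of "\<Theta> (?x k)"] that by (simp add: PX_def)
    have "\<Theta> (y i) = (\<Sum>k<N0. M $$ (i, k) * \<Theta> (?x k))" using M(3) N i by blast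
    also have "\<dots> = (\<Sum>k<N0. (M * PX) $$ (i, k) * tmon (en k))"
      by (rule combination_mult_mat[OF M0 PX_carrier i]) (rule X)
    finally show "\<Theta> (y i) = (\<Sum>k<N0. (M * PX) $$ (i, k) * tmon (en k))" .
  next
    show "\<exists>c. c \<noteq> 0 \<and> det (M * PX) = cst c"
      using det_mult[OF M0 PX_carrier] c d by (intro exI[of _ "c * d"]) (simp add: cst_mult)
  qed
qed

end

lemma det_monomial_matrix:
  fixes G :: "'a::comm_ring_1 mat"
  assumes "G \<in> carrier_mat N N" "\<sigma> permutes {0..<N}"
    and "\<And>i j. i < N \<Longrightarrow> j < N \<Longrightarrow> j \<noteq> \<sigma> i \<Longrightarrow> G $$ (i, j) = 0"
  shows "det G = of_int (sign \<sigma>) * (\<Prod>i = 0..<N. G $$ (i, \<sigma> i))"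
proof -
  have "det G = (\<Sum>p\<in>{\<sigma>}. of_int (sign p) * (\<Prod>i = 0..<N. G $$ (i, p i)))"
    unfolding det_def'[OF assms(1)]
  proof (rule sum.mono_neutral_right)
    show "\<forall>p\<in>{p. p permutes {0..<N}} - {\<sigma>}. of_int (sign p) * (\<Prod>i = 0..<N. G $$ (i, p i)) = 0"
    proof
      fix p assume p: "p \<in> {p. p permutes {0..<N}} - {\<sigma>}"
      then obtain i where i: "p i \<noteq> \<sigma> i" by auto
      then have iN: "i < N" using p assms(2) by (metis Diff_iff atLeastLessThan_iff mem_Collect_eq permutes_not_in zero_le)
      then have "p i < N" using p permutes_in_image[of p "{0..<N}" i] by simp
      then have "G $$ (i, p i) = 0" using assms(3) iN i by blast
      then have "(\<Prod>i = 0..<N. G $$ (i, p i)) = 0" using iN by (intro prod_zero) auto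
      then show "of_int (sign p) * (\<Prod>i = 0..<N. G $$ (i, p i)) = 0" by simp
    qed
  qed (use assms(2) finite_permutations in auto)
  then show ?thesis by simp
qed

lemma prod_single: "(\<Prod>s\<in>S. single (a s) (c s)) = cst (\<Prod>s\<in>S. c s) * tmon (\<Sum>s\<in>S. a s)"
  by (induction S rule: infinite_finite_induct) (auto simp: mult_single)

lemma single_power: "(single a c :: 'k::field torus) ^ k = single ((\<Sum>i<k. a)) (c ^ k)"
  by (induction k) (auto simp: mult_single add.commute)

section \<open>The regular trace and the Gram determinant\<close>

context quantum_setup
begin

lemma N0_nz: "(of_nat N0 :: 'k) \<noteq> 0"
  using l_pos by simp

text \<open>Through \<open>W\<close> the matrix of left multiplication is conjugate to the one in
  torus monomials, where every diagonal entry is the part of \<open>\<Theta> s\<close> with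
  exponents in \<open>Lat\<close>. In particular the choice of \<open>b\<close> does not affect the
  trace.\<close>

lemma Theta_reg_trace:
  assumes b: "free_basis R C N b" and s: "s \<in> carrier R"
  shows "\<Theta> (reg_trace R C N b s) = of_nat N0 * proj (\<Theta> s) \<and> reg_trace R C N b s \<in> C"
proof -
  have N: "N = N0" by (rule basis_torus(1)[OF b])
  obtain W c where W: "W \<in> carrier_mat N0 N0" "\<forall>i<N0. \<forall>k<N0. W $$ (i, k) \<in> Z"
    "\<forall>i<N0. \<Theta> (b i) = (\<Sum>k<N0. W $$ (i, k) * tmon (en k))" "c \<noteq> 0" "det W = cst c"
    using basis_torus(2)[OF b] by blast
  have bi: "b i \<in> carrier R" if "i < N0" for i using b that N by (auto simp: free_basis_def)
  have sb: "s \<otimes>\<^bsub>R\<^esub> b j \<in> carrier R" if "j < N0" for j using s bi[OF that] by simp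
  let ?k = "\<lambda>i j. coords R C N b (s \<otimes>\<^bsub>R\<^esub> b j) i"
  have kC: "?k i j \<in> C" if "i < N0" "j < N0" for i j using coords_basis(1)[OF b sb] that N by simp
  have tr: "\<Theta> (reg_trace R C N b s) = (\<Sum>i<N0. \<Theta> (?k i i)) \<and> reg_trace R C N b s \<in> C"
    unfolding reg_trace_def left_mult_matrix_def N[symmetric] by (rule Theta_finsum_CC) (use kC N in auto)
  \<comment> \<open>Transposed: rows belong to the products with basis elements, so that coordinate
    rows multiply matrices from the left. The trace is the same.\<close>
  define D where "D = mat N0 N0 (\<lambda>(j, i). \<Theta> (?k i j))"
  define S where "S = mat N0 N0 (\<lambda>(k, r). coef (app (h s) (tmon (en k))) (en r))"
  have D: "D \<in> carrier_mat N0 N0" and S: "S \<in> carrier_mat N0 N0" by (simp_all add: D_def S_def)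
  have hs: "h s \<in> centralizer" by (rule h_centralizer[OF s])
  have WS: "W * S = D * W"
  proof (rule eq_matI)
    fix j r assume "j < dim_row (D * W)" "r < dim_col (D * W)"
    then have jr: "j < N0" "r < N0" using D W by auto
    have Sk: "app (h s) (tmon (en k)) = (\<Sum>r<N0. S $$ (k, r) * tmon (en r))" if "k < N0" for k
      using en_expand[of "app (h s) (tmon (en k))"] that by (simp add: S_def)
    have "\<Theta> (s \<otimes>\<^bsub>R\<^esub> b j) = app (h s) (\<Sum>k<N0. W $$ (j, k) * tmon (en k))"
      using Theta_hom(1)[OF s bi[OF jr(1)]] W(3) jr(1) by simp
    also have "\<dots> = (\<Sum>k<N0. W $$ (j, k) * app (h s) (tmon (en k)))"
      using W(2) jr(1) by (auto simp: app_sum centralizer_Z_linear[OF hs] intro!: sum.cong)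
    also have "\<dots> = (\<Sum>r<N0. (W * S) $$ (j, r) * tmon (en r))"
      by (rule combination_mult_mat[OF W(1) S jr(1) Sk])
    finally have 1: "\<Theta> (s \<otimes>\<^bsub>R\<^esub> b j) = (\<Sum>r<N0. (W * S) $$ (j, r) * tmon (en r))" .
    have "\<Theta> (s \<otimes>\<^bsub>R\<^esub> b j) = (\<Sum>i<N0. D $$ (j, i) * \<Theta> (b i))"
      using coords_basis(2)[OF b sb[OF jr(1)]] jr(1) N by (simp add: D_def)
    also have "\<dots> = (\<Sum>r<N0. (D * W) $$ (j, r) * tmon (en r))"
      by (rule combination_mult_mat[OF D W(1) jr(1)]) (use W(3) in blast)
    finally have 2: "(\<Sum>r<N0. (W * S) $$ (j, r) * tmon (en r)) = (\<Sum>r<N0. (D * W) $$ (j, r) * tmon (en r))"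
      using 1 by simp
    show "(W * S) $$ (j, r) = (D * W) $$ (j, r)"
    proof (rule en_unique[OF _ _ 2 jr(2)])
      fix r assume r: "r < N0"
      show "(W * S) $$ (j, r) \<in> Z"
        unfolding index_mult_mat_sum[OF W(1) S jr(1) r]
        by (intro Z_sum Z_closed(4)) (use W(2) jr r in \<open>auto simp: S_def coef_Z\<close>)
      show "(D * W) $$ (j, r) \<in> Z"
        unfolding index_mult_mat_sum[OF D W(1) jr(1) r]
        by (intro Z_sum Z_closed(4)) (use W(2) jr r kC in \<open>auto simp: D_def Theta_C_Z\<close>)
    qed
  qed (use W D S in auto)
  \<comment> \<open>Since \<open>det W\<close> is a nonzero scalar, the rescaled adjugate is a
    two-sided inverse.\<close>
  define V where "V = cst (inverse c) \<cdot>\<^sub>m adj_mat W"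
  have V: "V \<in> carrier_mat N0 N0" using adj_mat(1)[OF W(1)] by (simp add: V_def)
  have unit: "cst (inverse c) * cst c = (1 :: 'k torus)" using W(4) by (simp add: mult_single)
  have WV: "W * V = 1\<^sub>m N0"
    unfolding V_def mult_smult_distrib[OF W(1) adj_mat(1)[OF W(1)]] adj_mat(2)[OF W(1)] W(5)
    using unit by (intro eq_matI) (auto simp: mult.assoc[symmetric])
  have VW: "V * W = 1\<^sub>m N0"
    unfolding V_def mult_smult_assoc_mat[OF adj_mat(1)[OF W(1)] W(1)] adj_mat(3)[OF W(1)] W(5)
    using unit by (intro eq_matI) (auto simp: mult.assoc[symmetric])
  have "D = D * (W * V)" using D by (simp add: WV)
  also have "\<dots> = W * (S * V)"
    using assoc_mult_mat[OF D W(1) V] assoc_mult_mat[OF W(1) S V] WS by simp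
  finally have "(\<Sum>i<N0. D $$ (i, i)) = (\<Sum>i<N0. (W * (S * V)) $$ (i, i))" by simp
  also have "\<dots> = (\<Sum>i<N0. (S * V * W) $$ (i, i))"
    using trace_commute[OF W(1) mult_carrier_mat[OF S V]] .
  also have "S * V * W = S" using assoc_mult_mat[OF S V W(1)] S by (simp add: VW)
  also have "(\<Sum>i<N0. S $$ (i, i)) = (\<Sum>i<N0. proj (\<Theta> s))"
  proof (intro sum.cong refl poly_mapping_eqI)
    fix k a assume "k \<in> {..<N0}"
    \<comment> \<open>\<open>\<rho> (en k)\<close> shifts the coefficient at \<open>a\<close> to
      \<open>a + en k\<close> with a power of \<epsilon>, which is 1 for \<open>a\<close> in
      \<open>Lat\<close>.\<close>
    then show "lookup (S $$ (k, k)) a = lookup (proj (\<Theta> s)) a"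
      by (auto simp: S_def lookup_coef centralizer_app_mono[OF hs] lookup_rho lookup_proj when_def
        eps_B_Lat \<Theta>_def)
  qed
  also have "(\<Sum>i<N0. D $$ (i, i)) = (\<Sum>i<N0. \<Theta> (?k i i))" by (simp add: D_def)
  finally show ?thesis using tr by simp
qed

text \<open>The involution that pairs a reduced exponent with its negative modulo \<open>l\<close>;
  it is continued by the identity to be a permutation in the sense of
  \<open>permutes\<close>.\<close>

definition \<sigma> :: "nat \<Rightarrow> nat" where
  "\<sigma> k = (if k < N0 then ix (red (- en k)) else k)"

lemma sigma: "k < N0 \<Longrightarrow> \<sigma> k < N0" "k < N0 \<Longrightarrow> en (\<sigma> k) = red (- en k)"
  by (simp_all add: \<sigma>_def ix_A en_ix red_A)

lemma add_Lat_iff: "\<alpha> \<in> A \<Longrightarrow> \<nu> \<in> A \<Longrightarrow> \<alpha> + \<nu> \<in> Lat \<longleftrightarrow> \<nu> = red (- \<alpha>)"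
  using red_unique[of \<nu> "- \<alpha>"] Lat_closed(3)[of "\<alpha> + \<nu>"] Lat_closed(3)[of "- \<alpha> - \<nu>"]
  by (auto simp: algebra_simps)

lemma sigma_permutes: "\<sigma> permutes {0..<N0}"
proof (rule bij_imp_permutes)
  have inv: "\<sigma> (\<sigma> k) = k" if "k < N0" for k
  proof -
    have "en k = red (- en (\<sigma> k))"
      using add_Lat_iff[OF en_A[OF that] en_A[OF sigma(1)[OF that]]] add_Lat_iff[OF en_A[OF sigma(1)[OF that]] en_A[OF that]]
        sigma(2)[OF that] by (simp add: add.commute)
    then show ?thesis using sigma[OF sigma(1)[OF that]] sigma(2)[of "\<sigma> k"] en_inj sigma(1) that by metis
  qed
  show "bij_betw \<sigma> {0..<N0} {0..<N0}"
    by (rule bij_betw_byWitness[of _ \<sigma>]) (use inv sigma(1) in auto)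
qed (simp add: \<sigma>_def)

text \<open>At a position in \<open>I\<close>, \<alpha> and its partner add up to \<open>l\<close>,
  or to 0 if \<alpha> vanishes there. The number of \<alpha> that do not vanish there is l^(mn) -
  l^(mn-1), which is L.\<close>

lemma sum_exponents:
  "(\<Sum>k = 0..<N0. en k + en (\<sigma> k)) = of_fun (\<lambda>_. int (l * (l ^ (m * n - 1) * (l - 1))))"
proof (rule poly_mapping_eqI)
  fix p
  have "(\<Sum>k = 0..<N0. en k + en (\<sigma> k)) = (\<Sum>\<alpha>\<in>A. \<alpha> + red (- \<alpha>))"
    using sum_en[of "\<lambda>\<alpha>. \<alpha> + red (- \<alpha>)"] sigma(2) by (simp add: atLeast0LessThan)
  then have e: "lookup (\<Sum>k = 0..<N0. en k + en (\<sigma> k)) p =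
      (\<Sum>\<alpha>\<in>A. lookup (\<alpha> + red (- \<alpha>)) p)" by (simp add: lookup_sum)
  show "lookup (\<Sum>k = 0..<N0. en k + en (\<sigma> k)) p =
      lookup (of_fun (\<lambda>_. int (l * (l ^ (m * n - 1) * (l - 1))))) p"
  proof (cases "p \<in> I")
    case False
    have "lookup (\<alpha> + red (- \<alpha>)) p = 0" if "\<alpha> \<in> A" for \<alpha>
    proof -
      have "p \<notin> keys \<alpha>" using that False unfolding A_def by blast
      then show ?thesis using False by (simp add: lookup_add red_def lookup_of_fun in_keys_iff)
    qed
    then show ?thesis using False by (simp add: e lookup_of_fun)
  next
    case True
    have "lookup (\<alpha> + red (- \<alpha>)) p = (if lookup \<alpha> p = 0 then 0 else int l)"
      if "\<alpha> \<in> A" for \<alpha>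
    proof -
      have b: "0 \<le> lookup \<alpha> p" "lookup \<alpha> p < int l" using that unfolding A_def by blast+
      have "(- lookup \<alpha> p) mod int l = int l - lookup \<alpha> p" if "lookup \<alpha> p \<noteq> 0"
        using b that by (simp add: zmod_zminus1_eq_if)
      then show ?thesis using True by (auto simp: lookup_add red_def lookup_of_fun)
    qed
    then have "(\<Sum>\<alpha>\<in>A. lookup (\<alpha> + red (- \<alpha>)) p) =
        (\<Sum>\<alpha>\<in>A. if lookup \<alpha> p = 0 then 0 else int l)" by (intro sum.cong) auto
    also have "\<dots> = (\<Sum>\<alpha>\<in>A - {\<alpha>\<in>A. keys \<alpha> \<subseteq> I - {p}}. int l)"
    proof (rule sum.mono_neutral_cong_right)
      have "keys \<alpha> \<subseteq> I - {p} \<longleftrightarrow> lookup \<alpha> p = 0" if "\<alpha> \<in> A" for \<alpha>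
      proof -
        have "keys \<alpha> \<subseteq> I" using that unfolding A_def by blast
        then show ?thesis by (auto simp: in_keys_iff)
      qed
      then show "\<forall>i\<in>A - (A - {\<alpha> \<in> A. keys \<alpha> \<subseteq> I - {p}}). (if lookup i p = 0 then 0 else int l) = 0"
        "\<And>x. x \<in> A - {\<alpha> \<in> A. keys \<alpha> \<subseteq> I - {p}} \<Longrightarrow> (if lookup x p = 0 then 0 else int l) = int l"
        by auto
    qed (use card_A in auto)
    also have "\<dots> = int (card (A - {\<alpha>\<in>A. keys \<alpha> \<subseteq> I - {p}})) * int l" by simp
    also have "card (A - {\<alpha>\<in>A. keys \<alpha> \<subseteq> I - {p}}) = l ^ (m * n) - l ^ (m * n - 1)"
    proof -
      have "card (I - {p}) = m * n - 1" using True by (simp add: I_def)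
      then show ?thesis using card_A card_A_on[of "I - {p}"] by (subst card_Diff_subset) auto
    qed
    also have "l ^ (m * n) - l ^ (m * n - 1) = l ^ (m * n - 1) * (l - 1)"
    proof -
      have "0 < m * n" using mn by simp
      then have "l ^ (m * n) = l ^ (m * n - 1) * l" by (metis Suc_diff_1 power_Suc2)
      then show ?thesis by (simp add: diff_mult_distrib2)
    qed
    finally show ?thesis using True by (simp add: e lookup_of_fun mult_ac)
  qed
qed

definition LL :: nat where "LL = l ^ (m * n - 1) * (l - 1)"

text \<open>The additional factor \<open>l\<close> in the exponent stems from \<open>t i j\<close>
  being the \<open>l\<close>-th power of the torus variable.\<close>

lemma prod_t: "(\<Prod>(i, j)\<in>I. t i j) ^ LL = tmon (of_fun (\<lambda>_. int (l * (l ^ (m * n - 1) * (l - 1)))))"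
proof -
  have "(\<Sum>i<k. (single p c :: expo)) = single p (int k * c)" for k p c
    by (induction k) (auto simp: single_add[symmetric] algebra_simps)
  then have "t i j ^ LL = tmon (single (i, j) (int (l * LL)))" for i j
    by (simp add: t_def single_power mult.commute)
  then have "(\<Prod>(i, j)\<in>I. t i j) ^ LL = (\<Prod>p\<in>I. tmon (single p (int (l * LL))))"
    by (simp add: prod_power_distrib split_beta)
  also have "\<dots> = tmon (of_fun (\<lambda>_. int (l * LL)))"
    by (simp add: prod_single of_fun_def)
  finally show ?thesis by (simp only: LL_def)
qed

text \<open>By bilinearity over \<open>Z\<close> the Gram matrix of \<open>y\<close> is
  \<open>W * (G * transpose_mat W)\<close> with \<open>G\<close> the Gram matrix of the torus
  monomials, so the two determinants differ by the square of the scalar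
  \<open>det W\<close>.\<close>

lemma Theta_discriminant:
  assumes b: "free_basis R C N b" and y: "free_basis R C N y"
  defines "d \<equiv> rdet CC N (\<lambda>i j. reg_trace R C N b (y i \<otimes>\<^bsub>R\<^esub> y j))"
  shows "d \<in> C \<and> (\<exists>u. u \<noteq> 0 \<and> \<Theta> d = cst u * (\<Prod>(i, j)\<in>I. t i j) ^ LL)"
proof -
  have N: "N = N0" by (rule basis_torus(1)[OF y])
  obtain W c where W: "W \<in> carrier_mat N0 N0" "\<forall>i<N0. \<forall>k<N0. W $$ (i, k) \<in> Z"
    "\<forall>i<N0. \<Theta> (y i) = (\<Sum>k<N0. W $$ (i, k) * tmon (en k))" "c \<noteq> 0" "det W = cst c"
    using basis_torus(2)[OF y] by blast
  have yi: "y i \<in> carrier R" if "i < N0" for i using y that N by (auto simp: free_basis_def)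
  \<comment> \<open>The factor \<open>of_nat N0\<close> is that of the trace; the power of
    \<epsilon> comes from the twisted product of two monomials.\<close>
  define G where "G = mat N0 N0 (\<lambda>(k, r). cst (of_nat N0) * proj (single (en k + en r) (\<epsilon> powi B (en k) (en r))))"
  have G: "G \<in> carrier_mat N0 N0" by (simp add: G_def)
  have tc: "reg_trace R C N b (y i \<otimes>\<^bsub>R\<^esub> y j) \<in> C"
    "\<Theta> (reg_trace R C N b (y i \<otimes>\<^bsub>R\<^esub> y j)) = cst (of_nat N0) * proj (app (h (y i)) (\<Theta> (y j)))"
    if "i < N0" "j < N0" for i j
    using Theta_reg_trace[OF b R.m_closed[OF yi[OF that(1)] yi[OF that(2)]]]
    unfolding Theta_hom(1)[OF yi[OF that(1)] yi[OF that(2)]] single_of_nat by blast+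
  \<comment> \<open>Comparing values at 1 lifts the expansion of \<open>\<Theta> (y i)\<close> to an
    identity of operators, which is needed because \<open>y i\<close> acts on the left in the
    product with \<open>y j\<close>.\<close>
  have hy: "h (y i) = (\<Sum>k<N0. mulop (W $$ (i, k)) * \<tau> (en k))" if i: "i < N0" for i
  proof (rule centralizer_eqI)
    show "h (y i) \<in> centralizer" by (rule h_centralizer[OF yi[OF i]])
    show "(\<Sum>k<N0. mulop (W $$ (i, k)) * \<tau> (en k)) \<in> centralizer"
      using W(2) i by (intro centralizer_sum centralizer_closed(4) mulop_centralizer tau_centralizer) auto
    have "app (\<tau> a) 1 = tmon a" for a using app_tau[of a 0 1] by simp
    then show "app (h (y i)) 1 = app (\<Sum>k<N0. mulop (W $$ (i, k)) * \<tau> (en k)) 1"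
      using W(3) i by (simp add: app_sum_op \<Theta>_def)
  qed
  have "mat N N (\<lambda>(i, j). \<Theta> (reg_trace R C N b (y i \<otimes>\<^bsub>R\<^esub> y j))) = W * (G * transpose_mat W)"
  proof (rule eq_matI)
    fix i j assume "i < dim_row (W * (G * transpose_mat W))" "j < dim_col (W * (G * transpose_mat W))"
    then have ij: "i < N0" "j < N0" using W G by auto
    have WZ: "W $$ (i, k) \<in> Z" "W $$ (j, k) \<in> Z" if "k < N0" for k using W(2) ij that by auto
    have "app (h (y i)) (\<Theta> (y j)) = (\<Sum>k<N0. W $$ (i, k) * (\<Sum>r<N0. W $$ (j, r) * app (\<tau> (en k)) (tmon (en r))))"
    proof -
      have "app (\<tau> a) (\<Theta> (y j)) = (\<Sum>r<N0. W $$ (j, r) * app (\<tau> a) (tmon (en r)))" for a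
      proof -
        have "\<Theta> (y j) = (\<Sum>r<N0. W $$ (j, r) * tmon (en r))" using W(3) ij(2) by blast
        then have "app (\<tau> a) (\<Theta> (y j)) = (\<Sum>r<N0. app (\<tau> a) (W $$ (j, r) * tmon (en r)))"
          by (simp only: app_sum)
        then show ?thesis
          using WZ(2) by (simp add: centralizer_Z_linear[OF tau_centralizer])
      qed
      then show ?thesis by (simp add: hy[OF ij(1)] app_sum_op)
    qed
    also have "\<dots> = (\<Sum>k<N0. W $$ (i, k) * (\<Sum>r<N0. W $$ (j, r) * single (en k + en r) (\<epsilon> powi B (en k) (en r))))"
      by (simp add: app_tau)
    finally have "cst (of_nat N0) * proj (app (h (y i)) (\<Theta> (y j))) =
        cst (of_nat N0) * (\<Sum>k<N0. W $$ (i, k) * (\<Sum>r<N0. W $$ (j, r) * proj (single (en k + en r) (\<epsilon> powi B (en k) (en r)))))"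
      using WZ by (auto simp: proj_sum proj_Z_mult intro!: sum.cong arg_cong[where f = "(*) _"] simp del: proj_single)
    also have "\<dots> = (\<Sum>k<N0. W $$ (i, k) * (\<Sum>r<N0. G $$ (k, r) * W $$ (j, r)))"
      by (auto simp: G_def sum_distrib_left mult_ac intro!: sum.cong)
    also have "\<dots> = (\<Sum>k<N0. W $$ (i, k) * (G * transpose_mat W) $$ (k, j))"
    proof (intro sum.cong refl arg_cong2[where f = "(*)"])
      fix k assume "k \<in> {..<N0}"
      then have k: "k < N0" by simp
      have WT: "transpose_mat W \<in> carrier_mat N0 N0" using W(1) by simp
      show "(\<Sum>r<N0. G $$ (k, r) * W $$ (j, r)) = (G * transpose_mat W) $$ (k, j)"
        unfolding index_mult_mat_sum[OF G WT k ij(2)] using W(1) ij(2) by (intro sum.cong) auto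
    qed
    also have "\<dots> = (W * (G * transpose_mat W)) $$ (i, j)"
      using index_mult_mat_sum[OF W(1), of "G * transpose_mat W" N0 i j] W(1) G ij by simp
    finally show "mat N N (\<lambda>(i, j). \<Theta> (reg_trace R C N b (y i \<otimes>\<^bsub>R\<^esub> y j))) $$ (i, j) = (W * (G * transpose_mat W)) $$ (i, j)"
      using tc(2)[OF ij] ij N by simp
  qed (use W G N in auto)
  moreover have "\<Theta> d = det (mat N N (\<lambda>(i, j). \<Theta> (reg_trace R C N b (y i \<otimes>\<^bsub>R\<^esub> y j)))) \<and> d \<in> C"
    unfolding d_def by (rule Theta_rdet) (use tc(1) N in auto)
  ultimately have d: "\<Theta> d = det (W * (G * transpose_mat W))" "d \<in> C" by auto
  have "det (W * (G * transpose_mat W)) = cst (c * c) * det G"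
    using det_mult[OF W(1), of "G * transpose_mat W"] det_mult[OF G, of "transpose_mat W"] det_transpose[OF W(1)] W(1,5) G
    by (simp add: cst_mult mult_ac)
  moreover have "det G = of_int (sign \<sigma>) * (\<Prod>i = 0..<N0. G $$ (i, \<sigma> i))"
  proof (rule det_monomial_matrix[OF G sigma_permutes])
    fix i j assume ij: "i < N0" "j < N0" "j \<noteq> \<sigma> i"
    then have "en i + en j \<notin> Lat"
      using add_Lat_iff[OF en_A[OF ij(1)] en_A[OF ij(2)]] sigma[OF ij(1)] en_inj[OF ij(2) sigma(1)[OF ij(1)]] by auto
    then show "G $$ (i, j) = 0" using ij by (simp add: G_def proj_single)
  qed
  moreover have "(\<Prod>i = 0..<N0. G $$ (i, \<sigma> i)) =
      (\<Prod>i = 0..<N0. single (en i + en (\<sigma> i)) (of_nat N0 * \<epsilon> powi B (en i) (en (\<sigma> i))))"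
  proof (intro prod.cong refl)
    fix i assume "i \<in> {0..<N0}"
    then have i: "i < N0" by simp
    then have "en i + en (\<sigma> i) \<in> Lat"
      using add_Lat_iff[OF en_A[OF i] en_A[OF sigma(1)[OF i]]] sigma[OF i] by auto
    then show "G $$ (i, \<sigma> i) = single (en i + en (\<sigma> i)) (of_nat N0 * \<epsilon> powi B (en i) (en (\<sigma> i)))"
      using i sigma(1)[OF i] by (simp add: G_def proj_single mult_single del: single_of_nat)
  qed
  moreover define v where "v = (\<Prod>i = 0..<N0. of_nat N0 * \<epsilon> powi B (en i) (en (\<sigma> i)))"
  ultimately have "\<Theta> d = cst (c * c) * (of_int (sign \<sigma>) * (cst v * (\<Prod>(i, j)\<in>I. t i j) ^ LL))"
    by (simp only: d prod_single sum_exponents prod_t)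
  also have "\<dots> = cst (c * c * of_int (sign \<sigma>) * v) * (\<Prod>(i, j)\<in>I. t i j) ^ LL"
    by (simp add: cst_mult mult_ac)
  finally have "\<Theta> d = cst (c * c * of_int (sign \<sigma>) * v) * (\<Prod>(i, j)\<in>I. t i j) ^ LL" .
  moreover have "v \<noteq> 0" using N0_nz by (simp add: v_def)
  then have "c * c * of_int (sign \<sigma>) * v \<noteq> 0" using W(4) by (cases \<sigma> rule: sign_cases) auto
  ultimately show ?thesis using d(2) by blast
qed

section \<open>The product of minors and the comparison in the Laurent ring\<close>

lemma CC_eq: "Ceps m n l \<epsilon> = CC"
  by (simp add: Ceps_def C_def)

text \<open>The entries become those of the classical path matrix at its final stage, and
  \<open>a' = m \<or> b' = n\<close> is the condition of \<open>solid_minor_frozen\<close>.\<close>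

lemma Theta_Delta:
  assumes "1 \<le> a" "1 \<le> b" "a + d = Suc a'" "b + d = Suc b'" "a' \<le> m" "b' \<le> n" "a' = m \<or> b' = n"
  shows "\<Theta> (Delta m n l \<epsilon> {a..a'} {b..b'}) = (\<Prod>r<d. t (a + r) (b + r)) \<and> Delta m n l \<epsilon> {a..a'} {b..b'} \<in> C"
proof -
  have s: "sorted_list_of_set {x..x'} ! r = x + r" if "r < d" "x + d = Suc x'" for x x' r :: nat
  proof -
    have "sorted_list_of_set {x..x'} = [x..<Suc x']"
      using sorted_list_of_set_range[of x "Suc x'"] by (simp add: atLeastLessThanSuc_atLeastAtMost)
    then show ?thesis using that by (simp add: nth_upt del: upt_Suc)
  qed
  have ij: "(a + r, b + k) \<in> I" if "r < d" "k < d" for r k using that assms by (auto simp: I_def)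
  have D: "Delta m n l \<epsilon> {a..a'} {b..b'} =
      rdet CC d (\<lambda>r k. zgen m n l \<epsilon> (sorted_list_of_set {a..a'} ! r) (sorted_list_of_set {b..b'} ! k))"
  proof -
    have "Suc a' - a = d" using assms(3) by simp
    then show ?thesis by (simp add: Delta_def rminor_def CC_eq)
  qed
  have "\<Theta> (Delta m n l \<epsilon> {a..a'} {b..b'}) = det (mat d d (\<lambda>(r, k).
      \<Theta> (zgen m n l \<epsilon> (sorted_list_of_set {a..a'} ! r) (sorted_list_of_set {b..b'} ! k)))) \<and> Delta m n l \<epsilon> {a..a'} {b..b'} \<in> C"
    unfolding D by (rule Theta_rdet) (use s assms ij C_mem(2) in simp)
  moreover have "mat d d (\<lambda>(r, k). \<Theta> (zgen m n l \<epsilon> (sorted_list_of_set {a..a'} ! r) (sorted_list_of_set {b..b'} ! k))) =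
      mat d d (\<lambda>(r, k). path_matrix t ti n m (a + r) (b + k))"
    by (rule eq_matI) (use s assms ij Theta_zgen in \<open>simp_all add: \<zeta>_def\<close>)
  moreover have "det (mat d d (\<lambda>(r, k). path_matrix t ti n m (a + r) (b + k))) = (\<Prod>r<d. t (a + r) (b + r))"
    using C.solid_minor_frozen[of a d m b] assms by (auto simp: C.solid_minor_def)
  ultimately show ?thesis by simp
qed

lemma Theta_pow: "x \<in> C \<Longrightarrow> \<Theta> (x [^]\<^bsub>CC\<^esub> (k::nat)) = \<Theta> x ^ k \<and> x [^]\<^bsub>CC\<^esub> k \<in> C"
proof (induction k)
  case 0
  then show ?case using Theta_CC(3) CC.one_closed CC.nat_pow_0 by simp
next
  case (Suc k)
  then have IH: "\<Theta> (x [^]\<^bsub>CC\<^esub> k) = \<Theta> x ^ k" "x [^]\<^bsub>CC\<^esub> k \<in> C" by auto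
  have "x [^]\<^bsub>CC\<^esub> Suc k = x [^]\<^bsub>CC\<^esub> k \<otimes>\<^bsub>CC\<^esub> x" by (rule CC.nat_pow_Suc)
  then show ?case
    using Theta_CC(1)[OF IH(2) Suc.prems] CC.m_closed[of "x [^]\<^bsub>CC\<^esub> k" x] IH Suc.prems by (simp add: mult.commute)
qed

abbreviation minors_product :: "'k qfree set set" where
  "minors_product \<equiv>
    (\<Otimes>\<^bsub>CC\<^esub>j\<in>{1..m - 1}.
        (Delta m n l \<epsilon> {m - j + 1..m} {1..j} [^]\<^bsub>CC\<^esub> LL) \<otimes>\<^bsub>CC\<^esub>
        (Delta m n l \<epsilon> {1..j} {n - j + 1..n} [^]\<^bsub>CC\<^esub> LL))
     \<otimes>\<^bsub>CC\<^esub> (\<Otimes>\<^bsub>CC\<^esub>k\<in>{1..n - m + 1}. Delta m n l \<epsilon> {1..m} {k..m + k - 1} [^]\<^bsub>CC\<^esub> LL)"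

lemma Theta_minors_product: "\<Theta> minors_product = (\<Prod>(i, j)\<in>I. t i j) ^ LL \<and> minors_product \<in> C"
proof -
  let ?D1 = "\<lambda>j. Delta m n l \<epsilon> {m - j + 1..m} {1..j}"
  let ?D2 = "\<lambda>j. Delta m n l \<epsilon> {1..j} {n - j + 1..n}"
  let ?D3 = "\<lambda>k. Delta m n l \<epsilon> {1..m} {k..m + k - 1}"
  have 1: "\<Theta> (?D1 j) = (\<Prod>r<j. t (m - j + 1 + r) (1 + r)) \<and> ?D1 j \<in> C" if "j \<in> {1..m - 1}" for j
    using that mn by (intro Theta_Delta) auto
  have 2: "\<Theta> (?D2 j) = (\<Prod>r<j. t (1 + r) (n - j + 1 + r)) \<and> ?D2 j \<in> C" if "j \<in> {1..m - 1}" for j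
    using that mn by (intro Theta_Delta) auto
  have 3: "\<Theta> (?D3 k) = (\<Prod>r<m. t (1 + r) (k + r)) \<and> ?D3 k \<in> C" if "k \<in> {1..n - m + 1}" for k
    using that mn by (intro Theta_Delta) auto
  let ?F = "\<lambda>j. (?D1 j [^]\<^bsub>CC\<^esub> LL) \<otimes>\<^bsub>CC\<^esub> (?D2 j [^]\<^bsub>CC\<^esub> LL)"
  have F: "\<Theta> (?F j) = ((\<Prod>r<j. t (m - j + 1 + r) (1 + r)) * (\<Prod>r<j. t (1 + r) (n - j + 1 + r))) ^ LL \<and> ?F j \<in> C"
    if "j \<in> {1..m - 1}" for j
    using 1[OF that] 2[OF that] Theta_pow[of "?D1 j" LL] Theta_pow[of "?D2 j" LL]
      Theta_CC(1)[of "?D1 j [^]\<^bsub>CC\<^esub> LL" "?D2 j [^]\<^bsub>CC\<^esub> LL"] CC.m_closed[of "?D1 j [^]\<^bsub>CC\<^esub> LL" "?D2 j [^]\<^bsub>CC\<^esub> LL"]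
    by (simp add: power_mult_distrib)
  have FF: "\<Theta> (\<Otimes>\<^bsub>CC\<^esub>j\<in>{1..m - 1}. ?F j) = (\<Prod>j\<in>{1..m - 1}. \<Theta> (?F j)) \<and> (\<Otimes>\<^bsub>CC\<^esub>j\<in>{1..m - 1}. ?F j) \<in> C"
    by (rule Theta_finprod_CC) (use F in blast, simp)
  have P3: "\<Theta> (?D3 k [^]\<^bsub>CC\<^esub> LL) = (\<Prod>r<m. t (1 + r) (k + r)) ^ LL \<and> ?D3 k [^]\<^bsub>CC\<^esub> LL \<in> C" if "k \<in> {1..n - m + 1}" for k
    using 3[OF that] Theta_pow[of "?D3 k" LL] by simp
  have GG: "\<Theta> (\<Otimes>\<^bsub>CC\<^esub>k\<in>{1..n - m + 1}. ?D3 k [^]\<^bsub>CC\<^esub> LL) = (\<Prod>k\<in>{1..n - m + 1}. \<Theta> (?D3 k [^]\<^bsub>CC\<^esub> LL)) \<and>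
      (\<Otimes>\<^bsub>CC\<^esub>k\<in>{1..n - m + 1}. ?D3 k [^]\<^bsub>CC\<^esub> LL) \<in> C"
    by (rule Theta_finprod_CC) (use P3 in blast, simp)
  have "\<Theta> minors_product = (\<Prod>j\<in>{1..m - 1}. \<Theta> (?F j)) * (\<Prod>k\<in>{1..n - m + 1}. \<Theta> (?D3 k [^]\<^bsub>CC\<^esub> LL))"
    using Theta_CC(1)[OF conjunct2[OF FF] conjunct2[OF GG]]
    unfolding conjunct1[OF FF] conjunct1[OF GG] .
  also have "\<dots> = (\<Prod>j\<in>{1..m - 1}. ((\<Prod>r<j. t (m - j + 1 + r) (1 + r)) * (\<Prod>r<j. t (1 + r) (n - j + 1 + r))) ^ LL) *
      (\<Prod>k\<in>{1..n - m + 1}. (\<Prod>r<m. t (1 + r) (k + r)) ^ LL)"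
    using F P3 by (intro arg_cong2[where f = "(*)"] prod.cong) blast+
  also have "\<dots> = ((\<Prod>j\<in>{1..m - 1}. (\<Prod>r<j. t (m - j + 1 + r) (1 + r)) * (\<Prod>r<j. t (1 + r) (n - j + 1 + r))) *
      (\<Prod>k\<in>{1..n - m + 1}. \<Prod>r<m. t (1 + r) (k + r))) ^ LL"
    by (simp only: prod_power_distrib power_mult_distrib)
  also have "\<dots> = (\<Prod>(i, j)\<in>I. t i j) ^ LL"
    by (simp only: prod_diagonals[OF mn] I_def)
  finally have "\<Theta> minors_product = (\<Prod>(i, j)\<in>I. t i j) ^ LL" .
  moreover have "minors_product \<in> C"
    using FF GG
      CC.m_closed[of "\<Otimes>\<^bsub>CC\<^esub>j\<in>{1..m - 1}. ?F j" "\<Otimes>\<^bsub>CC\<^esub>k\<in>{1..n - m + 1}. ?D3 k [^]\<^bsub>CC\<^esub> LL"] by simp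
  ultimately show ?thesis by blast
qed

lemma discriminant_exists: "\<exists>d. is_discriminant R C d"
  unfolding is_discriminant_def using central_subring_C free_basis_xm by blast

text \<open>Both sides lie in \<open>C\<close> and have the same image under \<Theta>, so
  injectivity turns the computation in the Laurent ring into an equation in the algebra
  itself.\<close>

lemma discriminant_formula:
  assumes "is_discriminant R C d"
  shows "\<exists>u. u \<noteq> 0 \<and> d = Reps_scalar m n \<epsilon> u \<otimes>\<^bsub>CC\<^esub> minors_product"
proof -
  obtain N b y where b: "free_basis R C N b" "free_basis R C N y"
    "d = rdet CC N (\<lambda>i j. reg_trace R C N b (y i \<otimes>\<^bsub>R\<^esub> y j))"
    using assms unfolding is_discriminant_def by blast
  obtain u where u: "u \<noteq> 0" "\<Theta> d = cst u * (\<Prod>(i, j)\<in>I. t i j) ^ LL" and d: "d \<in> C"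
    using Theta_discriminant[OF b(1,2)] unfolding b(3) by blast
  have mp: "\<Theta> minors_product = (\<Prod>(i, j)\<in>I. t i j) ^ LL" "minors_product \<in> C"
    using Theta_minors_product by blast+
  have "\<Theta> (Reps_scalar m n \<epsilon> u \<otimes>\<^bsub>CC\<^esub> minors_product) = \<Theta> d"
    unfolding Theta_CC(1)[OF C_mem(1) mp(2)] mp(1) u(2) Theta_scalar ..
  moreover have "Reps_scalar m n \<epsilon> u \<otimes>\<^bsub>CC\<^esub> minors_product \<in> C"
    using CC.m_closed[of "Reps_scalar m n \<epsilon> u" minors_product] C_mem(1) mp(2) by simp
  ultimately have "d = Reps_scalar m n \<epsilon> u \<otimes>\<^bsub>CC\<^esub> minors_product"
    using d by (intro Theta_inj) (auto simp: C_carrier)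
  then show ?thesis using u(1) by blast
qed

end

theorem theorem5p7:
  fixes \<epsilon> :: "'k::field_char_0" and l m n L :: nat
  assumes "l > 2" and "odd l"
    and "primitive_root_of_unity l \<epsilon>"
    and "0 < m" and "m \<le> n"
    and "L = l ^ (m * n - 1) * (l - 1)"
  shows "(\<exists>d. is_discriminant (Reps m n \<epsilon>) (Ceps_carrier m n l \<epsilon>) d) \<and>
    (\<forall>d. is_discriminant (Reps m n \<epsilon>) (Ceps_carrier m n l \<epsilon>) d \<longrightarrow>
      (\<exists>u::'k. u \<noteq> 0 \<and>
        d = Reps_scalar m n \<epsilon> u \<otimes>\<^bsub>Ceps m n l \<epsilon>\<^esub>
          ((\<Otimes>\<^bsub>Ceps m n l \<epsilon>\<^esub>j\<in>{1..m - 1}.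
              (Delta m n l \<epsilon> {m - j + 1..m} {1..j} [^]\<^bsub>Ceps m n l \<epsilon>\<^esub> L)
              \<otimes>\<^bsub>Ceps m n l \<epsilon>\<^esub>
              (Delta m n l \<epsilon> {1..j} {n - j + 1..n} [^]\<^bsub>Ceps m n l \<epsilon>\<^esub> L))
           \<otimes>\<^bsub>Ceps m n l \<epsilon>\<^esub>
           (\<Otimes>\<^bsub>Ceps m n l \<epsilon>\<^esub>k\<in>{1..n - m + 1}.
              Delta m n l \<epsilon> {1..m} {k..m + k - 1} [^]\<^bsub>Ceps m n l \<epsilon>\<^esub> L))))"
proof -
  interpret QS: quantum_setup m n l \<epsilon>
    using assms by unfold_locales
  have L: "L = QS.LL" by (simp add: assms(6) QS.LL_def)
  show ?thesis
    unfolding QS.CC_eq L QS.C_def[symmetric]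
    using QS.discriminant_exists QS.discriminant_formula by blast
qed

end
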